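(* Let $\mathbb{K}$ be a field of characteristic $2$ and let $A=\mathfrak{U}_{\mathbb{K}}(sl_3^+)$ be the Kostant form over $\mathbb{K}$, with its grading. Then the trivial module $\mathbb{K}$ over $A$ has a minimal (graded) projective resolution whose first terms are of the form $$\left( \bigoplus_{k\ge 0} A[2^{k+1}]^{\oplus 2} \right) \oplus \left( \bigoplus_{0\le k < l} A[2^l+2^k]^{\oplus 4} \right)\longrightarrow \bigoplus_{k=0}^{\infty} A[2^k]^{\oplus 2} \longrightarrow A \longrightarrow \mathbb{K}\longrightarrow 0.$$
   Context: Let $sl_3^+$ be the complex Lie algebra of strictly upper triangular $3\times 3$ matrices with basis the matrix units $e_{12},e_{13},e_{23}$, and let $\mathfrak{U}_3(\mathbb{C})$ be its universal enveloping algebra. Put $e_{ij}^{(k)}=\frac{1}{k!}e_{ij}^k$. Fix a total order on $\{e_{12},e_{13},e_{23}\}$; all products $\prod_{i<j}$ are taken with factors increasing from left to right in this order. $\mathfrak{U}_3(\mathbb{Z})$ is the $\mathbb{Z}$-span in $\mathfrak{U}_3(\mathbb{C})$ of the products $\prod_{i<j}e_{ij}^{(k_{ij})}$, $k_{ij}\ge 0$ (these form a $\mathbb{Z}$-basis); it is a subring. The Kostant form over $\mathbb{K}$ is $\mathfrak{U}_{\mathbb{K}}(sl_3^+)=\mathbb{K}\otimes_{\mathbb{Z}}\mathfrak{U}_3(\mathbb{Z})$. It is graded by non-negative integers, $e_{ij}^{(k)}$ having degree $k(j-i)$; its degree-zero component is $\mathbb{K}$. The trivial module $\mathbb{K}$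 is the one-dimensional left module, placed in degree $0$, on which all elements of positive degree act by zero. $A[s]$ denotes the free graded left $A$-module generated by one element of degree $s$. For a free graded module $P=\bigoplus_\alpha A v_\alpha$ with homogeneous basis $(v_\alpha)$, $\mathrm{Rad}(P)=\bigoplus_\alpha A_{\ge 1}v_\alpha$, where $A_{\geq 1}=\bigoplus_{d\ge1}A_d$. Every graded projective module here is a direct sum of modules $A[s]$. A graded projective resolution $\cdots\to F_2\to F_1\to F_0\to M\to 0$ (with degree-preserving maps) is minimal if the image of each $F_{i+1}\to F_i$ is contained in $\mathrm{Rad}(F_i)$. In the claim, the displayed terms are $F_2\to F_1\to F_0\to\mathbb{K}\to 0$. *)

theory Defs
  imports
    "HOL-Analysis.Analysis"
    "HOL-Library.Poly_Mapping"
    "HOL-Computational_Algebra.Group_Closure"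
begin

section \<open>Free monoids, free algebras, two-sided ideals\<close>

datatype 'a free_monoid = FM "'a list"

instantiation free_monoid :: (type) monoid_add
begin

definition zero_free_monoid :: "'a free_monoid" where "0 = FM []"

fun plus_free_monoid :: "'a free_monoid \<Rightarrow> 'a free_monoid \<Rightarrow> 'a free_monoid" where
  "FM xs + FM ys = FM (xs @ ys)"

instance
proof
  fix a b c :: "'a free_monoid"
  show "a + b + c = a + (b + c)" by (cases a; cases b; cases c) simp
  show "0 + a = a" "a + 0 = a" by (cases a; simp add: zero_free_monoid_def)+
qed

end

lemma free_monoid_add_eq_0: "a + b = 0 \<longleftrightarrow> a = 0 \<and> b = (0 :: 'a free_monoid)"
  by (cases a; cases b) (simp add: zero_free_monoid_def)

definition two_sided_ideal :: "'a::ring_1 set \<Rightarrow> 'a set" where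
  "two_sided_ideal S = group_closure {a * s * b | a s b. s \<in> S}"

lemma group_closure_subset:
  assumes "S \<subseteq> T" "0 \<in> T" "\<And>x y. x \<in> T \<Longrightarrow> y \<in> T \<Longrightarrow> x - y \<in> T"
  shows "group_closure S \<subseteq> T"
proof
  fix x assume "x \<in> group_closure S"
  then show "x \<in> T" by induction (use assms in auto)
qed

lemma group_closure_mono_in:
  assumes "S \<subseteq> group_closure T" shows "group_closure S \<subseteq> group_closure T"
  by (rule group_closure_subset) (use assms group_closure.diff in auto)

lemma in_group_closure: "s \<in> S \<Longrightarrow> s \<in> group_closure S"
  by (rule group_closure.base) simp

lemma group_closure_sum: "(\<And>i. i \<in> I \<Longrightarrow> f i \<in> group_closure S) \<Longrightarrow> sum f I \<in> group_closure S"
  by (induction I rule: infinite_finite_induct) (auto intro: group_closure_add)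

lemma group_closure_of_nat_mult:
  fixes x :: "'a::ring_1"
  assumes "x \<in> group_closure S" shows "of_nat n * x \<in> group_closure S"
  by (induction n) (auto simp: algebra_simps intro: assms group_closure_add)

lemma group_closure_mult:
  fixes x y :: "'a::ring"
  assumes "x \<in> group_closure S" "y \<in> group_closure T"
    and *: "\<And>s t. s \<in> S \<Longrightarrow> t \<in> T \<Longrightarrow> s * t \<in> group_closure U"
  shows "x * y \<in> group_closure U"
  using assms(1)
proof induction
  case (base s)
  show ?case using assms(2)
    by induction (use base * in \<open>auto simp: right_diff_distrib intro: group_closure.diff\<close>)
next
  case (diff s t)
  then show ?case by (auto simp: left_diff_distrib intro: group_closure.diff)
qed

lemma two_sided_ideal_diff:
  "x \<in> two_sided_ideal S \<Longrightarrow> y \<in> two_sided_ideal S \<Longrightarrow> x - y \<in> two_sided_ideal S"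
  unfolding two_sided_ideal_def by (rule group_closure.diff)

lemma two_sided_ideal_zero [simp]: "0 \<in> two_sided_ideal S"
  unfolding two_sided_ideal_def by simp

lemma two_sided_ideal_uminus: "x \<in> two_sided_ideal S \<Longrightarrow> - x \<in> two_sided_ideal S"
  using two_sided_ideal_diff[of 0 S x] by simp

lemma two_sided_ideal_add:
  "x \<in> two_sided_ideal S \<Longrightarrow> y \<in> two_sided_ideal S \<Longrightarrow> x + y \<in> two_sided_ideal S"
  using two_sided_ideal_diff[of x S "- y"] two_sided_ideal_uminus by auto

lemma two_sided_ideal_base: "s \<in> S \<Longrightarrow> s \<in> two_sided_ideal S"
  unfolding two_sided_ideal_def
  by (rule in_group_closure) (metis (mono_tags, lifting) mem_Collect_eq mult_1 mult_1_right)

lemma two_sided_ideal_mult: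
  assumes "x \<in> two_sided_ideal S"
  shows "a * x \<in> two_sided_ideal S" "x * a \<in> two_sided_ideal S"
proof -
  show "a * x \<in> two_sided_ideal S" using assms unfolding two_sided_ideal_def
  proof induction
    case (base s)
    then consider "s = 0" | c t d where "s = c * t * d" "t \<in> S" by auto
    then show ?case
    proof cases
      case 2
      then have "a * s = (a * c) * t * d" by (simp add: mult.assoc)
      with 2 show ?thesis by (intro in_group_closure) blast
    qed simp
  qed (auto simp: right_diff_distrib intro: group_closure.diff)
  show "x * a \<in> two_sided_ideal S" using assms unfolding two_sided_ideal_def
  proof induction
    case (base s)
    then consider "s = 0" | c t d where "s = c * t * d" "t \<in> S" by auto
    then show ?case
    proof cases
      case 2
      then have "s * a = c * t * (d * a)" by (simp add: mult.assoc)
      with 2 show ?thesis by (intro in_group_closure) blast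
    qed simp
  qed (auto simp: left_diff_distrib intro: group_closure.diff)
qed

section \<open>The Lie algebra of strictly upper triangular matrices\<close>

typedef sl3_plus =
  "{M :: complex^3^3. M$1$1 = 0 \<and> M$2$1 = 0 \<and> M$2$2 = 0 \<and> M$3$1 = 0 \<and> M$3$2 = 0 \<and> M$3$3 = 0}"
  by (rule exI[of _ 0]) simp

setup_lifting type_definition_sl3_plus

lift_definition sl3_add :: "sl3_plus \<Rightarrow> sl3_plus \<Rightarrow> sl3_plus" is "\<lambda>M N. M + N"
  by simp

lift_definition sl3_scale :: "complex \<Rightarrow> sl3_plus \<Rightarrow> sl3_plus" is "\<lambda>c M. \<chi> i j. c * M$i$j"
  by simp

lift_definition sl3_bracket :: "sl3_plus \<Rightarrow> sl3_plus \<Rightarrow> sl3_plus" is "\<lambda>M N. M ** N - N ** M"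
  by (simp add: matrix_matrix_mult_def sum_3)

datatype root = R12 | R13 | R23

fun root_row :: "root \<Rightarrow> 3" where "root_row R12 = 1" | "root_row R13 = 1" | "root_row R23 = 2"
fun root_col :: "root \<Rightarrow> 3" where "root_col R12 = 2" | "root_col R13 = 3" | "root_col R23 = 3"

text \<open>The height is column index minus row index (not computed in the type \<open>3\<close>,
  where \<open>3 = 0\<close>).\<close>

fun height :: "root \<Rightarrow> nat" where "height R12 = 1" | "height R13 = 2" | "height R23 = 1"

lift_definition matrix_unit :: "root \<Rightarrow> sl3_plus"
  is "\<lambda>\<alpha>. \<chi> i j. if i = root_row \<alpha> \<and> j = root_col \<alpha> then 1 else 0"
  subgoal for \<alpha> by (cases \<alpha>) simp_all
  done

section \<open>The universal enveloping algebra over the complex numbers\<close>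

text \<open>The quotient of the free algebra on the underlying set of the Lie algebra by linearity of
  the inclusion and by \<open>x y - y x = [x, y]\<close>.\<close>

definition free_gen :: "'a \<Rightarrow> 'a free_monoid \<Rightarrow>\<^sub>0 complex" where
  "free_gen x = Poly_Mapping.single (FM [x]) 1"

definition uea_relators :: "(sl3_plus free_monoid \<Rightarrow>\<^sub>0 complex) set" where
  "uea_relators =
     {free_gen (sl3_add x y) - free_gen x - free_gen y | x y. True} \<union>
     {free_gen (sl3_scale c x) - Poly_Mapping.single 0 c * free_gen x | c x. True} \<union>
     {free_gen x * free_gen y - free_gen y * free_gen x - free_gen (sl3_bracket x y) | x y. True}"

quotient_type uea = "sl3_plus free_monoid \<Rightarrow>\<^sub>0 complex" /
  "\<lambda>x y. x - y \<in> two_sided_ideal uea_relators"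
proof (rule equivpI)
  show "reflp (\<lambda>x y. x - y \<in> two_sided_ideal uea_relators)"
    by (rule reflpI) simp
  show "symp (\<lambda>x y. x - y \<in> two_sided_ideal uea_relators)"
    by (rule sympI) (use two_sided_ideal_uminus in fastforce)
  show "transp (\<lambda>x y. x - y \<in> two_sided_ideal uea_relators)"
    by (rule transpI) (use two_sided_ideal_add in fastforce)
qed

lemma lookup_mult_0:
  fixes f g :: "'a free_monoid \<Rightarrow>\<^sub>0 complex"
  shows "Poly_Mapping.lookup (f * g) 0 = Poly_Mapping.lookup f 0 * Poly_Mapping.lookup g 0"
proof -
  have "Sum_any (\<lambda>q. Poly_Mapping.lookup g q when (0::'a free_monoid) = l + q) =
        (Poly_Mapping.lookup g 0 when l = 0)" for l
  proof -
    have "(Poly_Mapping.lookup g q when (0::'a free_monoid) = l + q) =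
          ((Poly_Mapping.lookup g q when l = 0) when q = 0)" for q
      by (metis free_monoid_add_eq_0 when_def)
    then show ?thesis by simp
  qed
  then show ?thesis by (simp add: lookup_mult mult_when)
qed

lemma uea_ideal_lookup_0:
  assumes "f \<in> two_sided_ideal uea_relators" shows "Poly_Mapping.lookup f 0 = 0"
  using assms unfolding two_sided_ideal_def
proof induction
  case (base s)
  have gen: "Poly_Mapping.lookup (free_gen x) 0 = 0" for x :: sl3_plus
    by (simp add: free_gen_def lookup_single zero_free_monoid_def)
  have "Poly_Mapping.lookup r 0 = 0" if "r \<in> uea_relators" for r
    using that by (auto simp: uea_relators_def lookup_minus lookup_mult_0 gen)
  with base show ?case by (auto simp: lookup_mult_0)
qed (simp add: lookup_minus)

instantiation uea :: ring_1
begin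

lift_definition zero_uea :: uea is 0 .
lift_definition one_uea :: uea is 1 .
lift_definition plus_uea :: "uea \<Rightarrow> uea \<Rightarrow> uea" is "(+)"
  by (subst add_diff_add) (rule two_sided_ideal_add)
lift_definition minus_uea :: "uea \<Rightarrow> uea \<Rightarrow> uea" is "(-)"
proof -
  fix a b c d :: "sl3_plus free_monoid \<Rightarrow>\<^sub>0 complex"
  assume "a - b \<in> two_sided_ideal uea_relators" "c - d \<in> two_sided_ideal uea_relators"
  moreover have "(a - c) - (b - d) = (a - b) - (c - d)" by (simp add: algebra_simps)
  ultimately show "(a - c) - (b - d) \<in> two_sided_ideal uea_relators"
    by (simp only: two_sided_ideal_diff)
qed
lift_definition uminus_uea :: "uea \<Rightarrow> uea" is uminus
  using two_sided_ideal_uminus by fastforce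
lift_definition times_uea :: "uea \<Rightarrow> uea \<Rightarrow> uea" is "(*)"
proof -
  fix a b c d :: "sl3_plus free_monoid \<Rightarrow>\<^sub>0 complex"
  assume "a - b \<in> two_sided_ideal uea_relators" "c - d \<in> two_sided_ideal uea_relators"
  moreover have "a * c - b * d = (a - b) * c + b * (c - d)" by (simp add: algebra_simps)
  ultimately show "a * c - b * d \<in> two_sided_ideal uea_relators"
    by (simp add: two_sided_ideal_add two_sided_ideal_mult)
qed

instance
proof
  show "(0::uea) \<noteq> 1"
    by transfer (use uea_ideal_lookup_0 in \<open>fastforce simp: lookup_minus\<close>)
qed (transfer; simp add: algebra_simps)+

end

lift_definition uea_scale :: "complex \<Rightarrow> uea \<Rightarrow> uea" is "\<lambda>c f. Poly_Mapping.single 0 c * f"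
  by (simp add: two_sided_ideal_mult(1) flip: right_diff_distrib)

definition uea_incl :: "sl3_plus \<Rightarrow> uea" where "uea_incl x = abs_uea (free_gen x)"

abbreviation uea_e :: "root \<Rightarrow> uea" where "uea_e \<alpha> \<equiv> uea_incl (matrix_unit \<alpha>)"

definition divided_power :: "uea \<Rightarrow> nat \<Rightarrow> uea" where
  "divided_power x k = uea_scale (1 / fact k) (x ^ k)"

lemma single_0_commute:
  fixes f :: "'a::monoid_add \<Rightarrow>\<^sub>0 'b::comm_semiring_1"
  shows "Poly_Mapping.single 0 c * f = f * Poly_Mapping.single 0 c"
proof (rule poly_mapping_eqI)
  fix k
  have "((c when q = 0) when k = l + q) = ((c when k = l) when q = 0)" for l q :: 'a
    by (auto simp: when_def)
  moreover have "((c when 0 = l) when k = l + q) = (c when 0 = l)" if "k = q" for l q :: 'a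
    using that by (auto simp: when_def)
  ultimately show "Poly_Mapping.lookup (Poly_Mapping.single 0 c * f) k =
      Poly_Mapping.lookup (f * Poly_Mapping.single 0 c) k"
    by (simp add: lookup_mult lookup_single when_mult mult_when mult.commute)
qed

lemma single_0_left_commute:
  fixes f g :: "'a::monoid_add \<Rightarrow>\<^sub>0 'b::comm_semiring_1"
  shows "f * (Poly_Mapping.single 0 c * g) = Poly_Mapping.single 0 c * (f * g)"
  by (simp only: mult.assoc[symmetric] single_0_commute[of c f])

lemma uea_scale_simps:
  "uea_scale c (x + y) = uea_scale c x + uea_scale c y"
  "uea_scale (c + d) x = uea_scale c x + uea_scale d x"
  "uea_scale c (uea_scale d x) = uea_scale (c * d) x"
  "uea_scale 1 x = x"
  "uea_scale 0 x = 0"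
  "uea_scale c 0 = 0"
  "uea_scale c x * y = uea_scale c (x * y)"
  "x * uea_scale c y = uea_scale c (x * y)"
        apply (transfer; simp add: algebra_simps single_add)
       apply (transfer; simp add: algebra_simps single_add)
      apply (transfer; simp add: mult.assoc[symmetric] mult_single)
     apply (transfer; simp)
    apply (transfer; simp)
   apply (transfer; simp)
  apply (transfer; simp add: mult.assoc)
  apply (transfer; simp add: single_0_left_commute)
  done


lemma uea_scale_diff_minus:
  "uea_scale c (x - y) = uea_scale c x - uea_scale c y"
  "uea_scale c (- x) = - uea_scale c x"
  by (transfer; simp add: algebra_simps)+

lemma uea_scale_of_nat: "uea_scale (of_nat n) x = of_nat n * x"
  by (induction n) (simp_all add: uea_scale_simps algebra_simps)

lemma uea_bracket:
  "uea_incl x * uea_incl y - uea_incl y * uea_incl x = uea_incl (sl3_bracket x y)"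
proof -
  have "(free_gen x * free_gen y - free_gen y * free_gen x) - free_gen (sl3_bracket x y)
        \<in> two_sided_ideal uea_relators"
    by (rule two_sided_ideal_base) (auto simp: uea_relators_def)
  then show ?thesis
    by (simp add: uea_incl_def times_uea.abs_eq minus_uea.abs_eq uea.abs_eq_iff)
qed

lemma uea_incl_zero: "uea_incl (sl3_scale 0 x) = 0"
proof -
  have "free_gen (sl3_scale 0 x) - Poly_Mapping.single 0 0 * free_gen x \<in> two_sided_ideal uea_relators"
    by (rule two_sided_ideal_base) (unfold uea_relators_def, blast)
  then show ?thesis by (simp add: uea_incl_def zero_uea_def uea.abs_eq_iff)
qed

lemma sl3_brackets:
  "sl3_bracket (matrix_unit R12) (matrix_unit R23) = matrix_unit R13"
  "sl3_bracket (matrix_unit R12) (matrix_unit R13) = sl3_scale 0 (matrix_unit R13)"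
  "sl3_bracket (matrix_unit R23) (matrix_unit R13) = sl3_scale 0 (matrix_unit R13)"
  by (transfer; simp add: matrix_matrix_mult_def sum_3 vec_eq_iff forall_3)+

lemma uea_e_commute:
  "uea_e R12 * uea_e R23 = uea_e R23 * uea_e R12 + uea_e R13"
  "uea_e R12 * uea_e R13 = uea_e R13 * uea_e R12"
  "uea_e R23 * uea_e R13 = uea_e R13 * uea_e R23"
  using uea_bracket[of "matrix_unit R12" "matrix_unit R23"]
    uea_bracket[of "matrix_unit R12" "matrix_unit R13"]
    uea_bracket[of "matrix_unit R23" "matrix_unit R13"]
  by (simp_all add: sl3_brackets uea_incl_zero algebra_simps)

section \<open>The integral form\<close>

text \<open>A total order on the generators is given as the list \<open>r\<close> of all of them in increasing order;
  \<open>group_closure\<close> is the span over the integers.\<close>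

definition ordered_monomial :: "root list \<Rightarrow> (root \<Rightarrow> nat) \<Rightarrow> uea" where
  "ordered_monomial r k = prod_list (map (\<lambda>\<alpha>. divided_power (uea_e \<alpha>) (k \<alpha>)) r)"

definition weight :: "(root \<Rightarrow> nat) \<Rightarrow> nat" where
  "weight k = (\<Sum>\<alpha>\<in>{R12, R13, R23}. k \<alpha> * height \<alpha>)"

definition integral_form :: "root list \<Rightarrow> uea set" where
  "integral_form r = group_closure (range (ordered_monomial r))"

definition integral_form_component :: "root list \<Rightarrow> nat \<Rightarrow> uea set" where
  "integral_form_component r d = group_closure {ordered_monomial r k | k. weight k = d}"

lemma divided_power_0 [simp]: "divided_power x 0 = 1"
  by (simp add: divided_power_def uea_scale_simps)

lemma divided_power_commute:
  assumes "x * y = y * x"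
  shows "divided_power x k * divided_power y l = divided_power y l * divided_power x k"
proof -
  have "x ^ k * y ^ l = y ^ l * x ^ k"
    using assms power_commuting_commutes by metis
  then show ?thesis by (simp add: divided_power_def uea_scale_simps mult.commute)
qed

lemma mult_divided_power:
  "x * divided_power x k = uea_scale (of_nat (Suc k)) (divided_power x (Suc k))"
  by (simp add: divided_power_def uea_scale_simps field_simps del: of_nat_Suc)

lemma divided_power_mult:
  "divided_power x a * divided_power x b = of_nat ((a + b) choose a) * divided_power x (a + b)"
proof -
  have "divided_power x a * divided_power x b = uea_scale (1 / (fact a * fact b)) (x ^ (a + b))"
    by (simp add: divided_power_def uea_scale_simps power_add mult.commute)
  also have "1 / (fact a * fact b) = (of_nat ((a + b) choose a) :: complex) * (1 / fact (a + b))"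
    by (subst binomial_fact) auto
  finally show ?thesis
    by (simp add: divided_power_def uea_scale_simps flip: uea_scale_of_nat)
qed

lemma divided_power_uminus: "divided_power (- x) k = (- 1) ^ k * divided_power x k"
  by (cases "even k") (auto simp: divided_power_def uea_scale_diff_minus)

lemma divided_power_exchange:
  assumes xy: "x * y = y * x + z" and xz: "x * z = z * x" and yz: "y * z = z * y"
  shows "divided_power x a * divided_power y b =
    (\<Sum>j\<le>a. if j \<le> b then divided_power z j * divided_power y (b - j) * divided_power x (a - j) else 0)"
proof -
  define Y where "Y j = (if j \<le> b then divided_power y (b - j) else 0)" for j
  have xy': "x * divided_power y (Suc n) = divided_power y (Suc n) * x + z * divided_power y n" for n
  proof -
    have zy: "y ^ n * z = z * y ^ n" for n
      by (rule power_commuting_commutes[OF yz])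
    have "x * y ^ Suc n = y ^ Suc n * x + of_nat (Suc n) * (z * y ^ n)" for n
    proof (induction n)
      case 0
      show ?case by (simp add: xy)
    next
      case (Suc n)
      have "x * y ^ Suc (Suc n) = (x * y ^ Suc n) * y" by (simp only: power_Suc2 mult.assoc)
      also have "\<dots> = y ^ Suc n * (x * y) + of_nat (Suc n) * (z * y ^ Suc n)"
        by (simp only: Suc distrib_right mult.assoc) (simp only: power_Suc2)
      also have "\<dots> = y ^ Suc n * y * x + y ^ Suc n * z + of_nat (Suc n) * (z * y ^ Suc n)"
        by (simp only: xy distrib_left mult.assoc)
      also have "\<dots> = y ^ Suc (Suc n) * x + z * y ^ Suc n + of_nat (Suc n) * (z * y ^ Suc n)"
        by (simp only: zy power_Suc2[of y "Suc n"])
      finally show ?case by (simp only: of_nat_Suc[of "Suc n"] distrib_right mult_1 add.assoc)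
    qed
    then have "x * divided_power y (Suc n) =
        divided_power y (Suc n) * x + uea_scale (1 / fact (Suc n)) (of_nat (Suc n) * (z * y ^ n))"
      by (simp add: divided_power_def uea_scale_simps del: power_Suc of_nat_Suc fact_Suc)
    also have "uea_scale (1 / fact (Suc n)) (of_nat (Suc n) * (z * y ^ n)) = z * divided_power y n"
      by (simp add: divided_power_def uea_scale_simps field_simps flip: uea_scale_of_nat del: of_nat_Suc)
    finally show ?thesis .
  qed
  have xY: "x * Y j = Y j * x + z * Y (Suc j)" for j
  proof -
    consider "j < b" | "j = b" | "j > b" by linarith
    then show ?thesis
    proof cases
      case 1
      then have "b - j = Suc (b - Suc j)" by simp
      with 1 xy'[of "b - Suc j"] show ?thesis by (simp add: Y_def)
    qed (simp_all add: Y_def)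
  qed
  have xz': "x * divided_power z j = divided_power z j * x" for j
    using divided_power_commute[OF xz, of 1 j] by (simp add: divided_power_def uea_scale_simps)
  define T where "T a j = divided_power z j * Y j * divided_power x (a - j)" for a j
  have *: "divided_power x a * divided_power y b = (\<Sum>j\<le>a. T a j)"
  proof (induction a)
    case 0
    show ?case by (simp add: T_def Y_def)
  next
    case (Suc a)
    let ?n = "of_nat (Suc a) :: complex"
    have step: "x * T a j = uea_scale (of_nat (Suc a - j)) (T (Suc a) j)
        + uea_scale (of_nat (Suc j)) (T (Suc a) (Suc j))" if "j \<le> a" for j
    proof -
      have "x * T a j = divided_power z j * (x * Y j) * divided_power x (a - j)"
        by (simp add: T_def flip: mult.assoc) (simp add: xz')
      also have "\<dots> = divided_power z j * Y j * (x * divided_power x (a - j))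
          + (divided_power z j * z) * Y (Suc j) * divided_power x (a - j)"
        by (simp add: xY distrib_left distrib_right mult.assoc)
      also have "divided_power z j * z = z * divided_power z j"
        by (simp add: divided_power_def uea_scale_simps power_commutes)
      finally show ?thesis
        using that by (simp add: mult_divided_power T_def uea_scale_simps Suc_diff_le del: of_nat_Suc)
    qed
    have "uea_scale ?n (divided_power x (Suc a) * divided_power y b) =
          x * (divided_power x a * divided_power y b)"
      by (simp only: mult.assoc[symmetric] mult_divided_power uea_scale_simps(7))
    also have "\<dots> = (\<Sum>j\<le>a. x * T a j)" by (simp add: Suc sum_distrib_left)
    also have "\<dots> = (\<Sum>j\<le>a. uea_scale (of_nat (Suc a - j)) (T (Suc a) j))
        + (\<Sum>j\<le>a. uea_scale (of_nat (Suc j)) (T (Suc a) (Suc j)))"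
      by (simp add: step sum.distrib)
    also have "(\<Sum>j\<le>a. uea_scale (of_nat (Suc a - j)) (T (Suc a) j)) =
               (\<Sum>j\<le>Suc a. uea_scale (of_nat (Suc a - j)) (T (Suc a) j))"
      by (simp add: uea_scale_simps)
    also have "(\<Sum>j\<le>a. uea_scale (of_nat (Suc j)) (T (Suc a) (Suc j))) =
               (\<Sum>j\<le>Suc a. uea_scale (of_nat j) (T (Suc a) j))"
      by (subst sum.atMost_Suc_shift) (simp add: uea_scale_simps)
    also have "(\<Sum>j\<le>Suc a. uea_scale (of_nat (Suc a - j)) (T (Suc a) j)) + \<dots> =
               (\<Sum>j\<le>Suc a. uea_scale ?n (T (Suc a) j))"
      by (subst sum.distrib[symmetric], intro sum.cong refl)
        (simp flip: uea_scale_simps(2) of_nat_add del: of_nat_Suc)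
    also have "\<dots> = uea_scale ?n (\<Sum>j\<le>Suc a. T (Suc a) j)"
      by (simp only: uea_scale_of_nat sum_distrib_left)
    finally have "uea_scale (1 / ?n) (uea_scale ?n (divided_power x (Suc a) * divided_power y b)) =
      uea_scale (1 / ?n) (uea_scale ?n (\<Sum>j\<le>Suc a. T (Suc a) j))" by (rule arg_cong)
    then show ?case by (simp add: uea_scale_simps del: of_nat_Suc sum.atMost_Suc)
  qed
  also have "\<dots> = (\<Sum>j\<le>a. if j \<le> b then divided_power z j * divided_power y (b - j) * divided_power x (a - j) else 0)"
    by (intro sum.cong refl) (simp add: T_def Y_def)
  finally show ?thesis .
qed


lemma divided_power_exchange_in:
  assumes xy: "x * y = y * x + w" and w: "w = z \<or> w = - z"
    and xz: "x * z = z * x" and yz: "y * z = z * y"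
  shows "divided_power z c * divided_power x a * divided_power y b \<in>
    group_closure {divided_power z k * divided_power y l * divided_power x m | k l m.
      l + m + 2 * k = a + b + 2 * c}" (is "_ \<in> ?G")
proof -
  have xw: "x * w = w * x" and yw: "y * w = w * y" using w xz yz by auto
  have "divided_power z c * (divided_power w j * divided_power y (b - j) * divided_power x (a - j)) \<in> ?G"
    if "j \<le> a" "j \<le> b" for j
  proof -
    let ?t = "divided_power z c * (divided_power z j * divided_power y (b - j) * divided_power x (a - j))"
    have "?t = of_nat ((c + j) choose c) *
        (divided_power z (c + j) * divided_power y (b - j) * divided_power x (a - j))"
      by (simp only: mult.assoc[symmetric] divided_power_mult)
    also have "\<dots> \<in> ?G"
      by (intro group_closure_of_nat_mult in_group_closure CollectI exI conjI, rule refl) (use that in auto)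
    finally have *: "?t \<in> ?G" .
    have "divided_power w j = divided_power z j \<or> divided_power w j = - divided_power z j"
      using w by (cases "even j") (auto simp: divided_power_uminus)
    with * show ?thesis by auto
  qed
  then have "(\<Sum>j\<le>a. if j \<le> b then
      divided_power z c * (divided_power w j * divided_power y (b - j) * divided_power x (a - j))
      else 0) \<in> ?G"
    by (intro group_closure_sum) auto
  also have "(\<Sum>j\<le>a. if j \<le> b then
      divided_power z c * (divided_power w j * divided_power y (b - j) * divided_power x (a - j))
      else 0) = divided_power z c * (divided_power x a * divided_power y b)"
    by (simp only: divided_power_exchange[OF xy xw yw] sum_distrib_left if_distrib[of "(*) _"] mult_zero_right)
  finally show ?thesis by (simp add: mult.assoc)
qed

abbreviation (input) "dp \<alpha> k \<equiv> divided_power (uea_e \<alpha>) k"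

lemma dp_commute:
  "dp R12 a * dp R13 c = dp R13 c * dp R12 a"
  "dp R23 b * dp R13 c = dp R13 c * dp R23 b"
  by (intro divided_power_commute uea_e_commute)+

lemma dp_exchange_in:
  "dp R13 c * dp R12 a * dp R23 b \<in>
     group_closure {dp R13 k * dp R23 l * dp R12 m | k l m. l + m + 2 * k = a + b + 2 * c}"
  "dp R13 c * dp R23 b * dp R12 a \<in>
     group_closure {dp R13 k * dp R12 l * dp R23 m | k l m. l + m + 2 * k = b + a + 2 * c}"
  by (rule divided_power_exchange_in[where w = "uea_e R13"]; simp add: uea_e_commute)
    (rule divided_power_exchange_in[where w = "- uea_e R13"]; simp add: uea_e_commute)

lemma UNIV_root: "UNIV = {R12, R13, R23}"
  using root.exhaust by auto

lemma root_order_cases: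
  assumes "distinct r" "set r = (UNIV :: root set)"
  obtains "r = [R12, R13, R23]" | "r = [R12, R23, R13]" | "r = [R13, R12, R23]"
    | "r = [R13, R23, R12]" | "r = [R23, R12, R13]" | "r = [R23, R13, R12]"
proof -
  have "length r = card (UNIV :: root set)" using assms distinct_card by metis
  then have "length r = 3" by (simp add: UNIV_root)
  then obtain a b c where "r = [a, b, c]"
    by (auto simp: numeral_3_eq_3 length_Suc_conv)
  with assms(1) show ?thesis using that by (cases a; cases b; cases c; auto)
qed

lemma weight_eq: "weight k = k R12 + k R23 + 2 * k R13"
  by (simp add: weight_def)

lemma component_eq:
  assumes "distinct r" "set r = UNIV"
  shows "integral_form_component r d =
    group_closure {dp R13 c * dp R12 a * dp R23 b | c a b. a + b + 2 * c = d}" (is "_ = group_closure ?P")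
proof -
  let ?Q = "{dp R13 c * dp R23 b * dp R12 a | c b a. b + a + 2 * c = d}"
  have "?P \<subseteq> group_closure ?Q"
  proof
    fix t assume "t \<in> ?P"
    then obtain a b c where "t = dp R13 c * dp R12 a * dp R23 b" "a + b + 2 * c = d" by blast
    with dp_exchange_in(1)[of c a b] show "t \<in> group_closure ?Q" by simp
  qed
  moreover have "?Q \<subseteq> group_closure ?P"
  proof
    fix t assume "t \<in> ?Q"
    then obtain a b c where "t = dp R13 c * dp R23 b * dp R12 a" "b + a + 2 * c = d" by blast
    with dp_exchange_in(2)[of c b a] show "t \<in> group_closure ?P" by simp
  qed
  ultimately have PQ: "group_closure ?P = group_closure ?Q"
    by (intro antisym group_closure_mono_in)
  have ex: "\<exists>k. k R12 = a \<and> k R23 = b \<and> k R13 = c" for a b c :: nat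
    by (rule exI[of _ "\<lambda>\<alpha>. case \<alpha> of R12 \<Rightarrow> a | R23 \<Rightarrow> b | R13 \<Rightarrow> c"]) simp
  have P: "{dp R13 (k R13) * dp R12 (k R12) * dp R23 (k R23) | k. weight k = d} = ?P"
  proof (intro equalityI subsetI)
    fix t assume "t \<in> ?P"
    then obtain a b c where "t = dp R13 c * dp R12 a * dp R23 b" "a + b + 2 * c = d" by blast
    moreover obtain k where "k R12 = a" "k R23 = b" "k R13 = c" using ex by blast
    ultimately show "t \<in> {dp R13 (k R13) * dp R12 (k R12) * dp R23 (k R23) | k. weight k = d}"
      by (auto simp: weight_eq)
  qed (auto simp: weight_eq)
  have Q: "{dp R13 (k R13) * dp R23 (k R23) * dp R12 (k R12) | k. weight k = d} = ?Q"
  proof (intro equalityI subsetI)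
    fix t assume "t \<in> ?Q"
    then obtain a b c where "t = dp R13 c * dp R23 b * dp R12 a" "b + a + 2 * c = d" by blast
    moreover obtain k where "k R12 = a" "k R23 = b" "k R13 = c" using ex by blast
    ultimately show "t \<in> {dp R13 (k R13) * dp R23 (k R23) * dp R12 (k R12) | k. weight k = d}"
      by (auto simp: weight_eq)
  next
    fix t assume "t \<in> {dp R13 (k R13) * dp R23 (k R23) * dp R12 (k R12) | k. weight k = d}"
    then obtain k where "t = dp R13 (k R13) * dp R23 (k R23) * dp R12 (k R12)"
      and "k R23 + k R12 + 2 * k R13 = d" by (auto simp: weight_eq)
    then show "t \<in> ?Q" by blast
  qed
  have "(\<forall>k. ordered_monomial r k = dp R13 (k R13) * dp R12 (k R12) * dp R23 (k R23)) \<or>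
        (\<forall>k. ordered_monomial r k = dp R13 (k R13) * dp R23 (k R23) * dp R12 (k R12))"
  proof -
    have c1: "dp R12 a * (dp R13 c * t) = dp R13 c * (dp R12 a * t)" for a c t
      by (metis dp_commute(1) mult.assoc)
    have c2: "dp R23 a * (dp R13 c * t) = dp R13 c * (dp R23 a * t)" for a c t
      by (metis dp_commute(2) mult.assoc)
    show ?thesis using assms
      by (cases rule: root_order_cases) (simp_all add: ordered_monomial_def mult.assoc dp_commute c1 c2)
  qed
  then show ?thesis
  proof
    assume "\<forall>k. ordered_monomial r k = dp R13 (k R13) * dp R12 (k R12) * dp R23 (k R23)"
    then show ?thesis by (simp add: integral_form_component_def P)
  next
    assume "\<forall>k. ordered_monomial r k = dp R13 (k R13) * dp R23 (k R23) * dp R12 (k R12)"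
    then show ?thesis by (simp add: integral_form_component_def Q PQ)
  qed
qed

lemma integral_form_eq_components:
  "integral_form r = group_closure (\<Union>d. integral_form_component r d)"
proof (intro antisym)
  show "integral_form r \<subseteq> group_closure (\<Union>d. integral_form_component r d)"
    unfolding integral_form_def integral_form_component_def
    by (intro group_closure_mono_in) (auto intro!: in_group_closure)
  have "integral_form_component r d \<subseteq> integral_form r" for d
    unfolding integral_form_def integral_form_component_def
    by (intro group_closure_mono_in) (auto intro: in_group_closure)
  then show "group_closure (\<Union>d. integral_form_component r d) \<subseteq> integral_form r"
    unfolding integral_form_def by (intro group_closure_mono_in) auto
qed

text \<open>Neither the integral form nor its grading depends on the chosen total order, so fixing
  one below is no restriction.\<close>

theorem integral_form_component_order_irrelevant:
  assumes "distinct r" "set r = UNIV" "distinct r'" "set r' = UNIV"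
  shows "integral_form_component r d = integral_form_component r' d"
  by (simp only: component_eq[OF assms(1,2)] component_eq[OF assms(3,4)])

theorem integral_form_order_irrelevant:
  assumes "distinct r" "set r = UNIV" "distinct r'" "set r' = UNIV"
  shows "integral_form r = integral_form r'"
  using integral_form_component_order_irrelevant[OF assms] by (simp add: integral_form_eq_components)

definition root_order :: "root list" where "root_order = [R12, R13, R23]"

lemma root_order: "distinct root_order" "set root_order = UNIV"
  by (auto simp: root_order_def UNIV_root)

theorem integral_form_component_mult:
  assumes "x \<in> integral_form_component root_order d" "y \<in> integral_form_component root_order d'"
  shows "x * y \<in> integral_form_component root_order (d + d')"
proof -
  let ?P = "\<lambda>d. {dp R13 c * dp R12 a * dp R23 b | c a b. a + b + 2 * c = d}"
  have gen: "s * t \<in> group_closure (?P (d + d'))" if "s \<in> ?P d" "t \<in> ?P d'" for s t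
  proof -
    from that obtain a b c a' b' c' where
      s: "s = dp R13 c * dp R12 a * dp R23 b" "a + b + 2 * c = d" and
      t: "t = dp R13 c' * dp R12 a' * dp R23 b'" "a' + b' + 2 * c' = d'"
      by blast
    have "(dp R13 c * dp R13 c' * dp R12 a) * u * dp R23 b' \<in> group_closure (?P (d + d'))"
      if "u \<in> group_closure {dp R13 k * dp R12 l * dp R23 m | k l m. l + m + 2 * k = b + a' + 2 * 0}" for u
      using that
    proof induction
      case (base u)
      then consider "u = 0" | k l m where "u = dp R13 k * dp R12 l * dp R23 m" "l + m + 2 * k = b + a'"
        by auto
      then show ?case
      proof cases
        case 2
        have "(dp R13 c * dp R13 c' * dp R12 a) * u * dp R23 b' =
            (dp R13 c * dp R13 c') * (dp R12 a * dp R13 k) * dp R12 l * (dp R23 m * dp R23 b')"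
          by (simp only: 2 mult.assoc)
        also have "\<dots> = ((dp R13 c * dp R13 c') * dp R13 k) * (dp R12 a * dp R12 l) * (dp R23 m * dp R23 b')"
          by (simp only: dp_commute mult.assoc)
        also have "\<dots> = of_nat (((c + c') choose c) * ((c + c' + k) choose (c + c')) *
              ((a + l) choose a) * ((m + b') choose m)) *
            (dp R13 (c + c' + k) * dp R12 (a + l) * dp R23 (m + b'))"
        proof -
          have mm: "(of_nat p * u) * (of_nat q * v) = of_nat (p * q) * (u * v)" for p q and u v :: uea
            by (metis mult.assoc mult_of_nat_commute of_nat_mult)
          have "dp R13 c * dp R13 c' * dp R13 k =
              of_nat (((c + c') choose c) * ((c + c' + k) choose (c + c'))) * dp R13 (c + c' + k)"
            by (simp only: divided_power_mult mult.assoc of_nat_mult)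
          then show ?thesis by (simp only: divided_power_mult[of _ a] divided_power_mult[of _ m] mm)
        qed
        also have "\<dots> \<in> group_closure (?P (d + d'))"
          by (intro group_closure_of_nat_mult in_group_closure CollectI exI conjI, rule refl)
            (use s t 2 in auto)
        finally show ?thesis .
      qed simp
    qed (simp only: left_diff_distrib right_diff_distrib group_closure.diff)
    from this[OF dp_exchange_in(2)[of 0 b a']]
    have "(dp R13 c * dp R13 c' * dp R12 a) * (dp R23 b * dp R12 a') * dp R23 b'
        \<in> group_closure (?P (d + d'))" by simp
    also have "(dp R13 c * dp R13 c' * dp R12 a) * (dp R23 b * dp R12 a') * dp R23 b' = s * t"
    proof -
      have "s * t = dp R13 c * (dp R12 a * (dp R23 b * dp R13 c')) * dp R12 a' * dp R23 b'"
        by (simp only: s t mult.assoc)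
      also have "\<dots> = dp R13 c * (dp R12 a * dp R13 c') * dp R23 b * dp R12 a' * dp R23 b'"
        by (simp only: dp_commute(2) mult.assoc)
      also have "\<dots> = (dp R13 c * dp R13 c' * dp R12 a) * (dp R23 b * dp R12 a') * dp R23 b'"
        by (simp only: dp_commute(1) mult.assoc)
      finally show ?thesis ..
    qed
    finally show ?thesis .
  qed
  show ?thesis
    using assms unfolding component_eq[OF root_order] by (rule group_closure_mult) (rule gen)
qed

lemma integral_form_mult:
  assumes "x \<in> integral_form root_order" "y \<in> integral_form root_order"
  shows "x * y \<in> integral_form root_order"
  using assms unfolding integral_form_eq_components
  by (rule group_closure_mult) (use integral_form_component_mult in \<open>blast intro: in_group_closure\<close>)

lemma integral_form_one: "1 \<in> integral_form r"
proof -
  have "ordered_monomial r (\<lambda>_. 0) = 1"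
    by (induction r) (simp_all add: ordered_monomial_def)
  then show ?thesis unfolding integral_form_def by (metis in_group_closure rangeI)
qed

typedef kostant_Z = "integral_form root_order"
  using integral_form_one by blast

setup_lifting type_definition_kostant_Z

instantiation kostant_Z :: ring_1
begin

lift_definition zero_kostant_Z :: kostant_Z is 0 by (simp add: integral_form_def)
lift_definition one_kostant_Z :: kostant_Z is 1 by (rule integral_form_one)
lift_definition plus_kostant_Z :: "kostant_Z \<Rightarrow> kostant_Z \<Rightarrow> kostant_Z" is "(+)"
  by (simp add: integral_form_def group_closure_add)
lift_definition minus_kostant_Z :: "kostant_Z \<Rightarrow> kostant_Z \<Rightarrow> kostant_Z" is "(-)"
  by (simp add: integral_form_def group_closure.diff)
lift_definition uminus_kostant_Z :: "kostant_Z \<Rightarrow> kostant_Z" is uminus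
  by (simp add: integral_form_def)
lift_definition times_kostant_Z :: "kostant_Z \<Rightarrow> kostant_Z \<Rightarrow> kostant_Z" is "(*)"
  by (rule integral_form_mult)

instance
  by standard (transfer; simp add: algebra_simps)+

end

lift_definition kostant_monomial :: "(root \<Rightarrow> nat) \<Rightarrow> kostant_Z" is "ordered_monomial root_order"
  by (auto simp: integral_form_def intro: in_group_closure)


section \<open>Tensor products of rings over the integers\<close>

datatype ('a, 'b) elementary = Elem 'a 'b

text \<open>The addition on elementary tensors is their multiplication, so that \<open>(\<Rightarrow>\<^sub>0)\<close> over them
  carries the product determined by \<open>(a \<otimes> x) (b \<otimes> y) = (a b) \<otimes> (x y)\<close>.\<close>

instantiation elementary :: (monoid_mult, monoid_mult) monoid_add
begin

definition zero_elementary :: "('a, 'b) elementary" where "0 = Elem 1 1"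

fun plus_elementary :: "('a, 'b) elementary \<Rightarrow> ('a, 'b) elementary \<Rightarrow> ('a, 'b) elementary" where
  "Elem a x + Elem b y = Elem (a * b) (x * y)"

instance
proof
  fix a b c :: "('a, 'b) elementary"
  show "a + b + c = a + (b + c)" by (cases a; cases b; cases c) (simp add: mult.assoc)
  show "0 + a = a" "a + 0 = a" by (cases a; simp add: zero_elementary_def)+
qed

end

abbreviation (input) "elem a x \<equiv> Poly_Mapping.single (Elem a x) (1::int)"

definition tensor_relators :: "(('a::ring_1, 'b::ring_1) elementary \<Rightarrow>\<^sub>0 int) set" where
  "tensor_relators =
     {elem (a + b) x - elem a x - elem b x | a b x. True} \<union>
     {elem a (x + y) - elem a x - elem a y | a x y. True}"

lemma tensor_relators_mult:
  assumes "f \<in> group_closure tensor_relators"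
  shows "g * f \<in> group_closure tensor_relators" "f * g \<in> group_closure tensor_relators"
proof -
  have 1: "elem c z * r \<in> tensor_relators" if "r \<in> tensor_relators" for r :: "('a, 'b) elementary \<Rightarrow>\<^sub>0 int" and c z
    using that unfolding tensor_relators_def
  proof (elim UnE CollectE exE conjE)
    fix a b x assume "r = elem (a + b) x - elem a x - elem b x"
    then have "elem c z * r = elem (c * a + c * b) (z * x) - elem (c * a) (z * x) - elem (c * b) (z * x)"
      by (simp add: right_diff_distrib mult_single distrib_left)
    then show "elem c z * r \<in> {elem (a + b) x - elem a x - elem b x | a b x. True} \<union>
       {elem a (x + y) - elem a x - elem a y | a x y. True}" by blast
  next
    fix a x y assume "r = elem a (x + y) - elem a x - elem a y"
    then have "elem c z * r = elem (c * a) (z * x + z * y) - elem (c * a) (z * x) - elem (c * a) (z * y)"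
      by (simp add: right_diff_distrib mult_single distrib_left)
    then show "elem c z * r \<in> {elem (a + b) x - elem a x - elem b x | a b x. True} \<union>
       {elem a (x + y) - elem a x - elem a y | a x y. True}" by blast
  qed
  have 2: "r * elem c z \<in> tensor_relators" if "r \<in> tensor_relators" for r :: "('a, 'b) elementary \<Rightarrow>\<^sub>0 int" and c z
    using that unfolding tensor_relators_def
  proof (elim UnE CollectE exE conjE)
    fix a b x assume "r = elem (a + b) x - elem a x - elem b x"
    then have "r * elem c z = elem (a * c + b * c) (x * z) - elem (a * c) (x * z) - elem (b * c) (x * z)"
      by (simp add: left_diff_distrib mult_single distrib_right)
    then show "r * elem c z \<in> {elem (a + b) x - elem a x - elem b x | a b x. True} \<union>
       {elem a (x + y) - elem a x - elem a y | a x y. True}" by blast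
  next
    fix a x y assume "r = elem a (x + y) - elem a x - elem a y"
    then have "r * elem c z = elem (a * c) (x * z + y * z) - elem (a * c) (x * z) - elem (a * c) (y * z)"
      by (simp add: left_diff_distrib mult_single distrib_right)
    then show "r * elem c z \<in> {elem (a + b) x - elem a x - elem b x | a b x. True} \<union>
       {elem a (x + y) - elem a x - elem a y | a x y. True}" by blast
  qed
  have gen: "g \<in> group_closure {elem c z | c z. True}" for g :: "('a, 'b) elementary \<Rightarrow>\<^sub>0 int"
  proof (rule frag_induction[of g UNIV])
    fix t :: "('a, 'b) elementary"
    show "frag_of t \<in> group_closure {elem c z | c z. True}"
      by (cases t) (auto intro!: in_group_closure)
  qed (auto intro: group_closure.diff)
  show "g * f \<in> group_closure tensor_relators"
    by (rule group_closure_mult[OF gen assms]) (use 1 in \<open>auto intro: in_group_closure\<close>)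
  show "f * g \<in> group_closure tensor_relators"
    by (rule group_closure_mult[OF assms gen]) (use 2 in \<open>auto intro: in_group_closure\<close>)
qed

quotient_type (overloaded) ('a, 'b) tensor = "('a::ring_1, 'b::ring_1) elementary \<Rightarrow>\<^sub>0 int" /
  "\<lambda>f g. f - g \<in> group_closure tensor_relators"
proof (rule equivpI)
  show "reflp (\<lambda>f g :: ('a, 'b) elementary \<Rightarrow>\<^sub>0 int. f - g \<in> group_closure tensor_relators)"
    by (rule reflpI) simp
  show "symp (\<lambda>f g :: ('a, 'b) elementary \<Rightarrow>\<^sub>0 int. f - g \<in> group_closure tensor_relators)"
    by (rule sympI) (metis minus_diff_eq group_closure_minus_iff)
  show "transp (\<lambda>f g :: ('a, 'b) elementary \<Rightarrow>\<^sub>0 int. f - g \<in> group_closure tensor_relators)"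
    by (rule transpI) (use group_closure_add in fastforce)
qed

instantiation tensor :: (ring_1, ring_1) "{ring, monoid_mult}"
begin

lift_definition zero_tensor :: "('a, 'b) tensor" is 0 .
lift_definition one_tensor :: "('a, 'b) tensor" is 1 .
lift_definition plus_tensor :: "('a, 'b) tensor \<Rightarrow> ('a, 'b) tensor \<Rightarrow> ('a, 'b) tensor" is "(+)"
  by (subst add_diff_add) (rule group_closure_add)
lift_definition minus_tensor :: "('a, 'b) tensor \<Rightarrow> ('a, 'b) tensor \<Rightarrow> ('a, 'b) tensor" is "(-)"
proof -
  fix a b c d :: "('a, 'b) elementary \<Rightarrow>\<^sub>0 int"
  assume "a - b \<in> group_closure tensor_relators" "c - d \<in> group_closure tensor_relators"
  moreover have "(a - c) - (b - d) = (a - b) - (c - d)" by (simp add: algebra_simps)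
  ultimately show "(a - c) - (b - d) \<in> group_closure tensor_relators"
    by (simp only: group_closure.diff)
qed
lift_definition uminus_tensor :: "('a, 'b) tensor \<Rightarrow> ('a, 'b) tensor" is uminus
  using group_closure_minus_iff by fastforce
lift_definition times_tensor :: "('a, 'b) tensor \<Rightarrow> ('a, 'b) tensor \<Rightarrow> ('a, 'b) tensor" is "(*)"
proof -
  fix a b c d :: "('a, 'b) elementary \<Rightarrow>\<^sub>0 int"
  assume "a - b \<in> group_closure tensor_relators" "c - d \<in> group_closure tensor_relators"
  moreover have "a * c - b * d = (a - b) * c + b * (c - d)" by (simp add: algebra_simps)
  ultimately show "a * c - b * d \<in> group_closure tensor_relators"
    by (simp add: group_closure_add tensor_relators_mult)
qed

instance
  by standard (transfer; simp add: algebra_simps)+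

end

definition pure_tensor :: "'a::ring_1 \<Rightarrow> 'b::ring_1 \<Rightarrow> ('a, 'b) tensor" where
  "pure_tensor a x = abs_tensor (elem a x)"

section \<open>The Kostant form over a field\<close>

type_synonym 'k kostant = "('k, kostant_Z) tensor"

definition kostant_grading :: "nat \<Rightarrow> 'k::field kostant set" where
  "kostant_grading d = group_closure {pure_tensor c (kostant_monomial k) | c k. weight k = d}"

section \<open>Graded left modules\<close>

text \<open>Throughout, \<open>G\<close> is the grading of the ring, with \<open>G d\<close> the component of degree \<open>d\<close>.\<close>

definition positive_part :: "(nat \<Rightarrow> 'a::{ring, monoid_mult} set) \<Rightarrow> 'a set" where
  "positive_part G = group_closure (\<Union>d\<in>{1..}. G d)"

record ('a, 'm) gmod =
  carrier :: "'m set"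
  smult :: "'a \<Rightarrow> 'm \<Rightarrow> 'm"
  component :: "nat \<Rightarrow> 'm set"

definition additive_subgroup :: "'m::ab_group_add set \<Rightarrow> bool" where
  "additive_subgroup S \<longleftrightarrow> 0 \<in> S \<and> (\<forall>x\<in>S. \<forall>y\<in>S. x - y \<in> S)"

definition graded_module ::
  "(nat \<Rightarrow> 'a::{ring, monoid_mult} set) \<Rightarrow> ('a, 'm::ab_group_add) gmod \<Rightarrow> bool" where
  "graded_module G M \<longleftrightarrow>
     additive_subgroup (carrier M) \<and>
     (\<forall>a. \<forall>x\<in>carrier M. smult M a x \<in> carrier M) \<and>
     (\<forall>a. \<forall>x\<in>carrier M. \<forall>y\<in>carrier M. smult M a (x + y) = smult M a x + smult M a y) \<and>
     (\<forall>a b. \<forall>x\<in>carrier M. smult M (a + b) x = smult M a x + smult M b x) \<and>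
     (\<forall>a b. \<forall>x\<in>carrier M. smult M (a * b) x = smult M a (smult M b x)) \<and>
     (\<forall>x\<in>carrier M. smult M 1 x = x) \<and>
     (\<forall>n. additive_subgroup (component M n) \<and> component M n \<subseteq> carrier M) \<and>
     (\<forall>d n. \<forall>a\<in>G d. \<forall>x\<in>component M n. smult M a x \<in> component M (d + n)) \<and>
     (\<forall>x\<in>carrier M. \<exists>!f :: nat \<Rightarrow>\<^sub>0 'm.
        (\<forall>n. Poly_Mapping.lookup f n \<in> component M n) \<and>
        x = (\<Sum>n\<in>Poly_Mapping.keys f. Poly_Mapping.lookup f n))"

definition graded_hom ::
  "('a, 'm::ab_group_add) gmod \<Rightarrow> ('a, 'n::ab_group_add) gmod \<Rightarrow> ('m \<Rightarrow> 'n) \<Rightarrow> bool" where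
  "graded_hom M N f \<longleftrightarrow>
     (\<forall>x\<in>carrier M. f x \<in> carrier N) \<and>
     (\<forall>x\<in>carrier M. \<forall>y\<in>carrier M. f (x + y) = f x + f y) \<and>
     (\<forall>a. \<forall>x\<in>carrier M. f (smult M a x) = smult N a (f x)) \<and>
     (\<forall>n. \<forall>x\<in>component M n. f x \<in> component N n)"

definition graded_iso ::
  "('a, 'm::ab_group_add) gmod \<Rightarrow> ('a, 'n::ab_group_add) gmod \<Rightarrow> bool" (infix \<open>\<cong>\<^sub>g\<close> 50) where
  "M \<cong>\<^sub>g N \<longleftrightarrow>
     (\<exists>f. graded_hom M N f \<and> bij_betw f (carrier M) (carrier N) \<and>
       (\<forall>n. f ` component M n = component N n))"

definition shifted_ring ::
  "(nat \<Rightarrow> 'a::{ring, monoid_mult} set) \<Rightarrow> nat \<Rightarrow> ('a, 'a) gmod" where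
  "shifted_ring G s =
     \<lparr>carrier = UNIV, smult = (*), component = (\<lambda>n. if s \<le> n then G (n - s) else {0})\<rparr>"

definition direct_sum ::
  "'i set \<Rightarrow> ('i \<Rightarrow> ('a, 'm::ab_group_add) gmod) \<Rightarrow> ('a, 'i \<Rightarrow>\<^sub>0 'm) gmod" where
  "direct_sum I M =
     \<lparr>carrier = {f. Poly_Mapping.keys f \<subseteq> I \<and> (\<forall>i\<in>I. Poly_Mapping.lookup f i \<in> carrier (M i))},
      smult = (\<lambda>a. Poly_Mapping.mapp (\<lambda>i. smult (M i) a)),
      component = (\<lambda>n. {f. Poly_Mapping.keys f \<subseteq> I \<and>
        (\<forall>i\<in>I. Poly_Mapping.lookup f i \<in> component (M i) n)})\<rparr>"

definition direct_power :: "('a, 'm::ab_group_add) gmod \<Rightarrow> nat \<Rightarrow> ('a, nat \<Rightarrow>\<^sub>0 'm) gmod" where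
  "direct_power M n = direct_sum {..<n} (\<lambda>_. M)"

definition binary_sum ::
  "('a, 'm::ab_group_add) gmod \<Rightarrow> ('a, 'n::ab_group_add) gmod \<Rightarrow> ('a, 'm \<times> 'n) gmod" where
  "binary_sum M N =
     \<lparr>carrier = carrier M \<times> carrier N,
      smult = (\<lambda>a (x, y). (smult M a x, smult N a y)),
      component = (\<lambda>n. component M n \<times> component N n)\<rparr>"

definition lin_comb ::
  "('a::{ring, monoid_mult}, 'm::ab_group_add) gmod \<Rightarrow> ('m \<Rightarrow>\<^sub>0 'a) \<Rightarrow> 'm" where
  "lin_comb M f = (\<Sum>b\<in>Poly_Mapping.keys f. smult M (Poly_Mapping.lookup f b) b)"

definition homogeneous_basis ::
  "('a::{ring, monoid_mult}, 'm::ab_group_add) gmod \<Rightarrow> 'm set \<Rightarrow> bool" where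
  "homogeneous_basis M B \<longleftrightarrow>
     B \<subseteq> carrier M \<and> (\<forall>b\<in>B. \<exists>n. b \<in> component M n) \<and>
     (\<forall>x\<in>carrier M. \<exists>!f. Poly_Mapping.keys f \<subseteq> B \<and> x = lin_comb M f)"

definition Rad ::
  "(nat \<Rightarrow> 'a::{ring, monoid_mult} set) \<Rightarrow> ('a, 'm::ab_group_add) gmod \<Rightarrow> 'm set \<Rightarrow> 'm set" where
  "Rad G M B = {lin_comb M f | f. Poly_Mapping.keys f \<subseteq> B \<and>
     (\<forall>b. Poly_Mapping.lookup f b \<in> positive_part G)}"

text \<open>Graded projective modules over the rings considered here are graded free, so projectivity
  of the terms is stated as the existence of a homogeneous basis.  \<open>d i\<close> is the map from \<open>F (i + 1)\<close> to
  \<open>F i\<close>.\<close>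

definition graded_projective_resolution ::
  "(nat \<Rightarrow> 'a::{ring, monoid_mult} set) \<Rightarrow> (nat \<Rightarrow> ('a, 'm::ab_group_add) gmod) \<Rightarrow>
   (nat \<Rightarrow> 'm \<Rightarrow> 'm) \<Rightarrow> ('m \<Rightarrow> 'n) \<Rightarrow> ('a, 'n::ab_group_add) gmod \<Rightarrow> bool" where
  "graded_projective_resolution G F d \<epsilon> M \<longleftrightarrow>
     graded_module G M \<and>
     (\<forall>i. graded_module G (F i) \<and> (\<exists>B. homogeneous_basis (F i) B)) \<and>
     (\<forall>i. graded_hom (F (Suc i)) (F i) (d i)) \<and>
     graded_hom (F 0) M \<epsilon> \<and>
     (\<forall>i. d (Suc i) ` carrier (F (Suc (Suc i))) = {x \<in> carrier (F (Suc i)). d i x = 0}) \<and>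
     d 0 ` carrier (F 1) = {x \<in> carrier (F 0). \<epsilon> x = 0} \<and>
     \<epsilon> ` carrier (F 0) = carrier M"

definition minimal_graded_projective_resolution ::
  "(nat \<Rightarrow> 'a::{ring, monoid_mult} set) \<Rightarrow> (nat \<Rightarrow> ('a, 'm::ab_group_add) gmod) \<Rightarrow>
   (nat \<Rightarrow> 'm \<Rightarrow> 'm) \<Rightarrow> ('m \<Rightarrow> 'n) \<Rightarrow> ('a, 'n::ab_group_add) gmod \<Rightarrow> bool" where
  "minimal_graded_projective_resolution G F d \<epsilon> M \<longleftrightarrow>
     graded_projective_resolution G F d \<epsilon> M \<and>
     (\<forall>i B. homogeneous_basis (F i) B \<longrightarrow> d i ` carrier (F (Suc i)) \<subseteq> Rad G (F i) B)"

section \<open>The trivial module\<close>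

text \<open>The component of degree zero is the field itself, and an element acts through the scalar
  that is its part of degree zero.\<close>

definition trivial_module :: "('k::field kostant, 'k) gmod" where
  "trivial_module =
     \<lparr>carrier = UNIV,
      smult = (\<lambda>a x. (THE c. a - pure_tensor c 1 \<in> positive_part kostant_grading) * x),
      component = (\<lambda>n. if n = 0 then UNIV else {0})\<rparr>"

abbreviation kostant_shift :: "nat \<Rightarrow> ('k::field kostant, 'k kostant) gmod" where
  "kostant_shift s \<equiv> shifted_ring kostant_grading s"

end

theory Submission
  imports Defs
begin

text \<open>Let \<open>X a\<close>, \<open>Y b\<close>, \<open>Z c\<close> be the divided powers of \<open>e\<^sub>2\<^sub>3\<close>, \<open>e\<^sub>1\<^sub>2\<close>, \<open>e\<^sub>1\<^sub>3\<close>.  In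
characteristic two the signs in the exchange formula disappear: \<open>Z\<close> is central and \<open>X a * Y b\<close> is the sum over \<open>j\<close> of
\<open>Z j * Y (b - j) * X (a - j)\<close>.  Moreover \<open>X a * X b\<close> is \<open>X (a + b)\<close> when the binary digits of \<open>a\<close>
and \<open>b\<close> are disjoint and zero otherwise, and likewise for \<open>Y\<close> and \<open>Z\<close>.  The products
\<open>Z c * Y b * X a\<close> form a basis; their linear independence is read off from an explicit
representation of the enveloping algebra on functions of three exponents.

The augmentation ideal is generated, as a left ideal, by the elements \<open>X (2 ^ k)\<close> and
\<open>Y (2 ^ k)\<close>, because \<open>Z (2 ^ k)\<close> differs from \<open>X (2 ^ k) * Y (2 ^ k)\<close> by elements of the left ideal
of the \<open>X\<close>.  This generating set is minimal: the coefficient of a product of two elements of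
positive degree at \<open>X (2 ^ k)\<close> or \<open>Y (2 ^ k)\<close> is zero, since \<open>2 ^ k choose a\<close> is even for
\<open>0 < a < 2 ^ k\<close>.

With free generators \<open>x k\<close>, \<open>y k\<close> over these elements, the kernel of the first map contains the
relations \<open>X (2 ^ k) \<odot> x k\<close>, \<open>X (2 ^ k) \<odot> x l - X (2 ^ l) \<odot> x k\<close> for \<open>k < l\<close>, the same with \<open>Y\<close> and \<open>y\<close>,
and, for \<open>k \<noteq> l\<close>, the relation that lifts the exchange formula for \<open>X (2 ^ k)\<close> and \<open>Y (2 ^ l)\<close>.
For \<open>k = l\<close> the exchange formula expresses \<open>Z (2 ^ k)\<close> by the generators and gives no
relation.  That is two relations of degree \<open>2 ^ (k + 1)\<close> and four of degree \<open>2 ^ l + 2 ^ k\<close> for every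
\<open>k < l\<close>.  They are independent modulo decomposable elements, because the coefficients at
\<open>X (2 ^ k)\<close> and \<open>Y (2 ^ k)\<close> of the components are functionals dual to them.

They generate the kernel by a straightening argument.  Modulo the relations every element of
the free module is a linear combination of one standard lift for each basis monomial other
than \<open>1\<close>, and the standard lifts have linearly independent values.  First the lifts that
involve some \<open>x k\<close> are seen to span a submodule.  Modulo it, lifts \<open>yl b\<close> of \<open>Y b\<close> exist with
\<open>X s \<odot> yl b \<doteq> Z s \<odot> yl (b - s)\<close> for \<open>s < b\<close> and \<open>\<doteq> 0\<close> for \<open>s > b\<close>, by induction on \<open>b\<close> (lemma \<open>straight\<close>);
the elements \<open>zl c = X c \<odot> yl c\<close> then behave like lifts of \<open>Z c\<close>.  The subtle point is
\<open>Z (2 ^ i) \<odot> zl (2 ^ i) \<doteq> 0\<close>, which comes from \<open>X (2 ^ i) * X (2 ^ i) = 0\<close> applied to \<open>y (i + 1)\<close> (lemma \<open>ZXy\<close>).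

The remaining terms of the resolution exist in general: over a connected graded algebra of
countable dimension, a graded submodule of a free module has a minimal set of homogeneous
generators, and the kernel of the corresponding cover lies in the radical (lemmas
\<open>exists_minimal_generators\<close>, \<open>minimal_kernel\<close>, \<open>exists_minimal_resolution\<close>).\<close>

section \<open>Sums over the support\<close>

abbreviation lookup :: "('i \<Rightarrow>\<^sub>0 'a::zero) \<Rightarrow> 'i \<Rightarrow> 'a" where
  "lookup \<equiv> Poly_Mapping.lookup"

abbreviation keys :: "('i \<Rightarrow>\<^sub>0 'a::zero) \<Rightarrow> 'i set" where
  "keys \<equiv> Poly_Mapping.keys"

text \<open>The sum of \<open>\<phi> i (lookup f i)\<close> over the support of \<open>f\<close>; all maps out
  of finitely supported families below are of this form.\<close>

definition pm_sum :: "('i \<Rightarrow> 'a \<Rightarrow> 'b) \<Rightarrow> ('i \<Rightarrow>\<^sub>0 'a::zero) \<Rightarrow> 'b::comm_monoid_add" where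
  "pm_sum \<phi> f = (\<Sum>i\<in>keys f. \<phi> i (lookup f i))"

lemma pm_sum_superset:
  assumes "finite S" "keys f \<subseteq> S" "\<And>i. \<phi> i 0 = 0"
  shows "pm_sum \<phi> f = (\<Sum>i\<in>S. \<phi> i (lookup f i))"
  unfolding pm_sum_def using assms
  by (intro sum.mono_neutral_left) (auto simp: not_in_keys_iff_lookup_eq_zero)

lemma pm_sum_0 [simp]: "pm_sum \<phi> 0 = 0"
  by (simp add: pm_sum_def)

lemma pm_sum_single: "\<phi> i 0 = 0 \<Longrightarrow> pm_sum \<phi> (Poly_Mapping.single i a) = \<phi> i a"
  by (cases "a = 0") (simp_all add: pm_sum_def)

lemma pm_sum_add:
  assumes "\<And>i a b. \<phi> i (a + b) = \<phi> i a + \<phi> i b" "\<And>i. \<phi> i 0 = 0"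
  shows "pm_sum \<phi> (f + g) = pm_sum \<phi> f + pm_sum \<phi> g"
proof -
  let ?S = "keys f \<union> keys g"
  have "keys (f + g) \<subseteq> ?S" by (rule keys_add)
  then show ?thesis
    using pm_sum_superset[of ?S "f + g" \<phi>] pm_sum_superset[of ?S f \<phi>] pm_sum_superset[of ?S g \<phi>] assms
    by (simp add: lookup_add sum.distrib)
qed

lemma pm_sum_sum:
  assumes "\<And>i a b. \<phi> i (a + b) = \<phi> i a + \<phi> i b" "\<And>i. \<phi> i 0 = 0"
  shows "pm_sum \<phi> (sum f S) = (\<Sum>s\<in>S. pm_sum \<phi> (f s))"
  by (induction S rule: infinite_finite_induct) (simp_all add: pm_sum_add assms)

lemma pm_sum_minus:
  fixes \<phi> :: "'i \<Rightarrow> 'a::ab_group_add \<Rightarrow> 'b::ab_group_add"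
  assumes "\<And>i a b. \<phi> i (a + b) = \<phi> i a + \<phi> i b"
  shows "pm_sum \<phi> (f - g) = pm_sum \<phi> f - pm_sum \<phi> g"
proof -
  have "\<phi> i 0 = 0" for i using assms[of i 0 0] by simp
  then have "pm_sum \<phi> (f - g) + pm_sum \<phi> g = pm_sum \<phi> f"
    by (subst pm_sum_add[symmetric]) (auto simp: assms)
  then show ?thesis by (simp add: algebra_simps)
qed

lemma pm_sum_singles: "pm_sum Poly_Mapping.single f = f"
proof (rule poly_mapping_eqI)
  fix k
  have "lookup (pm_sum Poly_Mapping.single f) k =
      (\<Sum>i\<in>keys f. if i = k then lookup f k else 0)"
    unfolding pm_sum_def lookup_sum by (intro sum.cong) (auto simp: lookup_single when_def)
  then show "lookup (pm_sum Poly_Mapping.single f) k = lookup f k"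
    by (simp add: not_in_keys_iff_lookup_eq_zero)
qed

lemma pm_induct [case_names zero single add]:
  assumes "P 0" "\<And>i a. P (Poly_Mapping.single i a)" "\<And>f g. P f \<Longrightarrow> P g \<Longrightarrow> P (f + g)"
  shows "P (f :: 'i \<Rightarrow>\<^sub>0 'a::comm_monoid_add)"
proof -
  have "P (\<Sum>i\<in>S. Poly_Mapping.single i (lookup f i))" for S
    by (induction S rule: infinite_finite_induct) (auto intro: assms)
  then have "P (pm_sum Poly_Mapping.single f)" by (simp add: pm_sum_def)
  then show ?thesis by (simp only: pm_sum_singles)
qed


section \<open>Parity of binomial coefficients\<close>

text \<open>Lucas' theorem modulo two, one binary digit at a time.\<close>

lemma choose_double_parity:
  "even (2 * n choose Suc (2 * k)) \<and> (odd (2 * n choose (2 * k)) \<longleftrightarrow> odd (n choose k)) \<and>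
   (odd (Suc (2 * n) choose (2 * k)) \<longleftrightarrow> odd (n choose k)) \<and>
   (odd (Suc (2 * n) choose Suc (2 * k)) \<longleftrightarrow> odd (n choose k))"
proof (induction n arbitrary: k)
  case 0
  show ?case by (cases k) auto
next
  case (Suc n)
  have e: "even (2 * Suc n choose Suc (2 * k))" for k
    using Suc[of k] by simp
  have d: "odd (2 * Suc n choose (2 * k)) \<longleftrightarrow> odd (Suc n choose k)" for k
  proof (cases k)
    case (Suc k')
    with Suc.IH[of k'] Suc.IH[of "Suc k'"] show ?thesis by auto
  qed simp
  have "odd (Suc (2 * Suc n) choose (2 * k)) \<longleftrightarrow> odd (Suc n choose k)"
  proof (cases k)
    case (Suc k')
    have "Suc (2 * Suc n) choose (2 * k) =
        (2 * Suc n choose Suc (2 * k')) + (2 * Suc n choose (2 * k))"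
      by (simp add: Suc)
    with e[of k'] d[of k] show ?thesis by auto
  qed simp
  moreover have "odd (Suc (2 * Suc n) choose Suc (2 * k)) \<longleftrightarrow> odd (Suc n choose k)"
    using e[of k] d[of k] by (simp only: binomial_Suc_Suc) auto
  ultimately show ?case using e[of k] d[of k] by blast
qed

lemma odd_choose_add_iff:
  "odd ((s + a) choose s) \<longleftrightarrow> (\<forall>i. \<not> (bit s i \<and> bit a i))" for s a :: nat
proof (induction "s + a" arbitrary: s a rule: less_induct)
  case less
  have split: "(\<forall>i. \<not> (bit s i \<and> bit a i)) \<longleftrightarrow>
      \<not> (odd s \<and> odd a) \<and> (\<forall>i. \<not> (bit (s div 2) i \<and> bit (a div 2) i))"
    by (metis bit_0 bit_Suc not0_implies_Suc)
  show ?case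
  proof (cases "s + a = 0")
    case False
    then have IH: "odd ((s div 2 + a div 2) choose (s div 2)) \<longleftrightarrow>
        (\<forall>i. \<not> (bit (s div 2) i \<and> bit (a div 2) i))"
      by (intro less) linarith
    obtain s' where s': "s = 2 * s' \<or> s = Suc (2 * s')" by (metis oddE evenE Suc_eq_plus1)
    obtain a' where a': "a = 2 * a' \<or> a = Suc (2 * a')" by (metis oddE evenE Suc_eq_plus1)
    have "odd ((s + a) choose s) \<longleftrightarrow> \<not> (odd s \<and> odd a) \<and> odd ((s' + a') choose s')"
    proof (cases "odd s \<and> odd a")
      case True
      then have "s = Suc (2 * s')" "s + a = 2 * Suc (s' + a')" using s' a' by auto
      then show ?thesis using True choose_double_parity[of "Suc (s' + a')" s'] by metis
    next
      case False
      then consider "s = 2 * s'" "s + a = 2 * (s' + a')" | "s = 2 * s'" "s + a = Suc (2 * (s' + a'))"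
        | "s = Suc (2 * s')" "s + a = Suc (2 * (s' + a'))" using s' a' by fastforce
      then show ?thesis using False choose_double_parity[of "s' + a'" s'] by cases metis+
    qed
    moreover have "s div 2 = s'" "a div 2 = a'" using s' a' by auto
    ultimately show ?thesis using IH split by auto
  qed simp
qed

lemma bit_minus_power:
  fixes n :: nat
  assumes "bit n i"
  shows "2 ^ i \<le> n" "bit (n - 2 ^ i) j \<longleftrightarrow> bit n j \<and> j \<noteq> i"
proof -
  have "set_bit i (unset_bit i n) = n"
    by (rule bit_eqI) (use assms in \<open>auto simp: bit_simps\<close>)
  then have *: "unset_bit i n + 2 ^ i = n"
    by (simp add: set_bit_eq bit_simps)
  then show "2 ^ i \<le> n" by linarith
  from * have "n - 2 ^ i = unset_bit i n" by linarith
  then show "bit (n - 2 ^ i) j \<longleftrightarrow> bit n j \<and> j \<noteq> i" by (auto simp: bit_simps)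
qed

lemma ex_bit: "n \<noteq> 0 \<Longrightarrow> \<exists>i. bit (n :: nat) i"
  by (simp add: bit_eq_iff)

lemma bit_power [simp]: "bit (2 ^ k :: nat) i \<longleftrightarrow> i = k"
  by (auto simp: bit_simps)

lemma bit_disjoint_add:
  fixes s a :: nat
  assumes "\<And>i. \<not> (bit s i \<and> bit a i)"
  shows "bit (s + a) j \<longleftrightarrow> bit s j \<or> bit a j"
proof -
  have "semiring_bit_operations_class.and s a = 0"
    using assms by (intro bit_eqI) (simp add: bit_simps)
  then show ?thesis by (simp add: disjunctive_add_eq_or bit_simps)
qed

lemma odd_choose_iff:
  assumes "k \<le> n" shows "odd (n choose k) \<longleftrightarrow> (\<forall>i. \<not> (bit k i \<and> bit (n - k) i))"
  using odd_choose_add_iff[of k "n - k"] assms by simp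

lemma odd_choose_power:
  assumes "bit n i" shows "odd (n choose 2 ^ i)" "odd (n choose (n - 2 ^ i))"
proof -
  show "odd (n choose 2 ^ i)" using assms by (simp add: odd_choose_iff bit_minus_power)
  then show "odd (n choose (n - 2 ^ i))"
    using assms by (simp add: binomial_symmetric[of "2 ^ i" n] bit_minus_power)
qed

lemma even_power_choose: "0 < j \<Longrightarrow> j < 2 ^ l \<Longrightarrow> even (2 ^ l choose j)"
proof (induction l arbitrary: j)
  case (Suc l)
  have eq: "2 ^ Suc l = 2 * (2 ^ l :: nat)" by simp
  show ?case
  proof (cases "even j")
    case True
    then obtain j' where "j = 2 * j'" by blast
    with Suc choose_double_parity[of "2 ^ l" j'] show ?thesis by simp
  next
    case False
    then obtain j' where "j = Suc (2 * j')" by (metis oddE Suc_eq_plus1)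
    with choose_double_parity[of "2 ^ l" j'] show ?thesis
      using \<open>j = Suc (2 * j')\<close> by (simp del: binomial_Suc_Suc)
  qed
qed simp


section \<open>Finitely supported families as a module\<close>

text \<open>The module structure on finitely supported families, that is, on the free module over an arbitrary
  index type.\<close>

definition act :: "'a::{ring,monoid_mult} \<Rightarrow> ('i \<Rightarrow>\<^sub>0 'a) \<Rightarrow> ('i \<Rightarrow>\<^sub>0 'a)" (infixr \<open>\<odot>\<close> 72) where
  "a \<odot> f = Poly_Mapping.map ((*) a) f"

lemma lookup_act [simp]: "lookup (a \<odot> f) i = a * lookup f i"
  by (simp add: act_def map.rep_eq when_def)

lemma act_simps:
  "(a + b) \<odot> f = a \<odot> f + b \<odot> f" "(a - b) \<odot> f = a \<odot> f - b \<odot> f"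
  "a \<odot> (f + g) = a \<odot> f + a \<odot> g" "a \<odot> (f - g) = a \<odot> f - a \<odot> g"
  "0 \<odot> f = 0" "a \<odot> 0 = 0" "1 \<odot> f = f"
  by (rule poly_mapping_eqI; simp add: lookup_add lookup_minus algebra_simps)+

lemma act_act: "a \<odot> b \<odot> f = (a * b) \<odot> f"
  by (rule poly_mapping_eqI) (simp add: mult.assoc)

lemma act_sum:
  "(\<Sum>s\<in>S. c s) \<odot> f = (\<Sum>s\<in>S. c s \<odot> f)" "a \<odot> (\<Sum>s\<in>S. g s) = (\<Sum>s\<in>S. a \<odot> g s)"
  by (induction S rule: infinite_finite_induct) (simp_all add: act_simps)

text \<open>In characteristic two only the parity of the number of equal summands matters; this is how
  binomial identities enter.\<close>

lemma sum_parity: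
  assumes "u + u = (0::'b::comm_monoid_add)" "finite S"
  shows "(\<Sum>j\<in>S. if odd (p j) then u else 0) = (if odd (\<Sum>j\<in>S. p j :: nat) then u else 0)"
  using assms(2) by (induction rule: finite_induct) (auto simp: assms(1))

text \<open>A submodule \<open>L\<close>, and congruence modulo \<open>L\<close>; calculations in the quotient
  module are written as chains of congruences.\<close>

locale submodule =
  fixes L :: "('i \<Rightarrow>\<^sub>0 'a::{ring,monoid_mult}) set"
  assumes zero_in: "0 \<in> L" and diff_in: "u \<in> L \<Longrightarrow> v \<in> L \<Longrightarrow> u - v \<in> L"
    and act_in: "u \<in> L \<Longrightarrow> a \<odot> u \<in> L"
begin

lemma add_in: "u \<in> L \<Longrightarrow> v \<in> L \<Longrightarrow> u + v \<in> L"
  using diff_in[of 0 v] diff_in[of u "- v"] zero_in by simp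

definition cgr :: "('i \<Rightarrow>\<^sub>0 'a) \<Rightarrow> ('i \<Rightarrow>\<^sub>0 'a) \<Rightarrow> bool" (infix \<open>\<doteq>\<close> 50) where
  "u \<doteq> v \<longleftrightarrow> u - v \<in> L"

lemma cgr_refl [simp, intro]: "u \<doteq> u"
  by (simp add: cgr_def zero_in)

lemma cgr_sym: "u \<doteq> v \<Longrightarrow> v \<doteq> u"
  using diff_in[of 0 "u - v"] by (simp add: cgr_def zero_in)

lemma cgr_trans [trans]: "u \<doteq> v \<Longrightarrow> v \<doteq> w \<Longrightarrow> u \<doteq> w"
  using add_in[of "u - v" "v - w"] by (simp add: cgr_def)

lemma cgr_add: "u \<doteq> v \<Longrightarrow> u' \<doteq> v' \<Longrightarrow> u + u' \<doteq> v + v'"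
  using add_in[of "u - v" "u' - v'"] by (simp add: cgr_def algebra_simps)

lemma cgr_act: "u \<doteq> v \<Longrightarrow> a \<odot> u \<doteq> a \<odot> v"
  using act_in[of "u - v" a] by (simp add: cgr_def act_simps)

lemma cgr_act0: "u \<doteq> 0 \<Longrightarrow> a \<odot> u \<doteq> 0"
  using cgr_act[of u 0 a] by (simp add: act_simps)

lemma cgr_sum: "(\<And>s. s \<in> S \<Longrightarrow> f s \<doteq> g s) \<Longrightarrow> sum f S \<doteq> sum g S"
  by (induction S rule: infinite_finite_induct) (auto intro: cgr_add)

end

section \<open>Lifts of divided powers\<close>

text \<open>An arbitrary binary digit of a positive number.\<close>

definition some_bit :: "nat \<Rightarrow> nat" where
  "some_bit a = (SOME i. bit a i)"

lemma some_bit: "a \<noteq> 0 \<Longrightarrow> bit a (some_bit a)"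
  unfolding some_bit_def by (rule someI_ex) (rule ex_bit)

lemma some_bit_power [simp]: "some_bit (2 ^ k) = k"
  using some_bit[of "2 ^ k"] by simp

text \<open>If \<open>v i\<close> is a lift of \<open>D (2 ^ i)\<close>, this is a lift of \<open>D a\<close>,
  obtained by splitting off one binary digit of \<open>a\<close>.\<close>

definition divided_lift :: "(nat \<Rightarrow> 'a::{ring,monoid_mult}) \<Rightarrow> (nat \<Rightarrow> 'i \<Rightarrow>\<^sub>0 'a) \<Rightarrow> nat \<Rightarrow> 'i \<Rightarrow>\<^sub>0 'a" where
  "divided_lift D v a = D (a - 2 ^ some_bit a) \<odot> v (some_bit a)"

text \<open>Divided powers of one element in characteristic two; the binomial coefficient enters through its
  parity.\<close>

locale divided_powers =
  fixes D :: "nat \<Rightarrow> 'a::{ring,monoid_mult}"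
  assumes D_0: "D 0 = 1" and D_mult: "D a * D b = (if odd ((a + b) choose a) then D (a + b) else 0)"
begin

lemma D_split: "bit a i \<Longrightarrow> D a = D (a - 2 ^ i) * D (2 ^ i)"
  by (simp add: D_mult bit_minus_power odd_choose_power)

lemma D_commute: "D a * D b = D b * D a"
  using binomial_symmetric[of a "a + b"] by (simp add: D_mult add.commute)

lemma divided_lift_power: "divided_lift D v (2 ^ k) = v k"
  by (simp add: divided_lift_def D_0 act_simps)

end

text \<open>Lifts \<open>v k\<close> of the elements \<open>D (2 ^ k)\<close> which satisfy, modulo
  \<open>L\<close>, the obvious syzygies of these elements.\<close>

locale divided_syzygy = divided_powers D + submodule L
  for D :: "nat \<Rightarrow> 'a::{ring,monoid_mult}" and L :: "('i \<Rightarrow>\<^sub>0 'a) set" +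
  fixes v :: "nat \<Rightarrow> 'i \<Rightarrow>\<^sub>0 'a"
  assumes square: "D (2 ^ k) \<odot> v k \<doteq> 0" and swap: "D (2 ^ k) \<odot> v l \<doteq> D (2 ^ l) \<odot> v k"
begin

text \<open>Modulo the syzygies the lift does not depend on the digit that is split off.\<close>

lemma divided_lift_bit:
  assumes "bit a i" shows "divided_lift D v a \<doteq> D (a - 2 ^ i) \<odot> v i"
proof (cases "some_bit a = i")
  case False
  let ?j = "some_bit a" and ?m = "a - 2 ^ some_bit a - 2 ^ i"
  have j: "bit a ?j" using assms some_bit[of a] by (cases "a = 0") auto
  have "D (a - 2 ^ ?j) = D ?m * D (2 ^ i)"
    using assms j False by (intro D_split) (auto simp: bit_minus_power)
  then have "divided_lift D v a = D ?m \<odot> D (2 ^ i) \<odot> v ?j"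
    by (simp add: divided_lift_def act_act)
  also have "\<dots> \<doteq> D ?m \<odot> D (2 ^ ?j) \<odot> v i"
    by (intro cgr_act swap)
  also have "?m = a - 2 ^ i - 2 ^ ?j" by simp
  also have "D (a - 2 ^ i - 2 ^ ?j) \<odot> D (2 ^ ?j) \<odot> v i = D (a - 2 ^ i) \<odot> v i"
    unfolding act_act using assms j False
    by (subst D_split[of "a - 2 ^ i" ?j]) (auto simp: bit_minus_power)
  finally show ?thesis .
qed (simp add: divided_lift_def)

text \<open>So the lifts multiply like the divided powers themselves.\<close>

lemma D_divided_lift:
  assumes "a \<noteq> 0"
  shows "D s \<odot> divided_lift D v a \<doteq> (if odd ((s + a) choose s) then divided_lift D v (s + a) else 0)"
proof -
  let ?i = "some_bit a"
  have i: "bit a ?i" using assms by (rule some_bit)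
  note le = bit_minus_power(1)[OF i]
  have eq: "D s \<odot> divided_lift D v a = (D s * D (a - 2 ^ ?i)) \<odot> v ?i"
    by (simp add: divided_lift_def act_act)
  show ?thesis
  proof (cases "bit s ?i")
    case True
    have "even ((s + a) choose s)" using True i odd_choose_add_iff[of s a] by auto
    moreover have "D s * D (a - 2 ^ ?i) = D (s - 2 ^ ?i) * D (a - 2 ^ ?i) * D (2 ^ ?i)"
      using D_split[OF True] D_commute[of "2 ^ ?i" "a - 2 ^ ?i"] by (simp only: mult.assoc)
    then have "D s \<odot> divided_lift D v a \<doteq> 0"
      unfolding eq by (simp add: act_act[symmetric] cgr_act0 square)
    ultimately show ?thesis by simp
  next
    case False
    have par: "odd ((s + (a - 2 ^ ?i)) choose s) \<longleftrightarrow> odd ((s + a) choose s)"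
      unfolding odd_choose_add_iff bit_minus_power(2)[OF i] using False by metis
    show ?thesis
    proof (cases "odd ((s + a) choose s)")
      case True
      have "bit (s + a) ?i"
      proof -
        have "bit (s + a) ?i \<longleftrightarrow> bit s ?i \<or> bit a ?i"
          using True by (intro bit_disjoint_add) (simp add: odd_choose_add_iff)
        then show ?thesis using i by simp
      qed
      then have "divided_lift D v (s + a) \<doteq> D (s + a - 2 ^ ?i) \<odot> v ?i" by (rule divided_lift_bit)
      moreover have "D s * D (a - 2 ^ ?i) = D (s + a - 2 ^ ?i)"
        using True par le by (simp add: D_mult)
      ultimately show ?thesis using True by (simp add: eq cgr_sym)
    next
      case False
      then show ?thesis using par by (simp add: eq D_mult act_simps)
    qed
  qed
qed

end

section \<open>Divided powers of the Heisenberg algebra in characteristic two\<close>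

text \<open>The multiplication rules of the divided powers \<open>X\<close>, \<open>Y\<close> of two elements
  and \<open>Z\<close> of their central commutator, in characteristic two.\<close>

locale heisenberg2 =
  fixes X Y Z :: "nat \<Rightarrow> 'a::{ring,monoid_mult}"
  assumes char2: "(1::'a) + 1 = 0"
    and X: "divided_powers X" and Y: "divided_powers Y" and Z: "divided_powers Z"
    and ZX: "X a * Z c = Z c * X a" and ZY: "Y b * Z c = Z c * Y b"
    and XY: "X a * Y b = (\<Sum>j\<le>min a b. Z j * Y (b - j) * X (a - j))"
begin

lemma double_act: "u + u = (0 :: 'i \<Rightarrow>\<^sub>0 'a)"
proof -
  have "(1 + 1) \<odot> u = 0" by (simp add: char2 act_simps)
  then show ?thesis by (simp only: act_simps)
qed

lemma minus_eq_plus: "u - v = u + (v :: 'i \<Rightarrow>\<^sub>0 'a)"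
  using double_act[of v] by (simp add: diff_eq_eq add.assoc)

lemmas zero_simps =
  divided_powers.D_0[OF X] divided_powers.D_0[OF Y] divided_powers.D_0[OF Z]

lemmas mult_simps =
  divided_powers.D_mult[OF X] divided_powers.D_mult[OF Y] divided_powers.D_mult[OF Z]

end

text \<open>A module with generators \<open>y l\<close> (\<open>\<doteq>\<close> being equality modulo \<open>L\<close>) that satisfies the
  relations which the elements \<open>Y (2 ^ l)\<close> satisfy modulo the left ideal generated by the
  \<open>X (2 ^ k)\<close>.\<close>

locale heisenberg2_module = heisenberg2 X Y Z + submodule L + y: divided_syzygy Y L y
  for X Y Z :: "nat \<Rightarrow> 'a::{ring,monoid_mult}" and L :: "('i \<Rightarrow>\<^sub>0 'a) set" and y +
  assumes Xy_less: "k < l \<Longrightarrow> X (2 ^ k) \<odot> y l \<doteq> Z (2 ^ k) \<odot> divided_lift Y y (2 ^ l - 2 ^ k)"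
    and Xy_greater: "l < k \<Longrightarrow> X (2 ^ k) \<odot> y l \<doteq> 0"
begin

abbreviation "yl \<equiv> divided_lift Y y"

lemma yl_power: "yl (2 ^ k) = y k"
  by (rule y.divided_lift_power)

text \<open>The action of \<open>X s\<close> on the lift of \<open>Y b\<close> is the expected one, except in
  degree \<open>s = b\<close>, where the value \<open>zl b\<close> is new.\<close>

definition straight :: "nat \<Rightarrow> bool" where
  "straight b \<longleftrightarrow> (\<forall>s. (s < b \<longrightarrow> X s \<odot> yl b \<doteq> Z s \<odot> yl (b - s)) \<and> (b < s \<longrightarrow> X s \<odot> yl b \<doteq> 0))"

lemma straight_less: "straight b \<Longrightarrow> s < b \<Longrightarrow> X s \<odot> yl b \<doteq> Z s \<odot> yl (b - s)"
  and straight_greater: "straight b \<Longrightarrow> b < s \<Longrightarrow> X s \<odot> yl b \<doteq> 0"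
  by (auto simp: straight_def)

text \<open>For a power of two, splitting off one digit of \<open>s\<close> reduces the claim to smaller
  lifts.\<close>

lemma straight_power:
  assumes "\<And>b. 0 < b \<Longrightarrow> b < 2 ^ l \<Longrightarrow> straight b"
  shows "straight (2 ^ l)"
  unfolding straight_def yl_power
proof (intro allI conjI impI)
  fix s :: nat assume s: "s < 2 ^ l"
  show "X s \<odot> y l \<doteq> Z s \<odot> yl (2 ^ l - s)"
  proof (cases "s = 0")
    case True
    then show ?thesis by (simp add: zero_simps act_simps yl_power)
  next
    case False
    then obtain k where k: "bit s k" using ex_bit by blast
    note le = bit_minus_power(1)[OF k]
    with s have kl: "k < l" by (metis le_less_trans power_less_imp_less_exp one_less_numeral_iff semiring_norm(76))
    have "X s \<odot> y l = X (s - 2 ^ k) \<odot> X (2 ^ k) \<odot> y l"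
      by (simp add: act_act divided_powers.D_split[OF X k])
    also have "\<dots> \<doteq> X (s - 2 ^ k) \<odot> Z (2 ^ k) \<odot> yl (2 ^ l - 2 ^ k)"
      by (intro cgr_act Xy_less kl)
    also have "\<dots> = Z (2 ^ k) \<odot> X (s - 2 ^ k) \<odot> yl (2 ^ l - 2 ^ k)"
      by (simp add: act_act ZX)
    also have "\<dots> \<doteq> Z (2 ^ k) \<odot> Z (s - 2 ^ k) \<odot> yl (2 ^ l - 2 ^ k - (s - 2 ^ k))"
      using s le kl by (intro cgr_act straight_less assms) (auto intro: power_strict_increasing)
    also have "2 ^ l - 2 ^ k - (s - 2 ^ k) = 2 ^ l - s" using le by simp
    also have "Z (2 ^ k) \<odot> Z (s - 2 ^ k) \<odot> yl (2 ^ l - s) = Z s \<odot> yl (2 ^ l - s)"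
      using k le by (simp add: act_act mult_simps odd_choose_power)
    finally show ?thesis .
  qed
next
  fix s :: nat assume s: "2 ^ l < s"
  have "\<exists>k. bit s k \<and> k \<noteq> l"
  proof (rule ccontr)
    assume "\<not> ?thesis"
    moreover obtain k where "bit s k" using ex_bit s by (metis less_nat_zero_code)
    ultimately have "s = 2 ^ l" by (intro bit_eqI) (auto simp: bit_simps)
    with s show False by simp
  qed
  then obtain k where k: "bit s k" "k \<noteq> l" by blast
  note le = bit_minus_power(1)[OF k(1)]
  have eq: "X s \<odot> y l = X (s - 2 ^ k) \<odot> X (2 ^ k) \<odot> y l"
    by (simp add: act_act divided_powers.D_split[OF X k(1)])
  show "X s \<odot> y l \<doteq> 0"
  proof (cases "k < l")
    case True
    have "X (s - 2 ^ k) \<odot> X (2 ^ k) \<odot> y l \<doteq> X (s - 2 ^ k) \<odot> Z (2 ^ k) \<odot> yl (2 ^ l - 2 ^ k)"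
      by (intro cgr_act Xy_less True)
    also have "\<dots> = Z (2 ^ k) \<odot> X (s - 2 ^ k) \<odot> yl (2 ^ l - 2 ^ k)"
      by (simp add: act_act ZX)
    also have "\<dots> \<doteq> 0"
    proof -
      have "2 ^ l - 2 ^ k < s - 2 ^ k"
        by (rule diff_less_mono) (use s True in auto)
      then show ?thesis
        by (intro cgr_act0[of "X _ \<odot> _"] straight_greater assms) (use True in auto)
    qed
    finally show ?thesis by (simp add: eq)
  next
    case False
    with k have "l < k" by simp
    then show ?thesis unfolding eq by (intro cgr_act0 Xy_greater)
  qed
qed

lemma Y_yl:
  "m \<noteq> 0 \<Longrightarrow> Y t \<odot> yl m \<doteq> (if odd ((t + m) choose t) then yl (t + m) else 0)"
  by (rule y.D_divided_lift)

text \<open>In the exchange formula for \<open>X (2 ^ k) * Y (2 ^ k)\<close>, applied to \<open>y k\<close>,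
  only the first and the last term survive; all others carry an even binomial coefficient.\<close>

lemma YXy_same:
  assumes "straight (2 ^ k)"
  shows "Y (2 ^ k) \<odot> X (2 ^ k) \<odot> y k \<doteq> Z (2 ^ k) \<odot> y k"
proof -
  let ?a = "2 ^ k :: nat"
  have "X ?a \<odot> Y ?a \<odot> y k = (\<Sum>j\<le>?a. (Z j * Y (?a - j) * X (?a - j)) \<odot> y k)"
    by (simp add: act_act XY act_sum)
  also have "\<dots> = Y ?a \<odot> X ?a \<odot> y k + (\<Sum>j\<in>{1..?a}. (Z j * Y (?a - j) * X (?a - j)) \<odot> y k)"
  proof -
    have "{..?a} = insert 0 {1..?a}" by auto
    then show ?thesis by (simp add: zero_simps act_act)
  qed
  also have "\<dots> \<doteq> Y ?a \<odot> X ?a \<odot> y k + (\<Sum>j\<in>{1..?a}. if j = ?a then Z ?a \<odot> y k else 0)"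
  proof (intro cgr_add cgr_refl cgr_sum)
    fix j assume j: "j \<in> {1..?a}"
    show "(Z j * Y (?a - j) * X (?a - j)) \<odot> y k \<doteq> (if j = ?a then Z ?a \<odot> y k else 0)"
    proof (cases "j = ?a")
      case False
      with j have j': "0 < ?a - j" "?a - j < ?a" by auto
      have "(Z j * Y (?a - j) * X (?a - j)) \<odot> y k = Z j \<odot> Y (?a - j) \<odot> X (?a - j) \<odot> y k"
        by (simp add: act_act mult.assoc)
      also have "\<dots> \<doteq> Z j \<odot> Y (?a - j) \<odot> Z (?a - j) \<odot> yl (?a - (?a - j))"
        using straight_less[OF assms j'(2)] by (intro cgr_act) (simp add: yl_power)
      also have "\<dots> = (Z j * Z (?a - j)) \<odot> Y (?a - j) \<odot> yl j"
        using j by (simp add: act_act mult.assoc ZY)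
      also have "Z j * Z (?a - j) = 0"
        using j j' by (simp add: mult_simps even_power_choose)
      finally show ?thesis using False by (simp add: act_simps)
    qed (simp add: zero_simps act_act)
  qed
  also have "(\<Sum>j\<in>{1..?a}. if j = ?a then Z ?a \<odot> y k else 0) = Z ?a \<odot> y k"
    by simp
  finally have "X ?a \<odot> Y ?a \<odot> y k \<doteq> Y ?a \<odot> X ?a \<odot> y k + Z ?a \<odot> y k" .
  then have "Y ?a \<odot> X ?a \<odot> y k + Z ?a \<odot> y k \<doteq> 0"
    by (meson cgr_sym cgr_trans cgr_act0 y.square)
  then show ?thesis by (simp add: cgr_def minus_eq_plus)
qed

text \<open>Here \<open>X (2 ^ l) \<odot> Y (2 ^ k) \<odot> y l\<close> is evaluated twice: by the exchange
  formula, and after replacing \<open>Y (2 ^ k) \<odot> y l\<close> by \<open>Y (2 ^ l) \<odot> y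
  k\<close>.\<close>

lemma YXy_different:
  assumes "straight (2 ^ k)" "straight (2 ^ l)" "k \<noteq> l"
  shows "Y (2 ^ k) \<odot> X (2 ^ l) \<odot> y l \<doteq> Z (2 ^ l) \<odot> y k"
proof -
  let ?a = "2 ^ l :: nat" and ?b = "2 ^ k :: nat"
  have ab: "?a \<noteq> ?b" using assms(3) by simp
  have "X ?a \<odot> Y ?b \<odot> y l = (\<Sum>j\<le>min ?a ?b. (Z j * Y (?b - j) * X (?a - j)) \<odot> y l)"
    by (simp add: act_act XY act_sum)
  also have "\<dots> \<doteq> (\<Sum>j\<le>min ?a ?b. if j = 0 then Y ?b \<odot> X ?a \<odot> y l else 0)"
  proof (intro cgr_sum)
    fix j assume j: "j \<in> {..min ?a ?b}"
    show "(Z j * Y (?b - j) * X (?a - j)) \<odot> y l \<doteq> (if j = 0 then Y ?b \<odot> X ?a \<odot> y l else 0)"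
    proof (cases "j = 0")
      case False
      have "(Z j * Y (?b - j) * X (?a - j)) \<odot> y l = Z j \<odot> Y (?b - j) \<odot> X (?a - j) \<odot> y l"
        by (simp add: act_act mult.assoc)
      also have "\<dots> \<doteq> Z j \<odot> Y (?b - j) \<odot> Z (?a - j) \<odot> yl (?a - (?a - j))"
        using straight_less[OF assms(2), of "?a - j"] False by (intro cgr_act) (simp add: yl_power)
      also have "\<dots> = (Z j * Z (?a - j)) \<odot> Y (?b - j) \<odot> yl j"
        using j by (simp add: act_act mult.assoc ZY)
      also have "\<dots> \<doteq> (Z j * Z (?a - j)) \<odot> (if odd (?b choose (?b - j)) then yl ?b else 0)"
        
        proof -
          have e: "?b - j + j = ?b" using j by simp
          show ?thesis by (rule cgr_act, rule Y_yl[OF False, of "?b - j", unfolded e])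
        qed
      also have "\<dots> = 0"
      proof (cases "j < ?a")
        case True
        then show ?thesis using False by (simp add: mult_simps even_power_choose act_simps)
      next
        case ge: False
        with j ab have "0 < ?b - j" "?b - j < ?b" by auto
        then show ?thesis by (simp add: even_power_choose act_simps)
      qed
      finally show ?thesis using False by simp
    qed (simp add: zero_simps act_act)
  qed
  also have "\<dots> = Y ?b \<odot> X ?a \<odot> y l" by simp
  finally have 1: "X ?a \<odot> Y ?b \<odot> y l \<doteq> Y ?b \<odot> X ?a \<odot> y l" .
  have "X ?a \<odot> Y ?a \<odot> y k = (\<Sum>j\<le>?a. (Z j * Y (?a - j) * X (?a - j)) \<odot> y k)"
    by (simp add: act_act XY act_sum)
  also have "\<dots> \<doteq> (\<Sum>j\<le>?a. if j = ?a then Z ?a \<odot> y k else 0)"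
  proof (intro cgr_sum)
    fix j assume j: "j \<in> {..?a}"
    show "(Z j * Y (?a - j) * X (?a - j)) \<odot> y k \<doteq> (if j = ?a then Z ?a \<odot> y k else 0)"
    proof (cases "j = ?a")
      case False
      define u where "u = ?a - j"
      have u: "0 < u" "j = ?a - u" "u \<le> ?a" using False j by (auto simp: u_def)
      have eq: "(Z j * Y (?a - j) * X (?a - j)) \<odot> y k = Z j \<odot> Y u \<odot> X u \<odot> y k"
        by (simp add: act_act mult.assoc u_def)
      consider "u < ?b" | "u = ?b" | "u > ?b" by linarith
      then have "Z j \<odot> Y u \<odot> X u \<odot> y k \<doteq> 0"
      proof cases
        case 1
        have "Z j \<odot> Y u \<odot> X u \<odot> y k \<doteq> Z j \<odot> Y u \<odot> Z u \<odot> yl (?b - u)"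
          using straight_less[OF assms(1) 1] by (intro cgr_act) (simp add: yl_power)
        also have "\<dots> = Z j \<odot> Z u \<odot> Y u \<odot> yl (?b - u)"
          by (simp add: act_act ZY)
        also have "\<dots> \<doteq> 0"
          by (rule cgr_act0, rule cgr_act0) (use Y_yl[of "?b - u" u] 1 u in \<open>simp add: even_power_choose\<close>)
        finally show ?thesis .
      next
        case 2
        have "Z j \<odot> Y u \<odot> X u \<odot> y k \<doteq> Z j \<odot> Z ?b \<odot> y k"
          unfolding 2 by (intro cgr_act YXy_same assms)
        also have "\<dots> = 0"
          using u 2 ab by (simp add: act_act mult_simps even_power_choose act_simps)
        finally show ?thesis .
      next
        case 3
        then show ?thesis
          by (intro cgr_act0[of "X u \<odot> y k"] cgr_act0[of "Y u \<odot> X u \<odot> y k"])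
            (use straight_greater[OF assms(1) 3] in \<open>simp add: yl_power\<close>)
      qed
      then show ?thesis using False by (simp add: eq)
    qed (simp add: zero_simps act_act)
  qed
  also have "\<dots> = Z ?a \<odot> y k" by simp
  finally have 2: "X ?a \<odot> Y ?a \<odot> y k \<doteq> Z ?a \<odot> y k" .
  have "Y ?b \<odot> X ?a \<odot> y l \<doteq> X ?a \<odot> Y ?b \<odot> y l" by (rule cgr_sym[OF 1])
  also have "\<dots> \<doteq> X ?a \<odot> Y ?a \<odot> y k" by (intro cgr_act y.swap)
  finally show ?thesis using 2 by (rule cgr_trans)
qed

lemma YXy:
  assumes "m \<noteq> 0" "straight (2 ^ l)" "\<And>k. 2 ^ k \<le> m \<Longrightarrow> straight (2 ^ k)"
  shows "Y m \<odot> X (2 ^ l) \<odot> y l \<doteq> Z (2 ^ l) \<odot> yl m"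
proof -
  obtain k where k: "bit m k" using assms(1) ex_bit by blast
  have "Y m \<odot> X (2 ^ l) \<odot> y l = Y (m - 2 ^ k) \<odot> Y (2 ^ k) \<odot> X (2 ^ l) \<odot> y l"
    by (simp add: act_act mult.assoc divided_powers.D_split[OF Y k])
  also have "\<dots> \<doteq> Y (m - 2 ^ k) \<odot> Z (2 ^ l) \<odot> y k"
    using YXy_same[of k] YXy_different[of k l] assms bit_minus_power(1)[OF k]
    by (intro cgr_act) (cases "k = l"; simp)
  also have "\<dots> = Z (2 ^ l) \<odot> Y (m - 2 ^ k) \<odot> y k" by (simp add: act_act ZY)
  also have "\<dots> \<doteq> Z (2 ^ l) \<odot> yl m" by (intro cgr_act cgr_sym[OF y.divided_lift_bit] k)
  finally show ?thesis .
qed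

text \<open>For other \<open>b\<close> one digit is split off. The terms of the exchange formula then all
  contribute the same element, with multiplicities adding up to \<open>b choose t\<close> by the Vandermonde
  identity.\<close>

lemma straight_step:
  assumes i: "bit b i" and b: "b \<noteq> 2 ^ i" and IH: "\<And>b'. 0 < b' \<Longrightarrow> b' < b \<Longrightarrow> straight b'"
  shows "straight b"
proof -
  define t where "t = b - 2 ^ i"
  note le = bit_minus_power(1)[OF i]
  have t: "0 < t" "b = t + 2 ^ i" "t < b" using le b by (auto simp: t_def)
  have ib: "2 ^ i < b" using t by simp
  have exp: "X s \<odot> yl b \<doteq> (\<Sum>j\<le>min s t. Z j \<odot> Y (t - j) \<odot> X (s - j) \<odot> y i)" for s
  proof -
    have "X s \<odot> yl b \<doteq> X s \<odot> Y t \<odot> y i"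
      unfolding t_def by (intro cgr_act y.divided_lift_bit i)
    also have "\<dots> = (\<Sum>j\<le>min s t. Z j \<odot> Y (t - j) \<odot> X (s - j) \<odot> y i)"
      by (simp add: act_act XY act_sum mult.assoc)
    finally show ?thesis .
  qed
  have Pi: "straight (2 ^ i)" using IH ib by simp
  have big: "X u \<odot> y i \<doteq> 0" if "2 ^ i < u" for u
    using straight_greater[OF Pi that] by (simp add: yl_power)
  show ?thesis unfolding straight_def
  proof (intro allI conjI impI)
    fix s assume s: "b < s"
    have "(\<Sum>j\<le>min s t. Z j \<odot> Y (t - j) \<odot> X (s - j) \<odot> y i) \<doteq> (\<Sum>j\<le>min s t. 0)"
      using s t by (intro cgr_sum cgr_act0 big) auto
    then show "X s \<odot> yl b \<doteq> 0" using exp[of s] cgr_trans by simp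
  next
    fix s assume s: "s < b"
    let ?u = "Z s \<odot> yl (b - s)"
    have "Z j \<odot> Y (t - j) \<odot> X (s - j) \<odot> y i \<doteq>
        (if odd ((s choose j) * ((b - s) choose (t - j))) then ?u else 0)"
      if j: "j \<le> min s t" for j
    proof -
      consider "s - j < 2 ^ i" | "s - j = 2 ^ i" | "s - j > 2 ^ i" by linarith
      then show ?thesis
      proof cases
        case 1
        have "Z j \<odot> Y (t - j) \<odot> X (s - j) \<odot> y i \<doteq>
            Z j \<odot> Y (t - j) \<odot> Z (s - j) \<odot> yl (2 ^ i - (s - j))"
          using straight_less[OF Pi 1] by (intro cgr_act) (simp add: yl_power)
        also have "\<dots> = (Z j * Z (s - j)) \<odot> Y (t - j) \<odot> yl (2 ^ i - (s - j))"
          by (simp add: act_act mult.assoc ZY)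
        also have "\<dots> \<doteq> (Z j * Z (s - j)) \<odot>
            (if odd ((b - s) choose (t - j)) then yl (b - s) else 0)"
        proof -
          have e: "t - j + (2 ^ i - (s - j)) = b - s" using t j 1 by simp
          show ?thesis
            by (rule cgr_act, rule Y_yl[of "2 ^ i - (s - j)" "t - j", unfolded e]) (use 1 in simp)
        qed
        finally show ?thesis using j by (auto simp: mult_simps act_simps)
      next
        case 2
        then have bs: "t - j = b - s" "b - s \<noteq> 0" using t s j by auto
        have "Z j \<odot> Y (t - j) \<odot> X (s - j) \<odot> y i \<doteq> Z j \<odot> Z (2 ^ i) \<odot> yl (b - s)"
          unfolding 2 bs(1)
        proof (intro cgr_act YXy bs Pi)
          fix k :: nat assume "2 ^ k \<le> b - s"
          moreover have "s \<noteq> 0" using 2 by (metis diff_0_eq_0 power_not_zero zero_neq_numeral)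
          then have "b - s < b" using t by simp
          ultimately show "straight (2 ^ k)" by (intro IH) auto
        qed
        also have "\<dots> = (if odd (s choose j) then ?u else 0)"
          using 2 j by (auto simp: act_act mult_simps act_simps simp flip: 2)
        finally show ?thesis using bs by simp
      next
        case 3
        have "(b - s) choose (t - j) = 0" using t j s 3 by (intro binomial_eq_0) simp
        then have "even ((s choose j) * ((b - s) choose (t - j)))" by (simp only: mult_0_right) simp
        then show ?thesis using cgr_act0[OF cgr_act0[OF big[OF 3]]] by simp
      qed
    qed
    then have "(\<Sum>j\<le>min s t. Z j \<odot> Y (t - j) \<odot> X (s - j) \<odot> y i) \<doteq>
        (\<Sum>j\<le>min s t. if odd ((s choose j) * ((b - s) choose (t - j))) then ?u else 0)"
      by (intro cgr_sum) auto
    also have "\<dots> = (if odd (\<Sum>j\<le>min s t. (s choose j) * ((b - s) choose (t - j))) then ?u else 0)"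
      by (rule sum_parity[OF double_act]) simp
    \<comment> \<open>the summands with \<open>j > s\<close> vanish\<close>
    also have "(\<Sum>j\<le>min s t. (s choose j) * ((b - s) choose (t - j))) =
        (\<Sum>j\<le>t. (s choose j) * ((b - s) choose (t - j)))"
      by (rule sum.mono_neutral_left) auto
    also have "\<dots> = (b choose t)" using vandermonde[of s "b - s" t] s by simp
    also have "(if odd (b choose t) then ?u else 0) = ?u"
      using odd_choose_power(2)[OF i] by (simp add: t_def)
    finally show "X s \<odot> yl b \<doteq> ?u" using exp[of s] cgr_trans by blast
  qed
qed

lemma straight: "0 < b \<Longrightarrow> straight b"
proof (induction b rule: less_induct)
  case (less b)
  then obtain i where i: "bit b i" using ex_bit by blast
  show ?case
  proof (cases "b = 2 ^ i")
    case True
    then show ?thesis using straight_power less by blast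
  next
    case False
    then show ?thesis using straight_step[OF i] less by blast
  qed
qed

text \<open>These elements lift \<open>Z m\<close> up to terms in the left ideal generated by the \<open>X (2
  ^ k)\<close>.\<close>

definition zl :: "nat \<Rightarrow> 'i \<Rightarrow>\<^sub>0 'a" where
  "zl m = X m \<odot> yl m"

lemma zl_bit:
  assumes "bit m i"
  shows "zl m \<doteq> Z (m - 2 ^ i) \<odot> X (2 ^ i) \<odot> y i"
proof -
  let ?t = "m - 2 ^ i"
  note le = bit_minus_power(1)[OF assms]
  have "zl m \<doteq> X m \<odot> Y ?t \<odot> y i"
    unfolding zl_def by (intro cgr_act y.divided_lift_bit assms)
  also have "\<dots> = (\<Sum>j\<le>?t. Z j \<odot> Y (?t - j) \<odot> X (m - j) \<odot> y i)"
    by (simp add: act_act XY act_sum mult.assoc)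
  also have "\<dots> \<doteq> (\<Sum>j\<le>?t. if j = ?t then Z ?t \<odot> X (2 ^ i) \<odot> y i else 0)"
  proof (intro cgr_sum)
    fix j assume j: "j \<in> {..?t}"
    show "Z j \<odot> Y (?t - j) \<odot> X (m - j) \<odot> y i \<doteq> (if j = ?t then Z ?t \<odot> X (2 ^ i) \<odot> y i else 0)"
    proof (cases "j = ?t")
      case True
      then show ?thesis using le by (simp add: zero_simps act_simps)
    next
      case False
      with j le have "2 ^ i < m - j" by auto
      then have "X (m - j) \<odot> y i \<doteq> 0"
        using straight_greater[OF straight, of "2 ^ i" "m - j"] by (simp add: yl_power)
      then show ?thesis using False by (simp add: cgr_act0)
    qed
  qed
  finally show ?thesis by simp
qed

text \<open>This is where the next generator enters: \<open>X (2 ^ i) * X (2 ^ i) = 0\<close> is applied to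
  \<open>y (Suc i)\<close>.\<close>

lemma ZXy: "Z (2 ^ i) \<odot> X (2 ^ i) \<odot> y i \<doteq> 0"
proof -
  have eq: "2 ^ Suc i - 2 ^ i = (2 ^ i :: nat)" by simp
  have "Z (2 ^ i) \<odot> X (2 ^ i) \<odot> y i = X (2 ^ i) \<odot> Z (2 ^ i) \<odot> yl (2 ^ Suc i - 2 ^ i)"
    unfolding eq by (simp add: act_act ZX yl_power)
  also have "\<dots> \<doteq> X (2 ^ i) \<odot> X (2 ^ i) \<odot> y (Suc i)"
    by (intro cgr_act cgr_sym[OF Xy_less]) simp
  also have "\<dots> = 0"
    by (simp add: act_act mult_simps act_simps odd_choose_add_iff)
  finally show ?thesis .
qed

sublocale z: divided_syzygy Z L "\<lambda>l. X (2 ^ l) \<odot> y l"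
proof (intro divided_syzygy.intro divided_syzygy_axioms.intro Z)
  show "submodule L" by (rule submodule_axioms)
  show "Z (2 ^ k) \<odot> X (2 ^ k) \<odot> y k \<doteq> 0" for k by (rule ZXy)
  show "Z (2 ^ k) \<odot> X (2 ^ l) \<odot> y l \<doteq> Z (2 ^ l) \<odot> X (2 ^ k) \<odot> y k" for k l
  proof (cases "k = l")
    case False
    have "bit (2 ^ k + 2 ^ l :: nat) k \<and> bit (2 ^ k + 2 ^ l :: nat) l"
      using False by (subst (1 2) bit_disjoint_add) auto
    then have "zl (2 ^ k + 2 ^ l) \<doteq> Z (2 ^ l) \<odot> X (2 ^ k) \<odot> y k"
      "zl (2 ^ k + 2 ^ l) \<doteq> Z (2 ^ k) \<odot> X (2 ^ l) \<odot> y l"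
      using zl_bit[of "2 ^ k + 2 ^ l" k] zl_bit[of "2 ^ k + 2 ^ l" l] by simp_all
    then show ?thesis using cgr_sym cgr_trans by blast
  qed simp
qed

lemma zl_divided_lift: "m \<noteq> 0 \<Longrightarrow> zl m \<doteq> divided_lift Z (\<lambda>l. X (2 ^ l) \<odot> y l) m"
  unfolding divided_lift_def by (intro zl_bit some_bit)

lemma Z_zl:
  assumes "m \<noteq> 0"
  shows "Z c \<odot> zl m \<doteq> (if odd ((c + m) choose c) then zl (c + m) else 0)"
proof -
  have "Z c \<odot> zl m \<doteq> Z c \<odot> divided_lift Z (\<lambda>l. X (2 ^ l) \<odot> y l) m"
    by (intro cgr_act zl_divided_lift assms)
  also have "\<dots> \<doteq> (if odd ((c + m) choose c) then divided_lift Z (\<lambda>l. X (2 ^ l) \<odot> y l) (c + m) else 0)"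
    by (rule z.D_divided_lift[OF assms])
  also have "\<dots> \<doteq> (if odd ((c + m) choose c) then zl (c + m) else 0)"
    using zl_divided_lift[of "c + m"] assms by (simp add: cgr_sym)
  finally show ?thesis .
qed

lemma Y_zl:
  assumes "m \<noteq> 0" "t \<noteq> 0"
  shows "Y t \<odot> zl m \<doteq> Z m \<odot> yl t"
proof -
  obtain i where i: "bit m i" using assms ex_bit by blast
  note le = bit_minus_power(1)[OF i]
  have "Y t \<odot> zl m \<doteq> Y t \<odot> Z (m - 2 ^ i) \<odot> X (2 ^ i) \<odot> y i"
    by (intro cgr_act zl_bit i)
  also have "\<dots> = Z (m - 2 ^ i) \<odot> Y t \<odot> X (2 ^ i) \<odot> y i" by (simp add: act_act ZY mult.assoc[symmetric])
  also have "\<dots> \<doteq> Z (m - 2 ^ i) \<odot> Z (2 ^ i) \<odot> yl t"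
    by (intro cgr_act YXy assms straight) simp_all
  also have "\<dots> = Z m \<odot> yl t"
    unfolding act_act using divided_powers.D_split[OF Z i] by simp
  finally show ?thesis .
qed

lemma X_zl: "s \<noteq> 0 \<Longrightarrow> m \<noteq> 0 \<Longrightarrow> X s \<odot> zl m \<doteq> 0"
  using straight_greater[OF straight, of m "s + m"]
  by (auto simp: zl_def act_act mult_simps act_simps)

lemma X_yl:
  assumes "b \<noteq> 0"
  shows "X s \<odot> yl b \<doteq> (if s < b then Z s \<odot> yl (b - s) else if s = b then zl b else 0)"
  using straight_less[OF straight, of b s] straight_greater[OF straight, of b s] assms
  by (auto simp: zl_def)

end

section \<open>Standard lifts span the first syzygies modulo the relations\<close>

lemma group_closure_act:
  assumes "u \<in> group_closure E" "\<And>e. e \<in> E \<Longrightarrow> a \<odot> e \<in> group_closure F"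
  shows "a \<odot> u \<in> group_closure F"
  using assms(1) by induction (auto simp: act_simps assms(2) intro: group_closure.diff)

text \<open>The same rules in an algebra over a field that is spanned by the products \<open>Z c * Y b * X
  s\<close>.\<close>

locale kostant2 = heisenberg2 X Y Z
  for X Y Z :: "nat \<Rightarrow> 'a::{ring,monoid_mult}" +
  fixes \<kappa> :: "'k::field \<Rightarrow> 'a"
  assumes \<kappa>_commute: "\<kappa> r * a = a * \<kappa> r" and \<kappa>_mult: "\<kappa> r * \<kappa> s = \<kappa> (r * s)" and \<kappa>_1: "\<kappa> 1 = 1"
    and generated: "a \<in> group_closure {\<kappa> r * Z c * Y b * X s | r c b s. True}"
begin

lemma act_closed:
  assumes "0 \<in> S" "\<And>u v. u \<in> S \<Longrightarrow> v \<in> S \<Longrightarrow> u - v \<in> S"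
    and "\<And>r u. u \<in> S \<Longrightarrow> \<kappa> r \<odot> u \<in> S" "\<And>s u. u \<in> S \<Longrightarrow> X s \<odot> u \<in> S"
    and "\<And>s u. u \<in> S \<Longrightarrow> Y s \<odot> u \<in> S" "\<And>s u. u \<in> S \<Longrightarrow> Z s \<odot> u \<in> S"
    and u: "u \<in> S"
  shows "a \<odot> u \<in> S"
  using generated[of a]
  by induction (auto simp: act_simps assms(1,2) u act_act[symmetric] mult.assoc intro!: assms(3-6))

lemma submodule_group_closure:
  assumes E: "\<And>e r. e \<in> E \<Longrightarrow> \<kappa> r \<odot> e \<in> E"
    and X: "\<And>e s. e \<in> E \<Longrightarrow> X s \<odot> e \<in> group_closure E"
    and Y: "\<And>e s. e \<in> E \<Longrightarrow> Y s \<odot> e \<in> group_closure E"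
    and Z: "\<And>e s. e \<in> E \<Longrightarrow> Z s \<odot> e \<in> group_closure E"
  shows "submodule (group_closure E)"
proof
  show "a \<odot> u \<in> group_closure E" if "u \<in> group_closure E" for u a
    using that
    by (rule act_closed[rotated 6])
      (auto intro: group_closure.diff group_closure_act in_group_closure assms)
qed (auto intro: group_closure.diff)

end

text \<open>A module with generators \<open>x k\<close>, \<open>y k\<close> and a submodule \<open>L\<close>
  of relations. \<open>T (c, b, a)\<close> is the standard lift of the monomial \<open>Z c * Y b * X
  a\<close>; when \<open>a = b = 0\<close> it lifts \<open>X c * Y c\<close> instead, which has \<open>Z
  c\<close> as its only term without \<open>X\<close> and \<open>Y\<close>.\<close>

locale kostant2_presentation = kostant2 X Y Z \<kappa> + submodule L +
    x: divided_syzygy X L x + y: divided_syzygy Y L y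
  for X Y Z :: "nat \<Rightarrow> 'a::{ring,monoid_mult}" and \<kappa> :: "'k::field \<Rightarrow> 'a"
    and L :: "('i \<Rightarrow>\<^sub>0 'a) set" and x y +
  fixes T :: "nat \<times> nat \<times> nat \<Rightarrow> 'i \<Rightarrow>\<^sub>0 'a"
  assumes T_def: "T (c, b, a) =
      (if a \<noteq> 0 then Z c \<odot> Y b \<odot> divided_lift X x a else if b \<noteq> 0 then Z c \<odot> divided_lift Y y b
       else X c \<odot> divided_lift Y y c)"
    and exchange: "k \<noteq> l \<Longrightarrow> X (2 ^ k) \<odot> y l \<doteq>
      (\<Sum>j\<le>min (2 ^ k) (2 ^ l). T (j, 2 ^ l - j, 2 ^ k - j))"
begin

text \<open>The span \<open>L1\<close> of the relations and of the standard lifts that end in some \<open>x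
  k\<close>.\<close>

definition E1 where "E1 = L \<union> {\<kappa> r \<odot> T (c, b, a) | r c b a. a \<noteq> 0}"

definition L1 where "L1 = group_closure E1"

lemma \<kappa>_T: "D \<odot> \<kappa> r \<odot> u = \<kappa> r \<odot> D \<odot> u"
  by (simp add: act_act \<kappa>_commute)

lemma \<kappa>_E1: "e \<in> E1 \<Longrightarrow> \<kappa> r \<odot> e \<in> E1"
  unfolding E1_def by (auto simp: act_act \<kappa>_mult intro: act_in) blast

lemma \<kappa>_L1: "u \<in> L1 \<Longrightarrow> \<kappa> r \<odot> u \<in> L1"
  unfolding L1_def by (rule group_closure_act) (auto intro: in_group_closure \<kappa>_E1)

lemma L_L1: "u \<in> L \<Longrightarrow> u \<in> L1"
  by (simp add: L1_def E1_def in_group_closure)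

lemma L1_cgr: "u \<doteq> v \<Longrightarrow> v \<in> L1 \<Longrightarrow> u \<in> L1"
  using group_closure_add[of "u - v" E1 v] L_L1[of "u - v"] by (simp add: cgr_def L1_def)

lemma T_L1: "a \<noteq> 0 \<Longrightarrow> Z c \<odot> Y b \<odot> divided_lift X x a \<in> L1"
proof -
  assume "a \<noteq> 0"
  then have "\<kappa> 1 \<odot> T (c, b, a) \<in> L1" unfolding L1_def E1_def by (intro in_group_closure) blast
  with \<open>a \<noteq> 0\<close> show ?thesis by (simp add: T_def \<kappa>_1 act_simps)
qed

lemma zero_L1: "0 \<in> L1"
  by (simp add: L1_def)

lemma submodule_L1: "submodule L1"
  unfolding L1_def
proof (rule submodule_group_closure)
  fix e s assume "e \<in> E1"
  then consider "e \<in> L" | r c b a where "e = \<kappa> r \<odot> Z c \<odot> Y b \<odot> divided_lift X x a" "a \<noteq> 0"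
    by (auto simp: E1_def T_def)
  then have "X s \<odot> e \<in> L1 \<and> Y s \<odot> e \<in> L1 \<and> Z s \<odot> e \<in> L1"
  proof cases
    case 1
    then show ?thesis by (auto intro: L_L1 act_in)
  next
    case 2
    have "Z s \<odot> Z c \<odot> Y b \<odot> divided_lift X x a \<in> L1"
    proof -
      have "Z s \<odot> Z c \<odot> Y b \<odot> divided_lift X x a = (Z s * Z c) \<odot> Y b \<odot> divided_lift X x a"
        by (simp add: act_act mult.assoc)
      then show ?thesis using 2 by (simp add: mult_simps act_simps zero_L1 T_L1)
    qed
    moreover have "Y s \<odot> Z c \<odot> Y b \<odot> divided_lift X x a = Z c \<odot> (Y s * Y b) \<odot> divided_lift X x a"
      by (simp add: act_act ZY mult.assoc[symmetric])
    then have "Y s \<odot> Z c \<odot> Y b \<odot> divided_lift X x a \<in> L1"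
      using 2 by (simp add: mult_simps act_simps zero_L1 T_L1)
    moreover have "X s \<odot> Z c \<odot> Y b \<odot> divided_lift X x a \<in> L1"
    proof -
      have "X s \<odot> Z c \<odot> Y b \<odot> divided_lift X x a = Z c \<odot> (X s * Y b) \<odot> divided_lift X x a"
        by (simp add: act_act ZX mult.assoc[symmetric])
      also have "\<dots> = (\<Sum>j\<le>min s b. (Z c * Z j) \<odot> Y (b - j) \<odot> X (s - j) \<odot> divided_lift X x a)"
        by (simp add: XY act_sum act_act mult.assoc)
      also have "\<dots> \<in> L1"
        unfolding L1_def
      proof (rule group_closure_sum, fold L1_def)
        fix j
        have "(Z c * Z j) \<odot> Y (b - j) \<odot> X (s - j) \<odot> divided_lift X x a \<doteq> (Z c * Z j) \<odot> Y (b - j) \<odot>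
            (if odd ((s - j + a) choose (s - j)) then divided_lift X x (s - j + a) else 0)"
          using 2 by (intro cgr_act x.D_divided_lift)
        moreover have "\<dots> \<in> L1"
          using 2 by (auto simp: mult_simps act_simps zero_L1 T_L1)
        ultimately show "(Z c * Z j) \<odot> Y (b - j) \<odot> X (s - j) \<odot> divided_lift X x a \<in> L1"
          by (rule L1_cgr)
      qed
      finally show ?thesis .
    qed
    ultimately show ?thesis using 2 by (simp add: \<kappa>_T \<kappa>_L1)
  qed
  then show "X s \<odot> e \<in> group_closure E1" "Y s \<odot> e \<in> group_closure E1" "Z s \<odot> e \<in> group_closure E1"
    by (simp_all add: L1_def)
qed (rule \<kappa>_E1)

lemma T_in_L1: "a \<noteq> 0 \<Longrightarrow> T (c, b, a) \<in> L1"
  using T_L1 by (simp add: T_def)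

sublocale q: submodule L1 by (rule submodule_L1)

lemma q_cgr: "u \<doteq> v \<Longrightarrow> q.cgr u v"
  by (simp add: cgr_def q.cgr_def L_L1)

lemma q_zero: "q.cgr u 0 \<longleftrightarrow> u \<in> L1"
  by (simp add: q.cgr_def)

sublocale q: heisenberg2_module X Y Z L1 y
proof (intro heisenberg2_module.intro heisenberg2_module_axioms.intro heisenberg2_axioms submodule_L1)
  show "divided_syzygy Y L1 y"
    by (intro divided_syzygy.intro divided_syzygy_axioms.intro Y submodule_L1 q_cgr y.square y.swap)
  show "q.cgr (X (2 ^ k) \<odot> y l) (Z (2 ^ k) \<odot> divided_lift Y y (2 ^ l - 2 ^ k))" if "k < l" for k l
  proof -
    have lt: "(2 ^ k :: nat) < 2 ^ l" using that by simp
    have "q.cgr (X (2 ^ k) \<odot> y l) (\<Sum>j\<le>2 ^ k. T (j, 2 ^ l - j, 2 ^ k - j))"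
      using q_cgr[OF exchange[of k l]] that lt by (simp add: min_absorb1)
    also have "q.cgr \<dots> (\<Sum>j\<le>(2 ^ k :: nat). if j = 2 ^ k then T (2 ^ k, 2 ^ l - 2 ^ k, 0) else 0)"
      by (intro q.cgr_sum) (auto simp: q_zero T_in_L1)
    also have "\<dots> = Z (2 ^ k) \<odot> divided_lift Y y (2 ^ l - 2 ^ k)" using lt by (simp add: T_def)
    finally show ?thesis .
  qed
  show "q.cgr (X (2 ^ k) \<odot> y l) 0" if "l < k" for k l
  proof -
    have lt: "(2 ^ l :: nat) < 2 ^ k" using that by simp
    have "q.cgr (X (2 ^ k) \<odot> y l) (\<Sum>j\<le>2 ^ l. T (j, 2 ^ l - j, 2 ^ k - j))"
      using q_cgr[OF exchange[of k l]] that lt by (simp add: min_absorb2)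
    also have "q.cgr \<dots> (\<Sum>j\<le>(2 ^ l :: nat). 0)"
    proof (intro q.cgr_sum, unfold q_zero)
      fix j :: nat assume "j \<in> {..2 ^ l}"
      with lt have "2 ^ k - j \<noteq> 0" by (simp only: atMost_iff)
      then show "T (j, 2 ^ l - j, 2 ^ k - j) \<in> L1" by (rule T_in_L1)
    qed
    finally show ?thesis by simp
  qed
qed

text \<open>The span \<open>L2\<close> of the relations and of all standard lifts.\<close>

definition E2 where "E2 = L \<union> {\<kappa> r \<odot> T m | r m. m \<noteq> (0, 0, 0)}"

definition L2 where "L2 = group_closure E2"

lemma \<kappa>_E2: "e \<in> E2 \<Longrightarrow> \<kappa> r \<odot> e \<in> E2"
proof -
  assume "e \<in> E2"
  then consider "e \<in> L" | r' m where "e = \<kappa> r' \<odot> T m" "m \<noteq> (0, 0, 0)"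
    unfolding E2_def by blast
  then show "\<kappa> r \<odot> e \<in> E2"
  proof cases
    case 2
    then have "\<kappa> r \<odot> e = \<kappa> (r * r') \<odot> T m" by (simp add: act_act \<kappa>_mult)
    with 2 show ?thesis unfolding E2_def by blast
  qed (simp add: E2_def act_in)
qed

lemma \<kappa>_L2: "u \<in> L2 \<Longrightarrow> \<kappa> r \<odot> u \<in> L2"
  unfolding L2_def by (rule group_closure_act) (auto intro: in_group_closure \<kappa>_E2)

lemma L1_L2: "u \<in> L1 \<Longrightarrow> u \<in> L2"
proof -
  have "E1 \<subseteq> E2" unfolding E1_def E2_def by blast
  then have "L1 \<subseteq> L2" unfolding L1_def L2_def by (intro group_closure_mono_in) (auto intro: in_group_closure)
  then show "u \<in> L1 \<Longrightarrow> u \<in> L2" by blast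
qed

lemma L2_cgr: "q.cgr u v \<Longrightarrow> v \<in> L2 \<Longrightarrow> u \<in> L2"
  using group_closure_add[of "u - v" E2 v] L1_L2[of "u - v"] by (simp add: q.cgr_def L2_def)

lemma T_L2: "m \<noteq> (0, 0, 0) \<Longrightarrow> T m \<in> L2"
proof -
  assume "m \<noteq> (0, 0, 0)"
  then have "\<kappa> 1 \<odot> T m \<in> L2" unfolding L2_def E2_def by (intro in_group_closure) blast
  then show ?thesis by (simp add: \<kappa>_1 act_simps)
qed

lemma yl_L2: "b \<noteq> 0 \<Longrightarrow> Z c \<odot> q.yl b \<in> L2" and zl_L2: "c \<noteq> 0 \<Longrightarrow> q.zl c \<in> L2"
  using T_L2[of "(c, b, 0)"] T_L2[of "(c, 0, 0)"] by (simp_all add: T_def q.zl_def)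

lemma zero_L2: "0 \<in> L2"
  by (simp add: L2_def)

lemma submodule_L2: "submodule L2"
  unfolding L2_def
proof (rule submodule_group_closure)
  fix e s assume "e \<in> E2"
  then obtain r c b a where "e \<in> L \<or> e = \<kappa> r \<odot> T (c, b, a) \<and> (c, b, a) \<noteq> (0, 0, 0)"
    unfolding E2_def by (auto split: prod.splits)
  then consider "e \<in> L1" | "e = \<kappa> r \<odot> Z c \<odot> q.yl b" "b \<noteq> 0" | "e = \<kappa> r \<odot> q.zl c" "c \<noteq> 0"
    using T_in_L1[of a c b] L_L1[of e] \<kappa>_L1 by (cases "a = 0"; cases "b = 0") (auto simp: T_def q.zl_def)
  then have "X s \<odot> e \<in> L2 \<and> Y s \<odot> e \<in> L2 \<and> Z s \<odot> e \<in> L2"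
  proof cases
    case 1
    then show ?thesis by (auto intro: L1_L2 q.act_in)
  next
    case 2
    have "Z s \<odot> Z c \<odot> q.yl b \<in> L2"
      using 2 by (auto simp: act_act mult_simps act_simps zero_L2 yl_L2)
    moreover have "Y s \<odot> Z c \<odot> q.yl b \<in> L2"
    proof -
      have "Y s \<odot> Z c \<odot> q.yl b = Z c \<odot> Y s \<odot> q.yl b" by (simp add: act_act ZY)
      moreover have "q.cgr \<dots> (Z c \<odot> (if odd ((s + b) choose s) then q.yl (s + b) else 0))"
        using 2 by (intro q.cgr_act q.Y_yl)
      moreover have "\<dots> \<in> L2" using 2 by (simp add: yl_L2 act_simps zero_L2)
      ultimately show ?thesis by (simp only: L2_cgr)
    qed
    moreover have "X s \<odot> Z c \<odot> q.yl b \<in> L2"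
    proof -
      have "X s \<odot> Z c \<odot> q.yl b = Z c \<odot> X s \<odot> q.yl b" by (simp add: act_act ZX)
      moreover have "q.cgr \<dots> (Z c \<odot> (if s < b then Z s \<odot> q.yl (b - s) else if s = b then q.zl b else 0))"
        using 2 by (intro q.cgr_act q.X_yl)
      moreover have "Z c \<odot> Z s \<odot> q.yl (b - s) \<in> L2" if "s < b"
        using that by (auto simp: act_act mult_simps act_simps zero_L2 yl_L2)
      moreover have "Z c \<odot> q.zl b \<in> L2"
      proof (rule L2_cgr)
        show "q.cgr (Z c \<odot> q.zl b) (if odd ((c + b) choose c) then q.zl (c + b) else 0)"
          using 2 by (intro q.Z_zl)
      qed (use 2 in \<open>simp add: zl_L2 zero_L2\<close>)
      ultimately show ?thesis using zero_L2
        by (cases "s < b"; cases "s = b") (auto simp: act_simps dest: L2_cgr)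
    qed
    ultimately show ?thesis using 2 by (simp add: \<kappa>_T \<kappa>_L2)
  next
    case 3
    have "Z s \<odot> q.zl c \<in> L2"
      by (rule L2_cgr[OF q.Z_zl]) (use 3 in \<open>auto simp: zl_L2 zero_L2\<close>)
    moreover have "Y s \<odot> q.zl c \<in> L2"
    proof (cases "s = 0")
      case False
      show ?thesis by (rule L2_cgr[OF q.Y_zl]) (use 3 False in \<open>auto simp: yl_L2\<close>)
    qed (use 3 in \<open>simp add: zero_simps act_simps zl_L2\<close>)
    moreover have "X s \<odot> q.zl c \<in> L2"
    proof (cases "s = 0")
      case False
      show ?thesis by (rule L2_cgr[OF q.X_zl]) (use 3 False in \<open>auto simp: zero_L2\<close>)
    qed (use 3 in \<open>simp add: zero_simps act_simps zl_L2\<close>)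
    ultimately show ?thesis using 3 by (simp add: \<kappa>_T \<kappa>_L2)
  qed
  then show "X s \<odot> e \<in> group_closure E2" "Y s \<odot> e \<in> group_closure E2" "Z s \<odot> e \<in> group_closure E2"
    by (simp_all add: L2_def)
qed (rule \<kappa>_E2)

text \<open>As \<open>L2\<close> is a submodule and contains the generators, the standard lifts span the
  module modulo the relations.\<close>

lemma spanning: "a \<odot> x k \<in> L2" "a \<odot> y k \<in> L2"
proof -
  have "T (0, 0, 2 ^ k) = x k" "T (0, 2 ^ k, 0) = y k"
    by (simp_all add: T_def zero_simps act_simps x.divided_lift_power y.divided_lift_power)
  then have "x k \<in> L2" "y k \<in> L2"
    using T_L2[of "(0, 0, 2 ^ k)"] T_L2[of "(0, 2 ^ k, 0)"] by simp_all
  then show "a \<odot> x k \<in> L2" "a \<odot> y k \<in> L2"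
    using submodule.act_in[OF submodule_L2] by blast+
qed

end

section \<open>Graded free modules over a connected graded algebra\<close>

lemma unique_decomposition:
  fixes P :: "nat \<Rightarrow> 'm::ab_group_add \<Rightarrow> 'm"
  assumes add: "\<And>n x y. P n (x + y) = P n x + P n y"
    and same: "\<And>n y. y \<in> C n \<Longrightarrow> P n y = y" and other: "\<And>m n y. y \<in> C n \<Longrightarrow> m \<noteq> n \<Longrightarrow> P m y = 0"
    and "\<And>n. P n x \<in> C n" "finite {n. P n x \<noteq> 0}" "(\<Sum>n | P n x \<noteq> 0. P n x) = x"
  shows "\<exists>!f :: nat \<Rightarrow>\<^sub>0 'm. (\<forall>n. lookup f n \<in> C n) \<and>
    x = (\<Sum>n\<in>keys f. lookup f n)"
proof (rule ex1I)
  let ?f = "Abs_poly_mapping (\<lambda>n. P n x)"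
  have f: "lookup ?f = (\<lambda>n. P n x)"
    using assms(5) by simp
  moreover have "keys ?f = {n. P n x \<noteq> 0}" by (auto simp: in_keys_iff f)
  ultimately show "(\<forall>n. lookup ?f n \<in> C n) \<and>
      x = (\<Sum>n\<in>keys ?f. lookup ?f n)"
    using assms(4,6) by simp
  fix h :: "nat \<Rightarrow>\<^sub>0 'm"
  assume h: "(\<forall>n. lookup h n \<in> C n) \<and>
    x = (\<Sum>n\<in>keys h. lookup h n)"
  have P0: "P n 0 = 0" for n using add[of n 0 0] by simp
  have P_sum: "P n (\<Sum>i\<in>S. t i) = (\<Sum>i\<in>S. P n (t i))" for n S and t :: "nat \<Rightarrow> 'm"
    by (induction S rule: infinite_finite_induct) (simp_all add: add P0)
  show "h = ?f"
  proof (rule poly_mapping_eqI)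
    fix m
    have "P m x = (\<Sum>n\<in>keys h. P m (lookup h n))"
      using h P_sum by metis
    also have "\<dots> = (\<Sum>n\<in>keys h. if n = m then lookup h m else 0)"
    proof (intro sum.cong refl)
      fix n
      have c: "lookup h n \<in> C n" using h by blast
      show "P m (lookup h n) = (if n = m then lookup h m else 0)"
        using same[OF c] other[OF c, of m] by (cases "m = n") auto
    qed
    also have "\<dots> = lookup h m" by (simp add: in_keys_iff)
    finally show "lookup h m = lookup ?f m" by (simp add: f)
  qed
qed

text \<open>A connected graded algebra of countable dimension over a field. The field is embedded by
  \<open>\<kappa>\<close> as the component of degree zero, and \<open>pr n\<close> is the projection to the
  component of degree \<open>n\<close>.\<close>

locale graded_algebra =
  fixes G :: "nat \<Rightarrow> 'a::{ring,monoid_mult} set" and \<kappa> :: "'k::field \<Rightarrow> 'a" and pr :: "nat \<Rightarrow> 'a \<Rightarrow> 'a"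
  assumes \<kappa>_add: "\<kappa> (r + s) = \<kappa> r + \<kappa> s" and \<kappa>_mult: "\<kappa> (r * s) = \<kappa> r * \<kappa> s" and \<kappa>_1: "\<kappa> 1 = 1"
    and \<kappa>_commute: "\<kappa> r * a = a * \<kappa> r" and one_neq_zero: "(1::'a) \<noteq> 0"
    and G_0: "G 0 = range \<kappa>" and G_mult: "a \<in> G m \<Longrightarrow> b \<in> G n \<Longrightarrow> a * b \<in> G (m + n)"
    and pr_add: "pr n (a + b) = pr n a + pr n b" and pr_in: "pr n a \<in> G n"
    and pr_same: "a \<in> G n \<Longrightarrow> pr n a = a" and pr_other: "a \<in> G n \<Longrightarrow> m \<noteq> n \<Longrightarrow> pr m a = 0"
    and pr_finite: "finite {n. pr n a \<noteq> 0}" and pr_sum: "(\<Sum>n | pr n a \<noteq> 0. pr n a) = a"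
    and countable_dim: "\<exists>E. countable E \<and> (\<forall>a. a \<in> group_closure {\<kappa> r * e | r e. e \<in> E})"
begin

lemma \<kappa>_0: "\<kappa> 0 = 0"
  using \<kappa>_add[of 0 0] by simp

lemma pr_0 [simp]: "pr n 0 = 0"
  using pr_add[of n 0 0] by simp

lemma pr_minus: "pr n (a - b) = pr n a - pr n b"
  using pr_add[of n "a - b" b] by (simp add: algebra_simps)

lemma pr_of_sum: "pr n (\<Sum>i\<in>S. f i) = (\<Sum>i\<in>S. pr n (f i))"
  by (induction S rule: infinite_finite_induct) (simp_all add: pr_add)

lemma G_zero: "0 \<in> G n"
  using pr_in[of n 0] by simp

lemma pr_pr: "pr m (pr n a) = (if m = n then pr n a else 0)"
  using pr_same[OF pr_in] pr_other[OF pr_in] by simp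

lemma pr_mult_left:
  assumes "a \<in> G m" shows "pr n (a * b) = (if m \<le> n then a * pr (n - m) b else 0)"
proof -
  have "a * b = (\<Sum>i | pr i b \<noteq> 0. a * pr i b)"
    by (simp add: pr_sum flip: sum_distrib_left)
  then have "pr n (a * b) = (\<Sum>i | pr i b \<noteq> 0. pr n (a * pr i b))" by (simp add: pr_of_sum)
  also have "\<dots> = (\<Sum>i | pr i b \<noteq> 0. if i = n - m then (if m \<le> n then a * pr (n - m) b else 0) else 0)"
  proof (intro sum.cong refl)
    fix i
    have c: "a * pr i b \<in> G (m + i)" by (rule G_mult[OF assms pr_in])
    show "pr n (a * pr i b) = (if i = n - m then (if m \<le> n then a * pr (n - m) b else 0) else 0)"
      using pr_same[OF c] pr_other[OF c, of n] by (cases "n = m + i") auto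
  qed
  also have "\<dots> = (if m \<le> n then a * pr (n - m) b else 0)"
    by (simp add: pr_finite)
  finally show ?thesis .
qed

lemma pr_mult_right:
  assumes "b \<in> G m" shows "pr n (a * b) = (if m \<le> n then pr (n - m) a * b else 0)"
proof -
  have "a * b = (\<Sum>i | pr i a \<noteq> 0. pr i a * b)"
    by (simp add: pr_sum flip: sum_distrib_right)
  then have "pr n (a * b) = (\<Sum>i | pr i a \<noteq> 0. pr n (pr i a * b))" by (simp add: pr_of_sum)
  also have "\<dots> = (\<Sum>i | pr i a \<noteq> 0. if i = n - m then (if m \<le> n then pr (n - m) a * b else 0) else 0)"
  proof (intro sum.cong refl)
    fix i
    have c: "pr i a * b \<in> G (i + m)" by (rule G_mult[OF pr_in assms])
    show "pr n (pr i a * b) = (if i = n - m then (if m \<le> n then pr (n - m) a * b else 0) else 0)"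
      using pr_same[OF c] pr_other[OF c, of n] by (cases "n = i + m") auto
  qed
  also have "\<dots> = (if m \<le> n then pr (n - m) a * b else 0)"
    by (simp add: pr_finite)
  finally show ?thesis .
qed

lemma pr_0_mult: "pr 0 (a * b) = pr 0 a * pr 0 b"
proof -
  have "a * b = (\<Sum>i | pr i a \<noteq> 0. pr i a * b)"
    by (simp add: pr_sum flip: sum_distrib_right)
  then have "pr 0 (a * b) = (\<Sum>i | pr i a \<noteq> 0. if i = 0 then pr 0 a * pr 0 b else 0)"
    by (auto simp: pr_of_sum pr_mult_left[OF pr_in] intro!: sum.cong)
  then show ?thesis by (simp add: pr_finite)
qed

lemma positive_part_iff: "a \<in> positive_part G \<longleftrightarrow> pr 0 a = 0"
proof
  assume "a \<in> positive_part G"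
  then show "pr 0 a = 0"
    unfolding positive_part_def
  proof (induction rule: group_closure.induct)
    case (base s)
    then show ?case using pr_other[of s _ 0] by fastforce
  qed (simp add: pr_minus)
next
  assume *: "pr 0 a = 0"
  have "(\<Sum>n | pr n a \<noteq> 0. pr n a) \<in> positive_part G"
    unfolding positive_part_def
  proof (intro group_closure_sum in_group_closure)
    fix n assume "n \<in> {n. pr n a \<noteq> 0}"
    with * have "n \<in> {1..}" by (cases n) auto
    then show "pr n a \<in> (\<Union>d\<in>{1..}. G d)" using pr_in by blast
  qed
  then show "a \<in> positive_part G" by (simp add: pr_sum)
qed

subsection \<open>Homogeneous components\<close>

text \<open>The projection to degree \<open>n\<close> of the free module whose basis element \<open>i\<close>
  has degree \<open>\<delta> i\<close>.\<close>

definition prF :: "('i \<Rightarrow> nat) \<Rightarrow> nat \<Rightarrow> ('i \<Rightarrow>\<^sub>0 'a) \<Rightarrow> ('i \<Rightarrow>\<^sub>0 'a)" where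
  "prF \<delta> n = Poly_Mapping.mapp (\<lambda>i a. if \<delta> i \<le> n then pr (n - \<delta> i) a else 0)"

lemma lookup_prF: "lookup (prF \<delta> n f) i =
    (if \<delta> i \<le> n then pr (n - \<delta> i) (lookup f i) else 0)"
  by (auto simp: prF_def lookup_mapp when_def in_keys_iff)

lemma prF_simps:
  "prF \<delta> n (f + g) = prF \<delta> n f + prF \<delta> n g" "prF \<delta> n (f - g) = prF \<delta> n f - prF \<delta> n g"
  "prF \<delta> n 0 = 0" "prF \<delta> m (prF \<delta> n f) = (if m = n then prF \<delta> n f else 0)"
  by (rule poly_mapping_eqI; auto simp: lookup_prF lookup_add lookup_minus pr_add pr_minus pr_pr)+

lemma keys_prF: "keys (prF \<delta> n f) \<subseteq> keys f"
  by (auto simp: in_keys_iff lookup_prF split: if_splits)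

lemma prF_sum: "prF \<delta> n (\<Sum>s\<in>S. f s) = (\<Sum>s\<in>S. prF \<delta> n (f s))"
  by (induction S rule: infinite_finite_induct) (simp_all add: prF_simps)

lemma prF_act_left:
  assumes "a \<in> G d" shows "prF \<delta> n (a \<odot> f) = (if d \<le> n then a \<odot> prF \<delta> (n - d) f else 0)"
proof (rule poly_mapping_eqI)
  fix i
  have "n - \<delta> i - d = n - d - \<delta> i" by simp
  then show "lookup (prF \<delta> n (a \<odot> f)) i =
      lookup (if d \<le> n then a \<odot> prF \<delta> (n - d) f else 0) i"
    by (auto simp: lookup_prF pr_mult_left[OF assms])
qed

lemma prF_act_right:
  assumes "prF \<delta> m f = f" shows "prF \<delta> n (a \<odot> f) = (if m \<le> n then pr (n - m) a else 0) \<odot> f"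
proof (rule poly_mapping_eqI)
  fix i
  have f: "lookup f i = (if \<delta> i \<le> m then pr (m - \<delta> i) (lookup f i) else 0)"
    using lookup_prF[of \<delta> m f i] assms by simp
  show "lookup (prF \<delta> n (a \<odot> f)) i =
      lookup ((if m \<le> n then pr (n - m) a else 0) \<odot> f) i"
  proof (cases "\<delta> i \<le> m")
    case True
    then have "lookup f i \<in> G (m - \<delta> i)" using f pr_in by metis
    with True show ?thesis by (auto simp: lookup_prF pr_mult_right)
  qed (use f in \<open>simp add: lookup_prF\<close>)
qed

lemma prF_decompose:
  "finite {n. prF \<delta> n f \<noteq> 0}" "(\<Sum>n | prF \<delta> n f \<noteq> 0. prF \<delta> n f) = f"
proof -
  let ?S = "\<Union>i\<in>keys f. (\<lambda>n. n + \<delta> i) ` {n. pr n (lookup f i) \<noteq> 0}"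
  have S: "{n. prF \<delta> n f \<noteq> 0} \<subseteq> ?S"
  proof
    fix n assume "n \<in> {n. prF \<delta> n f \<noteq> 0}"
    then obtain i where "lookup (prF \<delta> n f) i \<noteq> 0"
      using poly_mapping_eqI[of "prF \<delta> n f" 0] by auto
    then have "\<delta> i \<le> n" "pr (n - \<delta> i) (lookup f i) \<noteq> 0"
      by (auto simp: lookup_prF split: if_splits)
    moreover from this have "i \<in> keys f" by (auto simp: in_keys_iff)
    ultimately show "n \<in> ?S" by (intro UN_I image_eqI[of _ _ "n - \<delta> i"]) auto
  qed
  have fin: "finite ?S" by (simp add: pr_finite)
  show *: "finite {n. prF \<delta> n f \<noteq> 0}" by (rule finite_subset[OF S fin])
  show "(\<Sum>n | prF \<delta> n f \<noteq> 0. prF \<delta> n f) = f"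
  proof (rule poly_mapping_eqI)
    fix i
    let ?a = "lookup f i"
    let ?T = "{n. prF \<delta> n f \<noteq> 0} \<union> (\<lambda>n. n + \<delta> i) ` {n. pr n ?a \<noteq> 0}"
    have "lookup (\<Sum>n | prF \<delta> n f \<noteq> 0. prF \<delta> n f) i =
        (\<Sum>n | prF \<delta> n f \<noteq> 0. lookup (prF \<delta> n f) i)" by (rule lookup_sum)
    also have "\<dots> = (\<Sum>n\<in>?T. lookup (prF \<delta> n f) i)"
      by (rule sum.mono_neutral_left) (auto simp: * pr_finite)
    also have "\<dots> = (\<Sum>n\<in>(\<lambda>n. n + \<delta> i) ` {n. pr n ?a \<noteq> 0}. lookup (prF \<delta> n f) i)"
    proof (rule sum.mono_neutral_right)
      show "\<forall>n\<in>?T - (\<lambda>n. n + \<delta> i) ` {n. pr n ?a \<noteq> 0}. lookup (prF \<delta> n f) i = 0"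
      proof
        fix n assume n: "n \<in> ?T - (\<lambda>n. n + \<delta> i) ` {n. pr n ?a \<noteq> 0}"
        have "\<delta> i \<le> n \<Longrightarrow> pr (n - \<delta> i) ?a = 0" using n by (auto simp: image_iff)
        then show "lookup (prF \<delta> n f) i = 0" by (simp add: lookup_prF)
      qed
    qed (auto simp: * pr_finite)
    also have "\<dots> = (\<Sum>n | pr n ?a \<noteq> 0. pr n ?a)"
      by (subst sum.reindex) (auto simp: inj_on_def lookup_prF)
    finally show "lookup (\<Sum>n | prF \<delta> n f \<noteq> 0. prF \<delta> n f) i = ?a" by (simp add: pr_sum)
  qed
qed

text \<open>The free graded module with basis elements indexed by \<open>I\<close>, of degrees
  \<open>\<delta>\<close>.\<close>

definition free :: "'i set \<Rightarrow> ('i \<Rightarrow> nat) \<Rightarrow> ('a, 'i \<Rightarrow>\<^sub>0 'a) gmod" where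
  "free I \<delta> = direct_sum I (\<lambda>i. shifted_ring G (\<delta> i))"

lemma carrier_free [simp]: "carrier (free I \<delta>) = {f. keys f \<subseteq> I}"
  by (simp add: free_def direct_sum_def shifted_ring_def)

lemma smult_free [simp]: "smult (free I \<delta>) = (\<odot>)"
proof (intro ext poly_mapping_eqI)
  fix a f i
  show "lookup (smult (free I \<delta>) a f) i = lookup (a \<odot> f) i"
    by (simp add: free_def direct_sum_def shifted_ring_def lookup_mapp when_def in_keys_iff)
qed

text \<open>Homogeneous elements are the fixed points of the projection, also outside \<open>I\<close>, where
  all entries vanish.\<close>

lemma component_free [simp]: "component (free I \<delta>) n = {f. keys f \<subseteq> I \<and> prF \<delta> n f = f}"
proof (intro set_eqI iffI)
  fix f assume f: "f \<in> component (free I \<delta>) n"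
  then have keys: "keys f \<subseteq> I"
    and c: "\<And>i. i \<in> I \<Longrightarrow> lookup f i \<in> (if \<delta> i \<le> n then G (n - \<delta> i) else {0})"
    by (auto simp: free_def direct_sum_def shifted_ring_def)
  have "prF \<delta> n f = f"
  proof (rule poly_mapping_eqI)
    fix i show "lookup (prF \<delta> n f) i = lookup f i"
    proof (cases "i \<in> I")
      case True
      from c[OF this] show ?thesis by (auto simp: lookup_prF pr_same split: if_splits)
    next
      case False
      with keys have "lookup f i = 0" by (auto simp: in_keys_iff)
      then show ?thesis by (simp add: lookup_prF)
    qed
  qed
  with keys show "f \<in> {f. keys f \<subseteq> I \<and> prF \<delta> n f = f}" by simp
next
  fix f assume "f \<in> {f. keys f \<subseteq> I \<and> prF \<delta> n f = f}"
  then have f: "keys f \<subseteq> I" "prF \<delta> n f = f" by auto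
  have "lookup f i \<in> (if \<delta> i \<le> n then G (n - \<delta> i) else {0})" for i
    using lookup_prF[of \<delta> n f i] f(2) pr_in by (metis singleton_iff)
  with f(1) show "f \<in> component (free I \<delta>) n"
    by (simp add: free_def direct_sum_def shifted_ring_def)
qed

lemma keys_act: "keys (a \<odot> f) \<subseteq> keys f"
  by (auto simp: in_keys_iff)

lemma keys_diff_subset: "keys f \<subseteq> I \<Longrightarrow> keys g \<subseteq> I \<Longrightarrow> keys (f - g) \<subseteq> I"
  by (metis (no_types, lifting) Un_least keys_diff order_trans)

lemma graded_module_free: "graded_module G (free (I :: 'i set) \<delta>)"
  unfolding graded_module_def additive_subgroup_def carrier_free smult_free component_free
proof (intro conjI allI ballI)
  fix f :: "'i \<Rightarrow>\<^sub>0 'a" assume f: "f \<in> {f. keys f \<subseteq> I}"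
  show "\<exists>!h :: nat \<Rightarrow>\<^sub>0 'i \<Rightarrow>\<^sub>0 'a. (\<forall>n. lookup h n \<in> {f. keys f \<subseteq> I \<and> prF \<delta> n f = f})
      \<and> f = (\<Sum>n\<in>keys h. lookup h n)"
    by (rule unique_decomposition[where P = "prF \<delta>"])
      (use f keys_prF[of \<delta> _ f] prF_decompose[of \<delta> f] in \<open>auto simp: prF_simps\<close>, metis prF_simps(4))
next
  fix a and f :: "'i \<Rightarrow>\<^sub>0 'a" assume f: "f \<in> {f. keys f \<subseteq> I}"
  then show "a \<odot> f \<in> {f. keys f \<subseteq> I}" using keys_act[of a f] by auto
next
  fix d n a and f :: "'i \<Rightarrow>\<^sub>0 'a" assume a: "a \<in> G d" and f: "f \<in> {f. keys f \<subseteq> I \<and> prF \<delta> n f = f}"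
  then show "a \<odot> f \<in> {f. keys f \<subseteq> I \<and> prF \<delta> (d + n) f = f}"
    using keys_act[of a f] prF_act_left[OF a, of \<delta> "d + n" f] by auto
qed (auto simp: act_simps act_act prF_simps dest: keys_diff_subset)

text \<open>The basis elements of a free module.\<close>

definition unit :: "'i \<Rightarrow> 'i \<Rightarrow>\<^sub>0 'a" where "unit i = Poly_Mapping.single i 1"

lemma lookup_unit: "lookup (unit i) j = (if i = j then 1 else 0)"
  by (simp add: unit_def lookup_single when_def)

lemma unit_inject: "unit i = unit j \<longleftrightarrow> i = j"
  by (metis lookup_unit one_neq_zero)

lemma keys_unit: "keys (unit i) = {i}"
  by (simp add: unit_def one_neq_zero)

lemma act_unit: "a \<odot> unit i = Poly_Mapping.single i a"
  by (rule poly_mapping_eqI) (simp add: lookup_unit lookup_single when_def)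

lemma sum_units: "pm_sum (\<lambda>i a. a \<odot> unit i) f = f"
  by (simp add: act_unit pm_sum_singles)

lemma lin_comb_free: "lin_comb (free I \<delta>) h = pm_sum (\<lambda>b a. a \<odot> b) h"
  by (simp add: lin_comb_def pm_sum_def)

lemma homogeneous_basis_free: "homogeneous_basis (free I \<delta>) (unit ` I)"
  unfolding homogeneous_basis_def
proof (intro conjI ballI)
  show "unit ` I \<subseteq> carrier (free I \<delta>)" by (auto simp: keys_unit)
  show "\<exists>n. b \<in> component (free I \<delta>) n" if b: "b \<in> unit ` I" for b
  proof -
    from b obtain i where i: "b = unit i" "i \<in> I" by auto
    have "pr 0 1 = 1" using pr_same[of 1 0] G_0 \<kappa>_1 by (metis rangeI)
    then have "prF \<delta> (\<delta> i) b = b"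
      by (intro poly_mapping_eqI) (auto simp: lookup_prF i lookup_unit)
    with i show ?thesis by (auto simp: keys_unit)
  qed
  fix f assume "f \<in> carrier (free I \<delta>)"
  then have f: "keys f \<subseteq> I" by simp
  have sum: "pm_sum (\<lambda>b a. a \<odot> b) (h + h') = pm_sum (\<lambda>b a. a \<odot> b) h + pm_sum (\<lambda>b a. a \<odot> b) h'"
    for h h' :: "('b \<Rightarrow>\<^sub>0 'a) \<Rightarrow>\<^sub>0 'a"
    by (rule pm_sum_add) (simp_all add: act_simps)
  show "\<exists>!h. keys h \<subseteq> unit ` I \<and> f = lin_comb (free I \<delta>) h"
  proof (rule ex1I)
    let ?h = "\<Sum>i\<in>keys f. Poly_Mapping.single (unit i) (lookup f i)"
    have "keys ?h \<subseteq> (\<Union>i\<in>keys f. keys (Poly_Mapping.single (unit i) (lookup f i)))"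
      by (rule keys_sum)
    also have "\<dots> \<subseteq> unit ` I" using f by (auto split: if_splits)
    finally have "keys ?h \<subseteq> unit ` I" .
    moreover have "lin_comb (free I \<delta>) ?h = f"
      unfolding lin_comb_free
      using sum_units[of f] by (subst pm_sum_sum) (simp_all add: act_simps pm_sum_single pm_sum_def[of _ f])
    ultimately show "keys ?h \<subseteq> unit ` I \<and> f = lin_comb (free I \<delta>) ?h" by simp
    have uniq: "lookup h b = (if b \<in> unit ` I then lookup f (the_inv unit b) else 0)"
      if h: "keys h \<subseteq> unit ` I \<and> f = lin_comb (free I \<delta>) h" for h b
    proof (cases "b \<in> unit ` I")
      case True
      then obtain i where i: "b = unit i" "i \<in> I" by auto
      have "lookup f i =
          (\<Sum>c\<in>keys h. lookup h c * lookup c i)"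
        using h by (simp add: lin_comb_free pm_sum_def lookup_sum)
      also have "\<dots> = (\<Sum>c\<in>keys h. if c = b then lookup h b else 0)"
        using h by (intro sum.cong refl) (auto simp: i lookup_unit unit_inject subset_iff image_iff)
      also have "\<dots> = lookup h b" by (simp add: in_keys_iff)
      finally show ?thesis
        using True i by (simp add: the_inv_f_f inj_def unit_inject)
    qed (use h in \<open>auto simp: in_keys_iff\<close>)
    fix h assume h: "keys h \<subseteq> unit ` I \<and> f = lin_comb (free I \<delta>) h"
    show "h = ?h"
    proof (rule poly_mapping_eqI)
      fix b
      show "lookup h b = lookup ?h b"
        using uniq[OF h, of b] uniq[of ?h b] \<open>keys ?h \<subseteq> unit ` I\<close> \<open>lin_comb (free I \<delta>) ?h = f\<close>
        by simp
    qed
  qed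
qed

text \<open>The augmentation ideal is two-sided, so the radical can be computed in the standard basis.\<close>

lemma positive_in_Rad:
  assumes B: "homogeneous_basis (free I \<delta>) B"
    and x: "keys x \<subseteq> I" "\<And>i. pr 0 (lookup x i) = 0"
  shows "x \<in> Rad G (free I \<delta>) B"
proof -
  have "\<exists>h. keys h \<subseteq> B \<and> unit i = pm_sum (\<lambda>b a. a \<odot> b) h" if "i \<in> I" for i
  proof -
    have "unit i \<in> carrier (free I \<delta>)" using that by (simp add: keys_unit)
    with B show ?thesis unfolding homogeneous_basis_def lin_comb_free by blast
  qed
  then obtain h where h: "\<And>i. i \<in> I \<Longrightarrow> keys (h i) \<subseteq> B"
    "\<And>i. i \<in> I \<Longrightarrow> pm_sum (\<lambda>b a. a \<odot> b) (h i) = unit i" by metis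
  define H where "H = (\<Sum>i\<in>keys x. lookup x i \<odot> h i)"
  have act: "pm_sum (\<lambda>b a. a \<odot> b) (c \<odot> k) = c \<odot> pm_sum (\<lambda>b a. a \<odot> b) k"
    for c and k :: "('b \<Rightarrow>\<^sub>0 'a) \<Rightarrow>\<^sub>0 'a"
    by (subst pm_sum_superset[of "keys k"])
      (auto simp: keys_act act_simps act_act pm_sum_def act_sum)
  have "keys H \<subseteq> (\<Union>i\<in>keys x. keys (lookup x i \<odot> h i))"
    unfolding H_def by (rule keys_sum)
  also have "\<dots> \<subseteq> B" by (intro UN_least order_trans[OF keys_act] h(1)) (use x(1) in auto)
  finally have "keys H \<subseteq> B" .
  moreover have "lookup H b \<in> positive_part G" for b
    unfolding positive_part_iff H_def lookup_sum pr_of_sum by (simp add: pr_0_mult x(2))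
  moreover have "pm_sum (\<lambda>b a. a \<odot> b) H = x"
  proof -
    have "pm_sum (\<lambda>b a. a \<odot> b) H = (\<Sum>i\<in>keys x. lookup x i \<odot> unit i)"
      unfolding H_def using x(1) h(2)
      by (subst pm_sum_sum) (auto simp: act_simps act intro!: sum.cong)
    then show ?thesis using sum_units[of x] by (simp add: pm_sum_def)
  qed
  ultimately show ?thesis unfolding Rad_def lin_comb_free by blast
qed

end

context graded_algebra begin

section \<open>Minimal generators and minimal resolutions\<close>

text \<open>The linear map that sends the basis element \<open>j\<close> to \<open>g j\<close>.\<close>

definition lin :: "('j \<Rightarrow> 'i \<Rightarrow>\<^sub>0 'a) \<Rightarrow> ('j \<Rightarrow>\<^sub>0 'a) \<Rightarrow> ('i \<Rightarrow>\<^sub>0 'a)" where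
  "lin g = pm_sum (\<lambda>j a. a \<odot> g j)"

lemma lin_simps:
  "lin g (f + h) = lin g f + lin g h" "lin g (f - h) = lin g f - lin g h" "lin g 0 = 0"
  "lin g (Poly_Mapping.single j a) = a \<odot> g j"
  unfolding lin_def
     apply (rule pm_sum_add; rule act_simps)
    apply (rule pm_sum_minus; rule act_simps)
   apply (rule pm_sum_0)
  apply (rule pm_sum_single; rule act_simps)
  done

lemma lin_unit: "lin g (unit j) = g j"
  by (simp add: unit_def lin_simps act_simps)

lemma lin_act: "lin g (a \<odot> f) = a \<odot> lin g f"
  unfolding lin_def
  by (subst pm_sum_superset[of "keys f"])
    (auto simp: keys_act act_simps act_act pm_sum_def act_sum)

lemma lin_sum: "lin g (\<Sum>s\<in>S. f s) = (\<Sum>s\<in>S. lin g (f s))"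
  by (induction S rule: infinite_finite_induct) (simp_all add: lin_simps)

lemma keys_lin:
  assumes "\<And>j. j \<in> keys f \<Longrightarrow> keys (g j) \<subseteq> I"
  shows "keys (lin g f) \<subseteq> I"
  unfolding lin_def pm_sum_def
  by (rule order_trans[OF keys_sum]) (intro UN_least order_trans[OF keys_act] assms)

lemma prF_lin:
  assumes "\<And>j. j \<in> keys f \<Longrightarrow> prF \<delta> (\<delta>' j) (g j) = g j"
  shows "prF \<delta> n (lin g f) = lin g (prF \<delta>' n f)"
proof -
  have "prF \<delta> n (lin g f) = (\<Sum>j\<in>keys f. prF \<delta> n (lookup f j \<odot> g j))"
    by (simp add: lin_def pm_sum_def prF_sum)
  also have "\<dots> = (\<Sum>j\<in>keys f. lookup (prF \<delta>' n f) j \<odot> g j)"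
    by (intro sum.cong refl) (simp add: prF_act_right[OF assms] lookup_prF)
  also have "\<dots> = lin g (prF \<delta>' n f)"
    unfolding lin_def by (rule pm_sum_superset[symmetric]) (auto simp: keys_prF act_simps)
  finally show ?thesis .
qed

text \<open>A graded submodule of the free module on \<open>I\<close>.\<close>

definition graded_submodule :: "'i set \<Rightarrow> ('i \<Rightarrow> nat) \<Rightarrow> ('i \<Rightarrow>\<^sub>0 'a) set \<Rightarrow> bool" where
  "graded_submodule I \<delta> N \<longleftrightarrow> submodule N \<and> (\<forall>f\<in>N. keys f \<subseteq> I \<and> (\<forall>n. prF \<delta> n f \<in> N))"

text \<open>The part of degree \<open>n\<close> of the product of the augmentation ideal with
  \<open>N\<close>.\<close>

definition decomposables :: "('i \<Rightarrow> nat) \<Rightarrow> ('i \<Rightarrow>\<^sub>0 'a) set \<Rightarrow> nat \<Rightarrow> ('i \<Rightarrow>\<^sub>0 'a) set" where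
  "decomposables \<delta> N n =
     group_closure {a \<odot> y | a y d. 1 \<le> d \<and> d \<le> n \<and> a \<in> G d \<and> y \<in> N \<and> prF \<delta> (n - d) y = y}"

text \<open>The elements \<open>g j\<close> are homogeneous generators of \<open>N\<close> that are linearly
  independent over the field modulo decomposable elements.\<close>

definition minimal_generators ::
  "('i \<Rightarrow> nat) \<Rightarrow> ('i \<Rightarrow>\<^sub>0 'a) set \<Rightarrow> 'j set \<Rightarrow> ('j \<Rightarrow> nat) \<Rightarrow> ('j \<Rightarrow> 'i \<Rightarrow>\<^sub>0 'a) \<Rightarrow> bool" where
  "minimal_generators \<delta> N J \<delta>' g \<longleftrightarrow>
     (\<forall>j\<in>J. g j \<in> N \<and> prF \<delta> (\<delta>' j) (g j) = g j) \<and>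
     (\<forall>f\<in>N. \<exists>h. keys h \<subseteq> J \<and> lin g h = f) \<and>
     (\<forall>n h. keys h \<subseteq> {j\<in>J. \<delta>' j = n} \<and> (\<forall>j. lookup h j \<in> range \<kappa>) \<and>
        lin g h \<in> decomposables \<delta> N n \<longrightarrow> h = 0)"

text \<open>The cover given by minimal generators has its kernel in the radical: the coordinates of degree
  zero of a relation give a linear dependence modulo decomposable elements.\<close>

lemma minimal_kernel:
  assumes min: "minimal_generators \<delta> N J \<delta>' g"
    and h: "keys h \<subseteq> J" "lin g h = 0"
  shows "pr 0 (lookup h j) = 0"
proof (cases "j \<in> J")
  case True
  let ?n = "\<delta>' j"
  have g: "g j \<in> N \<and> prF \<delta> (\<delta>' j) (g j) = g j" if "j \<in> J" for j
    using min that by (simp add: minimal_generators_def)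
  have "lin g (prF \<delta>' ?n h) = prF \<delta> ?n (lin g h)"
    using g h(1) by (intro prF_lin[symmetric]) auto
  then have 0: "lin g (prF \<delta>' ?n h) = 0" by (simp add: h(2) prF_simps)
  \<comment> \<open>the terms with coefficients of degree zero; all other terms are decomposable\<close>
  define h' where "h' = Poly_Mapping.mapp (\<lambda>i a. if \<delta>' i = ?n then a else 0) (prF \<delta>' ?n h)"
  define h'' where "h'' = prF \<delta>' ?n h - h'"
  have h': "lookup h' i = (if \<delta>' i = ?n then pr 0 (lookup h i) else 0)" for i
    by (auto simp: h'_def lookup_mapp when_def in_keys_iff lookup_prF)
  have h'': "lookup h'' i = (if \<delta>' i < ?n then pr (?n - \<delta>' i) (lookup h i) else 0)" for i
    by (auto simp: h''_def lookup_minus lookup_prF h')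
  have "lin g h'' \<in> decomposables \<delta> N ?n"
    unfolding lin_def pm_sum_def decomposables_def
  proof (intro group_closure_sum in_group_closure)
    fix i assume i: "i \<in> keys h''"
    then have lt: "\<delta>' i < ?n" and "lookup h i \<noteq> 0"
      by (auto simp: in_keys_iff h'' split: if_splits)
    then have "i \<in> J" using h(1) by (auto simp: in_keys_iff)
    with g have gi: "g i \<in> N" "prF \<delta> (\<delta>' i) (g i) = g i" by auto
    have "lookup h'' i \<in> G (?n - \<delta>' i)" using pr_in lt by (simp add: h'')
    then show "lookup h'' i \<odot> g i \<in>
        {a \<odot> y | a y d. 1 \<le> d \<and> d \<le> ?n \<and> a \<in> G d \<and> y \<in> N \<and> prF \<delta> (?n - d) y = y}"
      using lt gi
      by (intro CollectI exI[of _ "lookup h'' i"] exI[of _ "g i"] exI[of _ "?n - \<delta>' i"]) auto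
  qed
  moreover have "lin g h' = - lin g h''"
    using 0 by (simp add: h''_def lin_simps)
  ultimately have "lin g h' \<in> decomposables \<delta> N ?n"
    by (simp add: decomposables_def)
  moreover have "keys h' \<subseteq> {j\<in>J. \<delta>' j = ?n}"
  proof
    fix x assume "x \<in> keys h'"
    then have "\<delta>' x = ?n" "lookup h x \<noteq> 0"
      by (auto simp: in_keys_iff h' split: if_splits)
    then show "x \<in> {j\<in>J. \<delta>' j = ?n}" using h(1) by (auto simp: in_keys_iff)
  qed
  moreover have "lookup h' i \<in> range \<kappa>" for i
    using pr_in[of 0 "lookup h i"] G_zero[of 0] by (auto simp: h' G_0)
  ultimately have "h' = 0" using min by (simp add: minimal_generators_def)
  then show ?thesis using h'[of j] by simp
next
  case False
  with h(1) have "j \<notin> keys h" by blast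
  then show ?thesis by (simp add: in_keys_iff)
qed

lemma graded_submodule_kernel:
  assumes "\<And>j. j \<in> J \<Longrightarrow> prF \<delta> (\<delta>' j) (g j) = g j"
  shows "graded_submodule J \<delta>' {h. keys h \<subseteq> J \<and> lin g h = 0}"
  unfolding graded_submodule_def
proof (intro conjI ballI allI)
  show "submodule {h. keys h \<subseteq> J \<and> lin g h = 0}"
  proof
    fix u a assume "u \<in> {h. keys h \<subseteq> J \<and> lin g h = 0}"
    then show "a \<odot> u \<in> {h. keys h \<subseteq> J \<and> lin g h = 0}"
      using keys_act[of a u] by (auto simp: lin_act act_simps)
  qed (simp_all add: lin_simps keys_diff_subset)
  fix h n assume h: "h \<in> {h. keys h \<subseteq> J \<and> lin g h = 0}"
  then show "keys h \<subseteq> J" by simp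
  have "lin g (prF \<delta>' n h) = prF \<delta> n (lin g h)"
    using h assms by (intro prF_lin[symmetric]) auto
  then show "prF \<delta>' n h \<in> {h. keys h \<subseteq> J \<and> lin g h = 0}"
    using h keys_prF[of \<delta>' n h] by (auto simp: prF_simps)
qed

lemma vector_space: "vector_space (\<lambda>r (f :: 'i \<Rightarrow>\<^sub>0 'a). \<kappa> r \<odot> f)"
  by unfold_locales (simp_all add: act_simps act_act \<kappa>_add \<kappa>_mult \<kappa>_1)

text \<open>Independent sets are countable, so that all terms of the resolution can be indexed by natural
  numbers.\<close>

lemma countable_independent:
  fixes B :: "('i::countable \<Rightarrow>\<^sub>0 'a) set"
  assumes "module.independent (\<lambda>r f. \<kappa> r \<odot> f) B"
  shows "countable B"
proof -
  interpret V: vector_space "\<lambda>r (f :: 'i \<Rightarrow>\<^sub>0 'a). \<kappa> r \<odot> f" by (rule vector_space)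
  obtain E where E: "countable E" "\<And>a. a \<in> group_closure {\<kappa> r * e | r e. e \<in> E}"
    using countable_dim by blast
  define E' where "E' = (\<lambda>(e, i :: 'i). e \<odot> unit i) ` (E \<times> UNIV)"
  have countable: "countable E'" unfolding E'_def using E(1) by (intro countable_image countable_SIGMA) auto
  have unit: "a \<odot> unit i \<in> V.span E'" for a i
    using E(2)[of a]
  proof (induction rule: group_closure.induct)
    case (base s)
    then consider "s = 0" | r e where "s = \<kappa> r * e" "e \<in> E" by auto
    then show ?case
    proof cases
      case 2
      then have "e \<odot> unit i \<in> E'" unfolding E'_def by force
      then have "\<kappa> r \<odot> e \<odot> unit i \<in> V.span E'" by (intro V.span_scale V.span_base)
      with 2 show ?thesis by (simp add: act_act)
    qed (simp add: act_simps V.span_zero)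
  qed (simp add: act_simps V.span_diff)
  have span: "f \<in> V.span E'" for f
  proof -
    have "pm_sum (\<lambda>i a. a \<odot> unit i) f \<in> V.span E'"
      unfolding pm_sum_def by (intro V.span_sum unit)
    then show ?thesis by (simp add: sum_units)
  qed
  \<comment> \<open>every finite subset of the countable spanning set has only finitely many elements of \<open>B\<close> in its span\<close>
  have "B \<subseteq> (\<Union>S\<in>{S. finite S \<and> S \<subseteq> E'}. B \<inter> V.span S)"
  proof
    fix b assume "b \<in> B"
    from span[of b] obtain S r where "finite S" "S \<subseteq> E'" "b = (\<Sum>a\<in>S. \<kappa> (r a) \<odot> a)"
      unfolding V.span_explicit by blast
    have "b \<in> V.span S"
      unfolding \<open>b = _\<close> by (rule V.span_sum, rule V.span_scale, rule V.span_base)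
    with \<open>b \<in> B\<close> \<open>finite S\<close> \<open>S \<subseteq> E'\<close> show "b \<in> (\<Union>S\<in>{S. finite S \<and> S \<subseteq> E'}. B \<inter> V.span S)" by auto
  qed
  moreover have "countable (\<Union>S\<in>{S. finite S \<and> S \<subseteq> E'}. B \<inter> V.span S)"
  proof (intro countable_UN)
    show "countable {S. finite S \<and> S \<subseteq> E'}" using countable by (rule countable_Collect_finite_subset)
    fix S assume "S \<in> {S. finite S \<and> S \<subseteq> E'}"
    then have "finite S" by simp
    moreover have "V.independent (B \<inter> V.span S)"
      using assms V.independent_mono by blast
    ultimately have "finite (B \<inter> V.span S)" using V.independent_span_bound by blast
    then show "countable (B \<inter> V.span S)" by (rule countable_finite)
  qed
  ultimately show ?thesis by (rule countable_subset)
qed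

text \<open>In every degree a basis of the decomposable elements is extended to a basis of the component; the
  additional elements are the generators. That they generate is proved by induction on the degree.\<close>

lemma exists_minimal_generators:
  fixes N :: "('i::countable \<Rightarrow>\<^sub>0 'a) set"
  assumes N: "graded_submodule I \<delta> N"
  shows "\<exists>(J :: nat set) \<delta>' g. minimal_generators \<delta> N J \<delta>' g"
proof -
  interpret V: vector_space "\<lambda>r (f :: 'i \<Rightarrow>\<^sub>0 'a). \<kappa> r \<odot> f" by (rule vector_space)
  interpret N: submodule N using N by (simp add: graded_submodule_def)
  have prN: "prF \<delta> n f \<in> N" if "f \<in> N" for f n using N that by (simp add: graded_submodule_def)
  let ?W = "decomposables \<delta> N"
  define Nn where "Nn n = {f \<in> N. prF \<delta> n f = f}" for n
  have "\<exists>C B. C \<subseteq> ?W n \<and> ?W n \<subseteq> V.span C \<and> C \<subseteq> B \<and> B \<subseteq> Nn n \<and> V.independent B \<and> Nn n \<subseteq> V.span B" for n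
  proof -
    have sub: "?W n \<subseteq> Nn n"
    proof
      fix w assume "w \<in> ?W n"
      then show "w \<in> Nn n"
        unfolding decomposables_def
      proof (induction rule: group_closure.induct)
        case (base w)
        then show ?case
          by (auto simp: Nn_def N.zero_in prF_simps N.act_in prF_act_left)
      next
        case (diff s t)
        then show ?case by (auto simp: Nn_def N.diff_in prF_simps)
      qed
    qed
    obtain C where C: "C \<subseteq> ?W n" "V.independent C" "?W n \<subseteq> V.span C"
      using V.maximal_independent_subset by blast
    obtain B where "C \<subseteq> B" "B \<subseteq> Nn n" "V.independent B" "Nn n \<subseteq> V.span B"
      using V.maximal_independent_subset_extend[of C "Nn n"] C sub by blast
    with C show ?thesis by blast
  qed
  then obtain C B where CB: "\<And>n. C n \<subseteq> ?W n" "\<And>n. ?W n \<subseteq> V.span (C n)" "\<And>n. C n \<subseteq> B n"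
    "\<And>n. B n \<subseteq> Nn n" "\<And>n. V.independent (B n)" "\<And>n. Nn n \<subseteq> V.span (B n)" by metis
  \<comment> \<open>the generators of degree \<open>n\<close>; the pair of \<open>n\<close> and a number of the element is encoded as an index\<close>
  define D where "D n = B n - C n" for n
  have countD: "countable (D n)" for n
    using countable_independent[OF CB(5)[of n]] by (simp add: D_def)
  define \<delta>' :: "nat \<Rightarrow> nat" where "\<delta>' j = fst (prod_decode j)" for j
  define J where "J = {j. snd (prod_decode j) \<in> to_nat_on (D (\<delta>' j)) ` D (\<delta>' j)}"
  define g where "g j = from_nat_into (D (\<delta>' j)) (snd (prod_decode j))" for j
  have gD: "g j \<in> D (\<delta>' j)" "to_nat_on (D (\<delta>' j)) (g j) = snd (prod_decode j)" if "j \<in> J" for j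
    using that countD by (auto simp: J_def g_def)
  have inj: "i = j" if "i \<in> J" "j \<in> J" "\<delta>' i = \<delta>' j" "g i = g j" for i j
  proof -
    have "prod_decode i = prod_decode j"
      using gD(2)[OF that(1)] gD(2)[OF that(2)] that(3,4) by (auto simp: \<delta>'_def prod_eq_iff)
    then show ?thesis by (metis prod_decode_inverse)
  qed
  have surj: "\<exists>j\<in>J. \<delta>' j = n \<and> g j = b" if "b \<in> D n" for n b
    using that countD[of n]
    by (intro bexI[of _ "prod_encode (n, to_nat_on (D n) b)"]) (auto simp: J_def g_def \<delta>'_def)
  define Im where "Im = {lin g h | h. keys h \<subseteq> J}"
  have Im_diff: "u - v \<in> Im" if "u \<in> Im" "v \<in> Im" for u v
  proof -
    from that obtain h h' where "keys h \<subseteq> J" "keys h' \<subseteq> J" "u = lin g h" "v = lin g h'"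
      by (auto simp: Im_def)
    then show ?thesis unfolding Im_def
      by (intro CollectI exI[of _ "h - h'"]) (simp add: lin_simps keys_diff_subset)
  qed
  have Im_act: "a \<odot> u \<in> Im" if "u \<in> Im" for a u
  proof -
    from that obtain h where "keys h \<subseteq> J" "u = lin g h" by (auto simp: Im_def)
    then show ?thesis unfolding Im_def
      using keys_act[of a h] by (intro CollectI exI[of _ "a \<odot> h"]) (simp add: lin_act)
  qed
  have Im_0: "0 \<in> Im" unfolding Im_def by (intro CollectI exI[of _ 0]) (simp add: lin_simps)
  have Im_add: "u + v \<in> Im" if "u \<in> Im" "v \<in> Im" for u v
    using Im_diff[OF that(1) Im_diff[OF Im_0 that(2)]] by simp
  have Im_sub: "V.subspace Im" by (rule V.subspaceI) (auto intro: Im_0 Im_add Im_act)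
  have NIm: "Nn n \<subseteq> Im" for n
  proof (induction n rule: less_induct)
    case (less n)
    have W: "w \<in> Im" if "w \<in> ?W n" for w
      using that unfolding decomposables_def
    proof (induction rule: group_closure.induct)
      case (base w)
      then consider "w = 0" | a y d where "w = a \<odot> y" "1 \<le> d" "d \<le> n" "y \<in> Nn (n - d)"
        by (auto simp: Nn_def)
      then show ?case
      proof cases
        case 2
        then show ?thesis using less[of "n - d"] by (auto intro: Im_act)
      qed (simp add: Im_0)
    qed (rule Im_diff)
    have "B n \<subseteq> Im"
    proof
      fix b assume "b \<in> B n"
      then show "b \<in> Im"
      proof (cases "b \<in> D n")
        case True
        then obtain j where "j \<in> J" "g j = b" using surj by blast
        then show ?thesis unfolding Im_def
          by (intro CollectI exI[of _ "unit j"]) (simp add: lin_unit keys_unit)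
      qed (use CB(1) W in \<open>auto simp: D_def\<close>)
    qed
    then have "V.span (B n) \<subseteq> Im" by (intro V.span_minimal Im_sub)
    then show ?case using CB(6) by blast
  qed
  have "minimal_generators \<delta> N J \<delta>' g"
    unfolding minimal_generators_def
  proof (intro conjI ballI allI impI)
    fix j assume "j \<in> J"
    then have "g j \<in> Nn (\<delta>' j)" using gD CB(4) by (auto simp: D_def)
    then show "g j \<in> N" "prF \<delta> (\<delta>' j) (g j) = g j" by (auto simp: Nn_def)
  next
    fix f assume f: "f \<in> N"
    have "(\<Sum>n | prF \<delta> n f \<noteq> 0. prF \<delta> n f) \<in> Im"
    proof (intro V.subspace_sum Im_sub)
      fix n
      have "prF \<delta> n f \<in> Nn n" using prN[OF f] by (simp add: Nn_def prF_simps)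
      then show "prF \<delta> n f \<in> Im" using NIm by blast
    qed
    then show "\<exists>h. keys h \<subseteq> J \<and> lin g h = f"
      unfolding prF_decompose(2) Im_def by blast
  next
    fix n h
    assume h: "keys h \<subseteq> {j\<in>J. \<delta>' j = n} \<and> (\<forall>j. lookup h j \<in> range \<kappa>) \<and>
        lin g h \<in> ?W n"
    show "h = 0"
    proof (rule ccontr)
      assume "h \<noteq> 0"
      then obtain j where j: "j \<in> keys h" 
        using poly_mapping_eqI[of h 0] by (auto simp: in_keys_iff)
      obtain r where r: "lookup h j = \<kappa> r" using h by blast
      with j have "r \<noteq> 0" by (auto simp: in_keys_iff \<kappa>_0)
      have jJ: "j \<in> J" "\<delta>' j = n" using h j by auto
      let ?S = "V.span (B n - {g j})"
      have "C n \<subseteq> B n - {g j}" using gD(1)[OF jJ(1)] CB(3) jJ by (auto simp: D_def)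
      then have "lin g h \<in> ?S" using h CB(2) V.span_mono by blast
      moreover have "(\<Sum>i\<in>keys h - {j}. lookup h i \<odot> g i) \<in> ?S"
      proof (rule V.span_sum)
        fix i assume i: "i \<in> keys h - {j}"
        then have "i \<in> J" "\<delta>' i = n" using h by auto
        then have "g i \<in> B n" "g i \<noteq> g j" using gD(1)[of i] inj[of i j] jJ i by (auto simp: D_def)
        moreover obtain s where "lookup h i = \<kappa> s" using h by blast
        ultimately show "lookup h i \<odot> g i \<in> ?S"
          by (simp add: V.span_scale V.span_base)
      qed
      moreover have "lin g h = \<kappa> r \<odot> g j + (\<Sum>i\<in>keys h - {j}. lookup h i \<odot> g i)"
        unfolding lin_def pm_sum_def using j r by (simp add: sum.remove[of _ j])
      ultimately have "\<kappa> r \<odot> g j \<in> ?S" by (simp add: V.span_add_eq2)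
      then have "\<kappa> (inverse r) \<odot> \<kappa> r \<odot> g j \<in> ?S" by (rule V.span_scale)
      then have "g j \<in> ?S" using \<open>r \<noteq> 0\<close> by (simp add: act_act \<kappa>_1 act_simps flip: \<kappa>_mult)
      moreover have "g j \<in> B n" using gD(1)[OF jJ(1)] jJ by (simp add: D_def)
      ultimately show False using CB(5) V.dependent_def by blast
    qed
  qed
  then show ?thesis by blast
qed

text \<open>The first three terms are prescribed, all others are chosen one after the other.\<close>

theorem exists_minimal_resolution:
  fixes M :: "('a, 'm::ab_group_add) gmod" and I0 I1 I2 :: "nat set" and g0 g1 :: "nat \<Rightarrow> nat \<Rightarrow>\<^sub>0 'a"
  assumes M: "graded_module G M" and hom: "graded_hom (free I0 \<delta>0) M \<epsilon>"
    and surj: "\<epsilon> ` carrier (free I0 \<delta>0) = carrier M"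
    and sub0: "graded_submodule I0 \<delta>0 {f. keys f \<subseteq> I0 \<and> \<epsilon> f = 0}"
    and pos0: "\<And>f i. keys f \<subseteq> I0 \<Longrightarrow> \<epsilon> f = 0 \<Longrightarrow> pr 0 (lookup f i) = 0"
    and gen0: "minimal_generators \<delta>0 {f. keys f \<subseteq> I0 \<and> \<epsilon> f = 0} I1 \<delta>1 g0"
    and gen1: "minimal_generators \<delta>1 {f. keys f \<subseteq> I1 \<and> lin g0 f = 0} I2 \<delta>2 g1"
  shows "\<exists>F d. minimal_graded_projective_resolution G F d \<epsilon> M \<and>
    F 0 = free I0 \<delta>0 \<and> F 1 = free I1 \<delta>1 \<and> F 2 = free I2 \<delta>2"
proof -
  let ?K = "\<lambda>J g. {h. keys h \<subseteq> J \<and> lin g h = 0}"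
  define N0 where "N0 = {f. keys f \<subseteq> I0 \<and> \<epsilon> f = 0}"
  \<comment> \<open>a state is an index set, its degrees, and the next kernel\<close>
  define P where "P n s \<longleftrightarrow> (case s of (I, \<delta>, N) \<Rightarrow>
      graded_submodule I \<delta> N \<and> (\<forall>f\<in>N. \<forall>i. pr 0 (lookup f i) = 0)) \<and>
      (n = 0 \<longrightarrow> s = (I0, \<delta>0, N0)) \<and> (n = 1 \<longrightarrow> s = (I1, \<delta>1, ?K I1 g0)) \<and>
      (n = 2 \<longrightarrow> s = (I2, \<delta>2, ?K I2 g1))"
    for n :: nat and s :: "nat set \<times> (nat \<Rightarrow> nat) \<times> (nat \<Rightarrow>\<^sub>0 'a) set"
  define Q where "Q s t \<longleftrightarrow> (case s of (I, \<delta>, N) \<Rightarrow> case t of (J, \<delta>', N') \<Rightarrow>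
      \<exists>g. minimal_generators \<delta> N J \<delta>' g \<and> N' = ?K J g)"
    for s t :: "nat set \<times> (nat \<Rightarrow> nat) \<times> (nat \<Rightarrow>\<^sub>0 'a) set"
  have step: "graded_submodule J \<delta>' (?K J g) \<and> (\<forall>f\<in>?K J g. \<forall>i. pr 0 (lookup f i) = 0)"
    if "minimal_generators \<delta> N J \<delta>' g" for \<delta> J \<delta>' and g :: "nat \<Rightarrow> nat \<Rightarrow>\<^sub>0 'a" and N
    using minimal_kernel[OF that] graded_submodule_kernel[of J \<delta> \<delta>' g] that
    by (auto simp: minimal_generators_def)
  have "\<exists>s. \<forall>n. P n (s n) \<and> Q (s n) (s (Suc n))"
  proof (rule dependent_nat_choice)
    show "\<exists>s. P 0 s" using sub0 pos0 by (auto simp: P_def N0_def)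
    fix s n assume s: "P n s"
    obtain I \<delta> N where eq: "s = (I, \<delta>, N)" by (cases s)
    consider "n = 0" | "n = 1" | "n \<ge> 2" by linarith
    then show "\<exists>t. P (Suc n) t \<and> Q s t"
    proof cases
      case 1
      then have "\<delta> = \<delta>0" "N = N0" using s by (auto simp: P_def eq)
      then have "P (Suc n) (I1, \<delta>1, ?K I1 g0) \<and> Q s (I1, \<delta>1, ?K I1 g0)"
        using 1 gen0 step[OF gen0] by (auto simp: P_def Q_def eq N0_def)
      then show ?thesis by blast
    next
      case 2
      then have "\<delta> = \<delta>1" "N = ?K I1 g0" using s by (auto simp: P_def eq)
      then have "P (Suc n) (I2, \<delta>2, ?K I2 g1) \<and> Q s (I2, \<delta>2, ?K I2 g1)"
        using 2 gen1 step[OF gen1] by (auto simp: P_def Q_def eq)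
      then show ?thesis by blast
    next
      case 3
      have "graded_submodule I \<delta> N" using s by (simp add: P_def eq)
      then obtain J :: "nat set" and \<delta>' g where g: "minimal_generators \<delta> N J \<delta>' g"
        using exists_minimal_generators by blast
      then have "P (Suc n) (J, \<delta>', ?K J g) \<and> Q s (J, \<delta>', ?K J g)"
        using 3 step[OF g] by (auto simp: P_def Q_def eq)
      then show ?thesis by blast
    qed
  qed
  then obtain s where s: "\<And>n. P n (s n)" "\<And>n. Q (s n) (s (Suc n))" by blast
  define I where "I n = fst (s n)" for n
  define \<delta> where "\<delta> n = fst (snd (s n))" for n
  define N where "N n = snd (snd (s n))" for n
  have sn: "s n = (I n, \<delta> n, N n)" for n by (simp add: I_def \<delta>_def N_def)
  have "\<forall>n. \<exists>g. minimal_generators (\<delta> n) (N n) (I (Suc n)) (\<delta> (Suc n)) g \<and> N (Suc n) = ?K (I (Suc n)) g"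
    using s(2) by (simp add: Q_def sn)
  from choice[OF this] obtain g where
    g: "\<And>n. minimal_generators (\<delta> n) (N n) (I (Suc n)) (\<delta> (Suc n)) (g n)"
      "\<And>n. N (Suc n) = ?K (I (Suc n)) (g n)" by blast
  have N: "graded_submodule (I n) (\<delta> n) (N n)" "\<And>f i. f \<in> N n \<Longrightarrow> pr 0 (lookup f i) = 0" for n
    using s(1)[of n] by (auto simp: P_def sn)
  have gN: "g n j \<in> N n" "prF (\<delta> n) (\<delta> (Suc n) j) (g n j) = g n j" "keys (g n j) \<subseteq> I n"
    if "j \<in> I (Suc n)" for n j
    using g(1)[of n] N(1)[of n] that by (auto simp: minimal_generators_def graded_submodule_def)
  have image: "lin (g n) ` {f. keys f \<subseteq> I (Suc n)} = N n" for n
  proof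
    show "N n \<subseteq> lin (g n) ` {f. keys f \<subseteq> I (Suc n)}"
    proof
      fix f assume "f \<in> N n"
      moreover have "\<forall>f\<in>N n. \<exists>h. keys h \<subseteq> I (Suc n) \<and> lin (g n) h = f"
        using g(1)[of n] unfolding minimal_generators_def by (elim conjE)
      ultimately obtain h where "keys h \<subseteq> I (Suc n)" "lin (g n) h = f" by blast
      then show "f \<in> lin (g n) ` {f. keys f \<subseteq> I (Suc n)}"
        by (intro image_eqI[of _ _ h]) simp_all
    qed
    interpret N: submodule "N n" using N(1) by (simp add: graded_submodule_def)
    have "(\<Sum>i\<in>S. lookup h i \<odot> g n i) \<in> N n" if "S \<subseteq> I (Suc n)" for S h
      using that by (induction S rule: infinite_finite_induct) (simp_all add: N.zero_in N.add_in N.act_in gN)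
    then show "lin (g n) ` {f. keys f \<subseteq> I (Suc n)} \<subseteq> N n"
      by (auto simp: lin_def pm_sum_def)
  qed
  define F where "F n = free (I n) (\<delta> n)" for n
  have first: "I 0 = I0" "\<delta> 0 = \<delta>0" "N 0 = N0" "I 1 = I1" "\<delta> 1 = \<delta>1" "I 2 = I2" "\<delta> 2 = \<delta>2"
    using s(1)[of 0] s(1)[of 1] s(1)[of 2] by (auto simp: P_def I_def \<delta>_def N_def)
  have "minimal_graded_projective_resolution G F (\<lambda>n. lin (g n)) \<epsilon> M"
    unfolding minimal_graded_projective_resolution_def graded_projective_resolution_def
  proof (intro conjI allI impI)
    show "graded_module G M" by (rule M)
    show "graded_module G (F n)" "\<exists>B. homogeneous_basis (F n) B" for n
      unfolding F_def using graded_module_free homogeneous_basis_free by blast+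
    show "graded_hom (F (Suc n)) (F n) (lin (g n))" for n
      unfolding graded_hom_def F_def smult_free carrier_free component_free
    proof (intro conjI ballI allI)
      fix f :: "nat \<Rightarrow>\<^sub>0 'a" assume "f \<in> {f. keys f \<subseteq> I (Suc n)}"
      then show "lin (g n) f \<in> {f. keys f \<subseteq> I n}" using keys_lin[of f "g n" "I n"] gN(3) by auto
    next
      fix m and f :: "nat \<Rightarrow>\<^sub>0 'a" assume f: "f \<in> {f. keys f \<subseteq> I (Suc n) \<and> prF (\<delta> (Suc n)) m f = f}"
      then have "prF (\<delta> n) m (lin (g n) f) = lin (g n) (prF (\<delta> (Suc n)) m f)"
        using gN(2) by (intro prF_lin) auto
      then show "lin (g n) f \<in> {f. keys f \<subseteq> I n \<and> prF (\<delta> n) m f = f}"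
        using f keys_lin[of f "g n" "I n"] gN(3) by auto
    qed (simp_all add: lin_simps lin_act)
    show "graded_hom (F 0) M \<epsilon>" using hom by (simp add: F_def first)
    show "lin (g (Suc n)) ` carrier (F (Suc (Suc n))) = {x \<in> carrier (F (Suc n)). lin (g n) x = 0}" for n
      using image[of "Suc n"] g(2)[of n] by (simp add: F_def)
    show "lin (g 0) ` carrier (F 1) = {x \<in> carrier (F 0). \<epsilon> x = 0}"
      using image[of 0] by (simp add: F_def first N0_def)
    show "\<epsilon> ` carrier (F 0) = carrier M" using surj by (simp add: F_def first)
    show "lin (g n) ` carrier (F (Suc n)) \<subseteq> Rad G (F n) B" if "homogeneous_basis (F n) B" for n B
    proof
      fix f assume "f \<in> lin (g n) ` carrier (F (Suc n))"
      then have "f \<in> N n" using image[of n] by (simp add: F_def)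
      then show "f \<in> Rad G (F n) B"
        using that N(1)[of n] N(2)[of f n] positive_in_Rad[of "I n" "\<delta> n" B f] by (simp add: F_def graded_submodule_def)
    qed
  qed
  then show ?thesis using first by (intro exI[of _ F]) (auto simp: F_def)
qed

end

section \<open>Isomorphisms of graded free modules\<close>

lemma graded_isoI:
  assumes "graded_hom M N \<phi>"
    and "\<And>y. y \<in> carrier N \<Longrightarrow> \<psi> y \<in> carrier M" "\<And>x. x \<in> carrier M \<Longrightarrow> \<psi> (\<phi> x) = x"
    and "\<And>y. y \<in> carrier N \<Longrightarrow> \<phi> (\<psi> y) = y"
    and "\<And>n y. y \<in> component N n \<Longrightarrow> \<psi> y \<in> component M n" "\<And>n. component N n \<subseteq> carrier N"
  shows "M \<cong>\<^sub>g N"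
  unfolding graded_iso_def
proof (intro exI[of _ \<phi>] conjI allI)
  show "graded_hom M N \<phi>" by fact
  then have hom: "\<And>x. x \<in> carrier M \<Longrightarrow> \<phi> x \<in> carrier N" "\<And>n x. x \<in> component M n \<Longrightarrow> \<phi> x \<in> component N n"
    by (simp_all add: graded_hom_def)
  show "bij_betw \<phi> (carrier M) (carrier N)"
    by (rule bij_betw_byWitness[where f' = \<psi>]) (use assms hom in auto)
  fix n
  show "\<phi> ` component M n = component N n"
  proof
    show "component N n \<subseteq> \<phi> ` component M n"
    proof
      fix y assume y: "y \<in> component N n"
      then have "y \<in> carrier N" using assms(6) by blast
      then have "y = \<phi> (\<psi> y)" by (simp add: assms(4))
      then show "y \<in> \<phi> ` component M n" using assms(5)[OF y] by blast
    qed
  qed (use hom in auto)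
qed

context graded_algebra begin

lemma free_component_iff:
  "f \<in> component (free I \<delta>) n \<longleftrightarrow> keys f \<subseteq> I \<and>
     (\<forall>i\<in>I. lookup f i \<in> (if \<delta> i \<le> n then G (n - \<delta> i) else {0}))"
  by (simp add: free_def direct_sum_def shifted_ring_def del: component_free)

lemma free_single_iso: "free {i} \<delta> \<cong>\<^sub>g shifted_ring G (\<delta> i)"
proof (rule graded_isoI[where \<phi> = "\<lambda>f. lookup f i" and \<psi> = "Poly_Mapping.single i"])
  show "graded_hom (free {i} \<delta>) (shifted_ring G (\<delta> i)) (\<lambda>f. lookup f i)"
    unfolding graded_hom_def
    by (auto simp: shifted_ring_def lookup_add free_component_iff split: if_splits simp del: component_free)
  show "Poly_Mapping.single i (lookup f i) = f" if "f \<in> carrier (free {i} \<delta>)" for f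
    using that by (intro poly_mapping_eqI) (auto simp: lookup_single when_def in_keys_iff)
  show "Poly_Mapping.single i y \<in> component (free {i} \<delta>) n" if "y \<in> component (shifted_ring G (\<delta> i)) n" for n y
    using that unfolding free_component_iff by (simp add: shifted_ring_def)
qed (auto simp: shifted_ring_def)

text \<open>The index set \<open>J\<close> is identified with pairs of a summand and a position in the
  power.\<close>

lemma free_powers_iso:
  assumes h: "bij_betw h J (I \<times> {..<n})" and s: "\<And>j. j \<in> J \<Longrightarrow> \<delta> j = s (fst (h j))"
  shows "free J \<delta> \<cong>\<^sub>g direct_sum I (\<lambda>i. direct_power (shifted_ring G (s i)) n)" (is "_ \<cong>\<^sub>g ?D")
proof -
  define h' where "h' = inv_into J h"
  have h': "h' p \<in> J" "h (h' p) = p" if "p \<in> I \<times> {..<n}" for p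
    using h that unfolding h'_def bij_betw_def by (auto intro: inv_into_into f_inv_into_f)
  have hh: "h' (h j) = j" "h j \<in> I \<times> {..<n}" if "j \<in> J" for j
    using h that unfolding h'_def bij_betw_def by auto
  have carrier: "carrier ?D = {F. keys F \<subseteq> I \<and> (\<forall>i\<in>I. keys (lookup F i) \<subseteq> {..<n})}"
    by (simp add: direct_sum_def direct_power_def shifted_ring_def)
  have component: "component ?D m = {F. keys F \<subseteq> I \<and> (\<forall>i\<in>I. keys (lookup F i) \<subseteq> {..<n} \<and>
      (\<forall>t\<in>{..<n}. lookup (lookup F i) t \<in> (if s i \<le> m then G (m - s i) else {0})))}" for m
    by (simp add: direct_sum_def direct_power_def shifted_ring_def)
  have smult: "lookup (lookup (smult ?D a F) i) t =
      a * lookup (lookup F i) t" for a F i t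
    by (auto simp: direct_sum_def direct_power_def shifted_ring_def lookup_mapp when_def in_keys_iff)
  define inner where "inner f i = Abs_poly_mapping (\<lambda>t. if (i, t) \<in> I \<times> {..<n} then lookup f (h' (i, t)) else 0)"
    for f :: "'b \<Rightarrow>\<^sub>0 'a" and i
  have inner: "lookup (inner f i) t = (if (i, t) \<in> I \<times> {..<n} then lookup f (h' (i, t)) else 0)" for f i t
    unfolding inner_def
    by (subst lookup_Abs_poly_mapping) (auto intro!: finite_subset[of _ "{..<n}"] split: if_splits)
  define \<phi> where "\<phi> f = Abs_poly_mapping (inner f)" for f
  have \<phi>: "lookup (\<phi> f) = inner f" if "keys f \<subseteq> J" for f
    unfolding \<phi>_def
  proof (rule lookup_Abs_poly_mapping)
    have "{i. inner f i \<noteq> 0} \<subseteq> fst ` h ` keys f"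
    proof
      fix i assume "i \<in> {i. inner f i \<noteq> 0}"
      then obtain t where "lookup (inner f i) t \<noteq> 0"
        using poly_mapping_eqI[of "inner f i" 0] by auto
      then have "(i, t) \<in> I \<times> {..<n}" "h' (i, t) \<in> keys f"
        by (auto simp: inner in_keys_iff split: if_splits)
      then show "i \<in> fst ` h ` keys f"
        using h'(2)[of "(i, t)"] by (metis fst_conv image_eqI)
    qed
    then show "finite {i. inner f i \<noteq> 0}" by (rule finite_subset) simp
  qed
  define \<psi> where "\<psi> F = Abs_poly_mapping (\<lambda>j. if j \<in> J then lookup (lookup F (fst (h j))) (snd (h j)) else 0)"
    for F :: "'c \<Rightarrow>\<^sub>0 nat \<Rightarrow>\<^sub>0 'a"
  have \<psi>: "lookup (\<psi> F) j = (if j \<in> J then lookup (lookup F (fst (h j))) (snd (h j)) else 0)" for F j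
    unfolding \<psi>_def
  proof (subst lookup_Abs_poly_mapping)
    let ?S = "{j. (if j \<in> J then lookup (lookup F (fst (h j))) (snd (h j)) else 0) \<noteq> 0}"
    have "h ` ?S \<subseteq> (SIGMA i:keys F. keys (lookup F i))"
    proof
      fix p assume "p \<in> h ` ?S"
      then obtain j where "p = h j" "lookup (lookup F (fst (h j))) (snd (h j)) \<noteq> 0"
        by (auto split: if_splits)
      then show "p \<in> (SIGMA i:keys F. keys (lookup F i))"
        by (cases "h j") (auto simp: in_keys_iff)
    qed
    then have "finite (h ` ?S)" by (rule finite_subset) auto
    moreover have "inj_on h ?S"
      using h by (rule inj_on_subset[OF bij_betw_imp_inj_on]) (auto split: if_splits)
    ultimately show "finite ?S" by (rule finite_imageD)
  qed simp
  show ?thesis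
  proof (rule graded_isoI[where \<phi> = \<phi> and \<psi> = \<psi>])
    have keys: "keys (\<phi> f) \<subseteq> I \<and> (\<forall>i\<in>I. keys (lookup (\<phi> f) i) \<subseteq> {..<n})"
      if "keys f \<subseteq> J" for f
    proof -
      have "i \<in> I" if "i \<in> keys (\<phi> f)" for i
      proof (rule ccontr)
        assume "i \<notin> I"
        then have "inner f i = 0" by (intro poly_mapping_eqI) (simp add: inner)
        with that show False by (simp add: in_keys_iff \<phi>[OF \<open>keys f \<subseteq> J\<close>])
      qed
      then show ?thesis using that by (auto simp: \<phi> in_keys_iff inner split: if_splits)
    qed
    show "graded_hom (free J \<delta>) ?D \<phi>"
      unfolding graded_hom_def
    proof (intro conjI ballI allI)
      fix f assume "f \<in> carrier (free J \<delta>)"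
      then show "\<phi> f \<in> carrier ?D" using keys by (simp add: carrier)
    next
      fix f g assume "f \<in> carrier (free J \<delta>)" "g \<in> carrier (free J \<delta>)"
      then have fg: "keys f \<subseteq> J" "keys g \<subseteq> J" by simp_all
      then have "keys (f + g) \<subseteq> J" using Poly_Mapping.keys_add[of f g] by auto
      with fg show "\<phi> (f + g) = \<phi> f + \<phi> g"
        by (intro poly_mapping_eqI) (simp add: \<phi> lookup_add inner)
    next
      fix a f assume "f \<in> carrier (free J \<delta>)"
      then have f: "keys f \<subseteq> J" by simp
      then have "keys (a \<odot> f) \<subseteq> J" using keys_act[of a f] by auto
      with f show "\<phi> (smult (free J \<delta>) a f) = smult ?D a (\<phi> f)"
        by (intro poly_mapping_eqI) (simp add: \<phi> smult inner)
    next
      fix m f assume "f \<in> component (free J \<delta>) m"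
      then have f: "keys f \<subseteq> J"
        "\<And>j. j \<in> J \<Longrightarrow> lookup f j \<in> (if \<delta> j \<le> m then G (m - \<delta> j) else {0})"
        unfolding free_component_iff by auto
      have "lookup (lookup (\<phi> f) i) t \<in> (if s i \<le> m then G (m - s i) else {0})"
        if "i \<in> I" "t \<in> {..<n}" for i t
      proof -
        have it: "(i, t) \<in> I \<times> {..<n}" using that by simp
        then have eq: "\<delta> (h' (i, t)) = s i" using s[OF h'(1)] h'(2) by (metis fst_conv)
        show ?thesis using f(2)[OF h'(1)[OF it]] it unfolding eq by (simp add: \<phi>[OF f(1)] inner)
      qed
      with keys[OF f(1)] show "\<phi> f \<in> component ?D m" by (simp add: component)
    qed
    have keys\<psi>: "keys (\<psi> F) \<subseteq> J" for F
      by (auto simp: in_keys_iff \<psi> split: if_splits)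
    then show "\<psi> F \<in> carrier (free J \<delta>)" for F by simp
    show "\<psi> (\<phi> f) = f" if "f \<in> carrier (free J \<delta>)" for f
    proof (rule poly_mapping_eqI)
      fix j
      have f: "keys f \<subseteq> J" using that by simp
      show "lookup (\<psi> (\<phi> f)) j = lookup f j"
      proof (cases "j \<in> J")
        case True
        then show ?thesis using hh[OF True] by (simp add: \<psi> \<phi>[OF f] inner mem_Times_iff)
      next
        case False
        with f have "j \<notin> keys f" by blast
        with False show ?thesis by (simp add: \<psi> in_keys_iff)
      qed
    qed
    show "\<phi> (\<psi> F) = F" if F: "F \<in> carrier ?D" for F
    proof (intro poly_mapping_eqI)
      fix i t
      show "lookup (lookup (\<phi> (\<psi> F)) i) t = lookup (lookup F i) t"
      proof (cases "(i, t) \<in> I \<times> {..<n}")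
        case True
        then show ?thesis using h'[OF True] by (simp add: \<phi>[OF keys\<psi>] inner \<psi>)
      next
        case False
        have "lookup (lookup F i) t = 0"
        proof (cases "i \<in> I")
          case True
          with False F have "t \<notin> keys (lookup F i)" by (auto simp: carrier)
          then show ?thesis by (simp add: in_keys_iff)
        next
          case False
          with F have "i \<notin> keys F" by (auto simp: carrier)
          then show ?thesis by (simp add: in_keys_iff)
        qed
        with False show ?thesis by (simp add: \<phi>[OF keys\<psi>] inner del: mem_Sigma_iff)
      qed
    qed
    show "\<psi> F \<in> component (free J \<delta>) m" if F: "F \<in> component ?D m" for m F
      unfolding free_component_iff
    proof (intro conjI ballI keys\<psi>)
      fix j assume j: "j \<in> J"
      then have "fst (h j) \<in> I" "snd (h j) \<in> {..<n}" using hh(2) by (simp_all add: mem_Times_iff)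
      with F have "lookup (lookup F (fst (h j))) (snd (h j)) \<in>
          (if s (fst (h j)) \<le> m then G (m - s (fst (h j))) else {0})"
        unfolding component by blast
      then show "lookup (\<psi> F) j \<in> (if \<delta> j \<le> m then G (m - \<delta> j) else {0})"
        using j by (simp only: \<psi> s if_True)
    qed
    show "component ?D m \<subseteq> carrier ?D" for m unfolding carrier component by blast
  qed
qed

text \<open>Restriction of a family to the indices in \<open>S\<close>.\<close>

definition restr :: "'i set \<Rightarrow> ('i \<Rightarrow>\<^sub>0 'a) \<Rightarrow> ('i \<Rightarrow>\<^sub>0 'a)" where
  "restr S = Poly_Mapping.mapp (\<lambda>i a. if i \<in> S then a else 0)"

lemma lookup_restr: "lookup (restr S f) i = (if i \<in> S then lookup f i else 0)"
  by (auto simp: restr_def lookup_mapp when_def in_keys_iff)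

lemma restr_simps:
  "restr S (f + g) = restr S f + restr S g" "restr S (a \<odot> f) = a \<odot> restr S f"
  by (rule poly_mapping_eqI; simp add: lookup_restr lookup_add)+

lemma keys_restr: "keys (restr S f) \<subseteq> S"
  by (auto simp: in_keys_iff lookup_restr split: if_splits)

lemma restr_component:
  assumes f: "f \<in> component (free J \<delta>) n" and S: "S \<subseteq> J"
  shows "restr S f \<in> component (free S \<delta>) n"
  unfolding free_component_iff
proof (intro conjI ballI keys_restr)
  fix i assume i: "i \<in> S"
  with S f have "lookup f i \<in> (if \<delta> i \<le> n then G (n - \<delta> i) else {0})"
    unfolding free_component_iff by blast
  then show "lookup (restr S f) i \<in> (if \<delta> i \<le> n then G (n - \<delta> i) else {0})"
    using i by (simp only: lookup_restr if_True)
qed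

lemma free_sum_iso:
  assumes "J1 \<inter> J2 = {}" and M: "free J1 \<delta> \<cong>\<^sub>g M" and N: "free J2 \<delta> \<cong>\<^sub>g N"
  shows "free (J1 \<union> J2) \<delta> \<cong>\<^sub>g binary_sum M N"
proof -
  obtain \<phi> where \<phi>: "graded_hom (free J1 \<delta>) M \<phi>" "bij_betw \<phi> (carrier (free J1 \<delta>)) (carrier M)"
    "\<And>n. \<phi> ` component (free J1 \<delta>) n = component M n" using M by (auto simp: graded_iso_def)
  obtain \<psi> where \<psi>: "graded_hom (free J2 \<delta>) N \<psi>" "bij_betw \<psi> (carrier (free J2 \<delta>)) (carrier N)"
    "\<And>n. \<psi> ` component (free J2 \<delta>) n = component N n" using N by (auto simp: graded_iso_def)
  define \<phi>' where "\<phi>' = inv_into (carrier (free J1 \<delta>)) \<phi>"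
  define \<psi>' where "\<psi>' = inv_into (carrier (free J2 \<delta>)) \<psi>"
  have \<phi>': "\<phi>' u \<in> carrier (free J1 \<delta>)" "\<phi> (\<phi>' u) = u" if "u \<in> carrier M" for u
    using that \<phi>(2) unfolding \<phi>'_def bij_betw_def by (auto intro: inv_into_into f_inv_into_f simp del: carrier_free)
  have \<psi>': "\<psi>' u \<in> carrier (free J2 \<delta>)" "\<psi> (\<psi>' u) = u" if "u \<in> carrier N" for u
    using that \<psi>(2) unfolding \<psi>'_def bij_betw_def by (auto intro: inv_into_into f_inv_into_f simp del: carrier_free)
  have \<phi>'\<phi>: "\<phi>' (\<phi> x) = x" if "x \<in> carrier (free J1 \<delta>)" for x
    using that \<phi>(2) unfolding \<phi>'_def bij_betw_def by (simp add: inv_into_f_f del: carrier_free)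
  have \<psi>'\<psi>: "\<psi>' (\<psi> x) = x" if "x \<in> carrier (free J2 \<delta>)" for x
    using that \<psi>(2) unfolding \<psi>'_def bij_betw_def by (simp add: inv_into_f_f del: carrier_free)
  have sub: "component (free J \<delta>) n \<subseteq> carrier (free J \<delta>)" for J n by auto
  have comp\<phi>: "\<phi>' u \<in> component (free J1 \<delta>) n" if u: "u \<in> component M n" for u n
  proof -
    obtain x where "u = \<phi> x" "x \<in> component (free J1 \<delta>) n" using u unfolding \<phi>(3)[symmetric] by blast
    moreover from this have "x \<in> carrier (free J1 \<delta>)" using sub by blast
    ultimately show ?thesis by (simp only: \<phi>'\<phi>)
  qed
  have comp\<psi>: "\<psi>' u \<in> component (free J2 \<delta>) n" if u: "u \<in> component N n" for u n
  proof -
    obtain x where "u = \<psi> x" "x \<in> component (free J2 \<delta>) n" using u unfolding \<psi>(3)[symmetric] by blast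
    moreover from this have "x \<in> carrier (free J2 \<delta>)" using sub by blast
    ultimately show ?thesis by (simp only: \<psi>'\<psi>)
  qed
  have restr: "restr J1 (f + g) = f" "restr J2 (f + g) = g" if "keys f \<subseteq> J1" "keys g \<subseteq> J2" for f g
  proof -
    have "lookup f i = 0" if "i \<notin> J1" for i using \<open>keys f \<subseteq> J1\<close> that by (auto simp: in_keys_iff)
    moreover have "lookup g i = 0" if "i \<notin> J2" for i using \<open>keys g \<subseteq> J2\<close> that by (auto simp: in_keys_iff)
    moreover have "i \<notin> J1 \<or> i \<notin> J2" for i using assms(1) by blast
    ultimately show "restr J1 (f + g) = f" "restr J2 (f + g) = g"
      by (intro poly_mapping_eqI; simp add: lookup_restr lookup_add; metis)+
  qed
  have inJ: "restr S f \<in> carrier (free S \<delta>)" for S f using keys_restr by simp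
  show ?thesis
  proof (rule graded_isoI[where \<phi> = "\<lambda>f. (\<phi> (restr J1 f), \<psi> (restr J2 f))" and \<psi> = "\<lambda>(u, v). \<phi>' u + \<psi>' v"])
    show "graded_hom (free (J1 \<union> J2) \<delta>) (binary_sum M N) (\<lambda>f. (\<phi> (restr J1 f), \<psi> (restr J2 f)))"
      unfolding graded_hom_def
    proof (intro conjI ballI allI)
      fix n f assume f: "f \<in> component (free (J1 \<union> J2) \<delta>) n"
      then have "restr J1 f \<in> component (free J1 \<delta>) n" "restr J2 f \<in> component (free J2 \<delta>) n"
        by (auto intro: restr_component simp del: component_free)
      then show "(\<phi> (restr J1 f), \<psi> (restr J2 f)) \<in> component (binary_sum M N) n"
        using \<phi>(1) \<psi>(1) by (simp add: graded_hom_def binary_sum_def del: component_free)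
    qed (use \<phi>(1) \<psi>(1) inJ in \<open>simp_all add: graded_hom_def binary_sum_def restr_simps keys_restr\<close>)
    fix y assume "y \<in> carrier (binary_sum M N)"
    then obtain u v where y: "y = (u, v)" "u \<in> carrier M" "v \<in> carrier N" by (auto simp: binary_sum_def)
    then have k: "keys (\<phi>' u) \<subseteq> J1" "keys (\<psi>' v) \<subseteq> J2"
      using \<phi>'(1) \<psi>'(1) by simp_all
    then show "(case y of (u, v) \<Rightarrow> \<phi>' u + \<psi>' v) \<in> carrier (free (J1 \<union> J2) \<delta>)"
      using Poly_Mapping.keys_add[of "\<phi>' u" "\<psi>' v"] by (auto simp: y)
    show "(\<phi> (restr J1 (case y of (u, v) \<Rightarrow> \<phi>' u + \<psi>' v)), \<psi> (restr J2 (case y of (u, v) \<Rightarrow> \<phi>' u + \<psi>' v))) = y"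
      using k y \<phi>'(2) \<psi>'(2) by (simp add: restr)
  next
    fix f assume "f \<in> carrier (free (J1 \<union> J2) \<delta>)"
    then have f: "keys f \<subseteq> J1 \<union> J2" by simp
    have "restr J1 f + restr J2 f = f"
    proof (rule poly_mapping_eqI)
      fix i
      have "i \<notin> J1 \<and> i \<notin> J2 \<Longrightarrow> lookup f i = 0" using f by (auto simp: in_keys_iff)
      moreover have "\<not> (i \<in> J1 \<and> i \<in> J2)" using assms(1) by blast
      ultimately show "lookup (restr J1 f + restr J2 f) i = lookup f i"
        by (auto simp: lookup_add lookup_restr)
    qed
    then show "(case (\<phi> (restr J1 f), \<psi> (restr J2 f)) of (u, v) \<Rightarrow> \<phi>' u + \<psi>' v) = f"
      using \<phi>'\<phi>[OF inJ] \<psi>'\<psi>[OF inJ] by simp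
  next
    fix n y assume "y \<in> component (binary_sum M N) n"
    then obtain u v where y: "y = (u, v)" "u \<in> component M n" "v \<in> component N n" by (auto simp: binary_sum_def)
    with comp\<phi> comp\<psi> have "\<phi>' u \<in> component (free J1 \<delta>) n" "\<psi>' v \<in> component (free J2 \<delta>) n" by auto
    then show "(case y of (u, v) \<Rightarrow> \<phi>' u + \<psi>' v) \<in> component (free (J1 \<union> J2) \<delta>) n"
      using Poly_Mapping.keys_add[of "\<phi>' u" "\<psi>' v"] by (auto simp: y prF_simps)
  next
    fix n
    have "component M n \<subseteq> carrier M"
      using image_mono[OF sub, of \<phi> J1 n] unfolding \<phi>(3) bij_betw_imp_surj_on[OF \<phi>(2)] .
    moreover have "component N n \<subseteq> carrier N"
      using image_mono[OF sub, of \<psi> J2 n] unfolding \<psi>(3) bij_betw_imp_surj_on[OF \<psi>(2)] .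
    ultimately show "component (binary_sum M N) n \<subseteq> carrier (binary_sum M N)" by (auto simp: binary_sum_def)
  qed
qed

end

section \<open>Linear independence of the ordered monomials\<close>

text \<open>The exponents of \<open>e\<^sub>1\<^sub>3\<close>, \<open>e\<^sub>1\<^sub>2\<close>,
  \<open>e\<^sub>2\<^sub>3\<close>, in this order.\<close>

type_synonym expo = "nat \<times> nat \<times> nat"

text \<open>The matrix entry at the position of a root.\<close>

lift_definition sl3_entry :: "sl3_plus \<Rightarrow> root \<Rightarrow> complex" is
  "\<lambda>M \<alpha>. M $ root_row \<alpha> $ root_col \<alpha>" .

lemma sl3_entry_simps:
  "sl3_entry (sl3_add x y) \<alpha> = sl3_entry x \<alpha> + sl3_entry y \<alpha>"
  "sl3_entry (sl3_scale c x) \<alpha> = c * sl3_entry x \<alpha>"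
  "sl3_entry (sl3_bracket x y) R12 = 0"
  "sl3_entry (sl3_bracket x y) R23 = 0"
  "sl3_entry (sl3_bracket x y) R13 =
     sl3_entry x R12 * sl3_entry y R23 - sl3_entry y R12 * sl3_entry x R23"
  by (transfer; simp add: matrix_matrix_mult_def sum_3)+

lemma sl3_entry_unit: "sl3_entry (matrix_unit \<beta>) \<alpha> = (if \<alpha> = \<beta> then 1 else 0)"
  apply transfer
  subgoal for \<beta> \<alpha> by (cases \<alpha>; cases \<beta>; simp)
  done

text \<open>A function of three exponents \<open>(c, x, y)\<close> is regarded as the family of derivatives at
  the origin of a power series in variables \<open>w\<close>, \<open>u\<close>, \<open>v\<close>. Then
  \<open>e\<^sub>2\<^sub>3\<close> acts as the derivative by \<open>v\<close>,
  \<open>e\<^sub>1\<^sub>3\<close> as the derivative by \<open>w\<close>, and \<open>e\<^sub>1\<^sub>2\<close>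
  as the derivative by \<open>u\<close> minus \<open>v\<close> times the derivative by
  \<open>w\<close>.\<close>

definition vec_op :: "sl3_plus \<Rightarrow> (expo \<Rightarrow> complex) \<Rightarrow> expo \<Rightarrow> complex" where
  "vec_op M f = (\<lambda>(c, x, y).
     sl3_entry M R12 * (f (c, x + 1, y) - of_nat y * f (c + 1, x, y - 1)) +
     sl3_entry M R23 * f (c, x, y + 1) + sl3_entry M R13 * f (c + 1, x, y))"

lemma vec_op_linear: "vec_op M (\<lambda>p. r * f p + s * g p) = (\<lambda>p. r * vec_op M f p + s * vec_op M g p)"
  by (auto simp: vec_op_def algebra_simps)

lemma vec_op_bracket:
  "vec_op M (vec_op N f) p - vec_op N (vec_op M f) p = vec_op (sl3_bracket M N) f p"
proof -
  obtain c x y where p: "p = (c, x, y)" by (cases p)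
  show ?thesis
    by (cases y) (simp_all add: p vec_op_def sl3_entry_simps algebra_simps)
qed

text \<open>The action of a word in the elements of the Lie algebra.\<close>

fun word_act :: "sl3_plus free_monoid \<Rightarrow> (expo \<Rightarrow> complex) \<Rightarrow> expo \<Rightarrow> complex" where
  "word_act (FM xs) f = foldr vec_op xs f"

lemma word_act_add: "word_act (v + w) f = word_act v (word_act w f)"
  by (cases v; cases w) simp

lemma word_act_linear: "word_act w (\<lambda>p. r * f p + s * g p) = (\<lambda>p. r * word_act w f p + s * word_act w g p)"
proof (cases w)
  case (FM xs)
  show ?thesis unfolding FM by (induction xs) (simp_all add: vec_op_linear)
qed

lemma word_act_linear_simps:
  "word_act w (\<lambda>p. f p + g p) = (\<lambda>p. word_act w f p + word_act w g p)"
  "word_act w (\<lambda>p. r * f p) = (\<lambda>p. r * word_act w f p)"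
  "word_act w (\<lambda>p. 0) = (\<lambda>p. 0)"
  using word_act_linear[of w 1 f 1 g] word_act_linear[of w r f 0 g] word_act_linear[of w 0 f 0 g] by simp_all

text \<open>The representation of the free algebra.\<close>

definition free_rep :: "(sl3_plus free_monoid \<Rightarrow>\<^sub>0 complex) \<Rightarrow> (expo \<Rightarrow> complex) \<Rightarrow> expo \<Rightarrow> complex" where
  "free_rep q f = (\<lambda>p. pm_sum (\<lambda>w c. c * word_act w f p) q)"

lemma free_rep_add: "free_rep (q + q') f p = free_rep q f p + free_rep q' f p"
  by (simp add: free_rep_def pm_sum_add distrib_right)

lemma free_rep_minus: "free_rep (q - q') f p = free_rep q f p - free_rep q' f p"
  by (simp add: free_rep_def pm_sum_minus distrib_right)

lemma free_rep_single: "free_rep (Poly_Mapping.single w c) f p = c * word_act w f p"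
  by (simp add: free_rep_def pm_sum_single)

lemma free_rep_zero [simp]: "free_rep 0 f p = 0"
  by (simp add: free_rep_def)

lemma free_rep_arg:
  "free_rep q (\<lambda>p. f p + g p) p = free_rep q f p + free_rep q g p"
  "free_rep q (\<lambda>p. r * f p) p = r * free_rep q f p"
  "free_rep q (\<lambda>p. 0) p = 0"
  by (simp_all add: free_rep_def pm_sum_def word_act_linear_simps distrib_left sum.distrib sum_distrib_left mult_ac)

lemma free_rep_mult: "free_rep (q * q') f p = free_rep q (free_rep q' f) p"
proof (induction q arbitrary: p rule: pm_induct)
  case (single w c)
  show ?case
  proof (induction q' arbitrary: p rule: pm_induct)
    case (single v d)
    show ?case
      by (simp add: mult_single free_rep_single[abs_def] word_act_add word_act_linear_simps mult.assoc)
  next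
    case (add q1 q2)
    then show ?case by (simp add: distrib_left free_rep_add free_rep_add[abs_def] free_rep_arg)
  qed (simp add: free_rep_zero[abs_def] free_rep_arg)
qed (simp_all add: distrib_right free_rep_add)

text \<open>The representation kills the relations of the enveloping algebra, because it respects
  brackets.\<close>

lemma free_rep_relators: "r \<in> uea_relators \<Longrightarrow> free_rep r f p = 0"
  unfolding uea_relators_def free_gen_def
  using vec_op_bracket[of _ _ f p]
  by (auto simp: free_rep_minus free_rep_mult free_rep_single free_rep_single[abs_def] zero_free_monoid_def)
     (auto simp: vec_op_def sl3_entry_simps algebra_simps split: prod.splits)

lemma free_rep_ideal: "r \<in> two_sided_ideal uea_relators \<Longrightarrow> free_rep r f p = 0"
  unfolding two_sided_ideal_def
proof (induction rule: group_closure.induct)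
  case (base s)
  have "free_rep r g = (\<lambda>p. 0)" if "r \<in> uea_relators" for r g
    using free_rep_relators[OF that] by auto
  with base show ?case by (auto simp: free_rep_mult free_rep_arg)
qed (simp add: free_rep_minus)

text \<open>The representation of the enveloping algebra.\<close>

lift_definition uea_rep :: "uea \<Rightarrow> (expo \<Rightarrow> complex) \<Rightarrow> expo \<Rightarrow> complex" is free_rep
proof -
  fix q q' :: "sl3_plus free_monoid \<Rightarrow>\<^sub>0 complex"
  assume "q - q' \<in> two_sided_ideal uea_relators"
  then have "free_rep q f p = free_rep q' f p" for f p
    using free_rep_ideal[of "q - q'" f p] by (simp add: free_rep_minus)
  then show "free_rep q = free_rep q'" by (intro ext)
qed

lemma uea_rep_simps:
  "uea_rep (u + v) f p = uea_rep u f p + uea_rep v f p"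
  "uea_rep (u - v) f p = uea_rep u f p - uea_rep v f p"
  "uea_rep (u * v) f = uea_rep u (uea_rep v f)"
  "uea_rep 0 f p = 0"
  "uea_rep 1 f = f"
  "uea_rep (uea_scale c u) f p = c * uea_rep u f p"
  "uea_rep (uea_incl x) f = vec_op x f"
  subgoal by transfer (rule free_rep_add)
  subgoal by transfer (rule free_rep_minus)
  subgoal by transfer (auto simp: free_rep_mult)
  subgoal by transfer simp
  subgoal by transfer (auto simp: free_rep_single single_one[symmetric] zero_free_monoid_def simp del: single_one)
  subgoal by transfer (simp add: free_rep_mult free_rep_single[abs_def] free_rep_single zero_free_monoid_def)
  subgoal by (simp add: uea_incl_def uea_rep.abs_eq free_gen_def free_rep_single[abs_def])
  done

lemma uea_rep_divided_power: "uea_rep (divided_power u k) f p = (uea_rep u ^^ k) f p / fact k"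
proof -
  have "uea_rep (u ^ k) f = (uea_rep u ^^ k) f"
    by (induction k) (simp_all add: uea_rep_simps)
  then show ?thesis by (simp add: divided_power_def uea_rep_simps)
qed

text \<open>At \<open>v = 0\<close> the action of \<open>e\<^sub>1\<^sub>2\<close> is a plain shift, so an
  ordered product applied to a function and evaluated at the origin picks out one value.\<close>

lemma vec_op_unit_power:
  "(vec_op (matrix_unit R12) ^^ k) f (c, x, 0) = f (c, x + k, 0)"
  "(vec_op (matrix_unit R13) ^^ k) f (c, x, y) = f (c + k, x, y)"
  "(vec_op (matrix_unit R23) ^^ k) f (c, x, y) = f (c, x, y + k)"
  by (induction k arbitrary: c x y) (simp_all add: vec_op_def sl3_entry_unit)

text \<open>A triple of exponents as a function of the root.\<close>

fun exps :: "expo \<Rightarrow> root \<Rightarrow> nat" where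
  "exps (c, b, a) R13 = c" | "exps (c, b, a) R12 = b" | "exps (c, b, a) R23 = a"

lemma exps_surj: "k = exps (k R13, k R12, k R23)"
proof
  fix \<alpha> show "k \<alpha> = exps (k R13, k R12, k R23) \<alpha>" by (cases \<alpha>) auto
qed

text \<open>The coefficients of an element in the basis of ordered divided power monomials. The factorials
  cancel the denominators of the divided powers.\<close>

definition uea_coeff :: "uea \<Rightarrow> expo \<Rightarrow> complex" where
  "uea_coeff u = (\<lambda>(c, b, a). fact a * fact b * fact c * uea_rep u (\<lambda>p. if p = (c, b, a) then 1 else 0) (0, 0, 0))"

lemma uea_coeff_minus: "uea_coeff (u - v) m = uea_coeff u m - uea_coeff v m"
  by (cases m) (simp add: uea_coeff_def uea_rep_simps algebra_simps)

lemma uea_coeff_monomial: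
  "uea_coeff (ordered_monomial root_order (exps m)) m' = (if m = m' then 1 else 0)"
proof -
  obtain c b a c' b' a' where m: "m = (c, b, a)" "m' = (c', b', a')" by (cases m; cases m')
  let ?f = "\<lambda>p. if p = (c', b', a') then 1 else 0 :: complex"
  have "uea_rep (ordered_monomial root_order (exps m)) ?f (0, 0, 0) =
      ?f (c, b, a) / (fact a * fact b * fact c)"
    by (simp add: ordered_monomial_def root_order_def m uea_rep_simps uea_rep_divided_power
        vec_op_unit_power[abs_def] uea_rep_simps[abs_def] vec_op_unit_power)
  then show ?thesis by (auto simp: uea_coeff_def m)
qed

section \<open>Coordinates on the Kostant form\<close>

declare split_paired_All [simp del] split_paired_Ex [simp del]

lemma kostant_Z_induct [case_names zero mono diff]:
  assumes "P 0" "\<And>m. P (kostant_monomial (exps m))" "\<And>x y. P x \<Longrightarrow> P y \<Longrightarrow> P (x - y)"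
  shows "P u"
proof -
  have "P (Abs_kostant_Z v)" if "v \<in> integral_form root_order" for v
    using that unfolding integral_form_def
  proof (induction rule: group_closure.induct)
    case (base s)
    then consider "s = 0" | k where "s = ordered_monomial root_order k" by auto
    then show ?case
    proof cases
      case 1
      with assms(1) show ?thesis by (simp add: zero_kostant_Z_def)
    next
      case 2
      then have "s = ordered_monomial root_order (exps (k R13, k R12, k R23))"
        using exps_surj by metis
      then show ?thesis using assms(2) by (simp add: kostant_monomial_def)
    qed
  next
    case (diff s t)
    then have "Abs_kostant_Z (s - t) = Abs_kostant_Z s - Abs_kostant_Z t"
      by (simp add: minus_kostant_Z.abs_eq eq_onp_def integral_form_def)
    with diff assms(3) show ?case by simp
  qed
  from this[of "Rep_kostant_Z u"] show ?thesis by (simp add: Rep_kostant_Z Rep_kostant_Z_inverse)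
qed

text \<open>The same coefficients on the integral form, where they are integers and almost all zero.\<close>

lift_definition kostant_coeff :: "kostant_Z \<Rightarrow> expo \<Rightarrow> complex" is uea_coeff .

lemma kostant_coeff_simps:
  "kostant_coeff (u - v) m = kostant_coeff u m - kostant_coeff v m"
  "kostant_coeff 0 m = 0"
  "kostant_coeff (kostant_monomial (exps m)) m' = (if m = m' then 1 else 0)"
  subgoal by transfer (rule uea_coeff_minus)
  subgoal by transfer (use uea_coeff_minus[of 0 0] in simp)
  subgoal by transfer (rule uea_coeff_monomial)
  done

lemma kostant_coeff_integral: "\<exists>p. \<forall>m. kostant_coeff u m = of_int (lookup p m)"
proof (induction u rule: kostant_Z_induct)
  case (mono m)
  show ?case
    by (rule exI[of _ "Poly_Mapping.single m 1"]) (simp add: kostant_coeff_simps lookup_single when_def)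
next
  case (diff x y)
  then obtain p q where "\<forall>m. kostant_coeff x m = of_int (lookup p m)"
    "\<forall>m. kostant_coeff y m = of_int (lookup q m)" by auto
  then show ?case
    by (intro exI[of _ "p - q"]) (simp add: kostant_coeff_simps lookup_minus)
qed (auto intro!: exI[of _ 0] simp: kostant_coeff_simps)

text \<open>The integral coefficients as a finitely supported family.\<close>

definition int_coeff :: "kostant_Z \<Rightarrow> expo \<Rightarrow>\<^sub>0 int" where
  "int_coeff u = (SOME p. \<forall>m. kostant_coeff u m = of_int (lookup p m))"

lemma lookup_int_coeff: "of_int (lookup (int_coeff u) m) = kostant_coeff u m"
  unfolding int_coeff_def by (rule someI2_ex[OF kostant_coeff_integral]) auto

lemma int_coeff_simps:
  "int_coeff (u - v) = int_coeff u - int_coeff v"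
  "int_coeff 0 = 0"
  "int_coeff (kostant_monomial (exps m)) = Poly_Mapping.single m 1"
proof -
  have eq: "p = q" if "\<And>m. (of_int (lookup p m) :: complex) = of_int (lookup q m)"
    for p q :: "expo \<Rightarrow>\<^sub>0 int"
    using that by (intro poly_mapping_eqI) simp
  show "int_coeff (u - v) = int_coeff u - int_coeff v" "int_coeff 0 = 0"
    "int_coeff (kostant_monomial (exps m)) = Poly_Mapping.single m 1"
    by (rule eq; simp add: lookup_minus lookup_int_coeff kostant_coeff_simps lookup_single when_def)+
qed

lemma int_coeff_add: "int_coeff (u + v) = int_coeff u + int_coeff v"
  using int_coeff_simps(1)[of u "- v"] int_coeff_simps(1)[of 0 v] by (simp add: int_coeff_simps)

subsection \<open>Tensor products\<close>

lemma pure_tensor_add: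
  "pure_tensor (a + b) x = pure_tensor a x + pure_tensor b x"
  "pure_tensor a (x + y) = pure_tensor a x + pure_tensor a y"
proof -
  have "elem (a + b) x - (elem a x + elem b x) \<in> group_closure tensor_relators"
    by (rule in_group_closure) (unfold tensor_relators_def diff_diff_eq, blast)
  then show "pure_tensor (a + b) x = pure_tensor a x + pure_tensor b x"
    by (simp add: pure_tensor_def plus_tensor.abs_eq tensor.abs_eq_iff)
  have "elem a (x + y) - (elem a x + elem a y) \<in> group_closure tensor_relators"
    by (rule in_group_closure) (unfold tensor_relators_def diff_diff_eq, blast)
  then show "pure_tensor a (x + y) = pure_tensor a x + pure_tensor a y"
    by (simp add: pure_tensor_def plus_tensor.abs_eq tensor.abs_eq_iff)
qed

lemma pure_tensor_0 [simp]: "pure_tensor 0 x = 0" "pure_tensor a 0 = 0"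
  using pure_tensor_add(1)[of 0 0 x] pure_tensor_add(2)[of a 0 0] by simp_all

lemma pure_tensor_minus:
  "pure_tensor (a - b) x = pure_tensor a x - pure_tensor b x"
  "pure_tensor a (x - y) = pure_tensor a x - pure_tensor a y"
  using pure_tensor_add(1)[of "a - b" b x] pure_tensor_add(2)[of a "x - y" y]
  by (simp_all add: algebra_simps)

lemma pure_tensor_mult: "pure_tensor a x * pure_tensor b y = pure_tensor (a * b) (x * y)"
  by (simp add: pure_tensor_def times_tensor.abs_eq mult_single)

lemma pure_tensor_1: "pure_tensor 1 1 = 1"
  by (simp add: pure_tensor_def one_tensor_def flip: zero_elementary_def single_one)

lemma pure_tensor_of_nat: "pure_tensor a (of_nat n * x) = pure_tensor (of_nat n * a) x"
  by (induction n) (simp_all add: distrib_right pure_tensor_add)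

lemma pure_tensor_sum: "pure_tensor a (sum f S) = (\<Sum>s\<in>S. pure_tensor a (f s))"
  by (induction S rule: infinite_finite_induct) (simp_all add: pure_tensor_add)

text \<open>Pure tensors generate the tensor product as an abelian group.\<close>

lemma tensor_induct [case_names zero pure diff]:
  assumes "P 0" "\<And>a x. P (pure_tensor a x)" "\<And>s t. P s \<Longrightarrow> P t \<Longrightarrow> P (s - t)"
  shows "P t"
proof -
  have "P (abs_tensor f)" for f
  proof (rule frag_induction[of f UNIV "\<lambda>f. P (abs_tensor f)"])
    show "P (abs_tensor 0)" using assms(1) by (simp add: zero_tensor_def)
    show "P (abs_tensor (Poly_Mapping.single e 1))" for e
      using assms(2) by (cases e) (simp add: pure_tensor_def)
    show "P (abs_tensor (f - g))" if "P (abs_tensor f)" "P (abs_tensor g)" for f g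
      using assms(3)[OF that] by (simp add: minus_tensor.abs_eq)
  qed auto
  from this[of "rep_tensor t"] show ?thesis by (simp add: Quotient_abs_rep[OF Quotient_tensor])
qed

subsection \<open>Coordinates over a field\<close>

text \<open>The coordinates of \<open>n\<close> times an elementary tensor.\<close>

fun elem_coeff :: "('k::field, kostant_Z) elementary \<Rightarrow> int \<Rightarrow> expo \<Rightarrow>\<^sub>0 'k" where
  "elem_coeff (Elem a u) n = Poly_Mapping.map (\<lambda>i. of_int (n * i) * a) (int_coeff u)"

lemma lookup_elem_coeff:
  "lookup (elem_coeff (Elem a u) n) m = of_int n * of_int (lookup (int_coeff u) m) * a"
  by (simp add: map.rep_eq when_def)

lemma elem_coeff_add: "elem_coeff e (n + n') = elem_coeff e n + elem_coeff e n'"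
  by (cases e; rule poly_mapping_eqI)
    (simp add: lookup_elem_coeff lookup_add algebra_simps del: elem_coeff.simps)

lemma elem_coeff_0: "elem_coeff e 0 = 0"
  using elem_coeff_add[of e 0 0] by simp

text \<open>The coordinates of an element of the Kostant form over a field. They respect the relations of the
  tensor product since they are additive in both factors.\<close>

lift_definition coord :: "('k::field, kostant_Z) tensor \<Rightarrow> expo \<Rightarrow>\<^sub>0 'k" is "pm_sum elem_coeff"
proof -
  fix f g :: "('k, kostant_Z) elementary \<Rightarrow>\<^sub>0 int"
  assume "f - g \<in> group_closure tensor_relators"
  then have "pm_sum elem_coeff (f - g) = 0"
  proof (induction rule: group_closure.induct)
    case (base s)
    have 1: "elem_coeff (Elem (a + b) x) 1 - elem_coeff (Elem a x) 1 - elem_coeff (Elem b x) 1 = 0"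
      for a b :: 'k and x
      by (rule poly_mapping_eqI)
        (simp add: lookup_elem_coeff lookup_minus lookup_add algebra_simps del: elem_coeff.simps)
    have 2: "elem_coeff (Elem a (x + y)) 1 - elem_coeff (Elem a x) 1 - elem_coeff (Elem a y) 1 = 0"
      for a :: 'k and x y
      by (rule poly_mapping_eqI)
        (simp add: lookup_elem_coeff lookup_minus lookup_add int_coeff_add algebra_simps del: elem_coeff.simps)
    from base show ?case
      by (auto simp: tensor_relators_def pm_sum_minus elem_coeff_add pm_sum_single elem_coeff_0
          1 2 simp del: elem_coeff.simps)
  qed (simp add: pm_sum_minus elem_coeff_add)
  then show "pm_sum elem_coeff f = pm_sum elem_coeff g"
    by (simp add: pm_sum_minus elem_coeff_add)
qed

lemma coord_minus: "coord (s - t) = coord s - coord t"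
  by transfer (simp add: pm_sum_minus elem_coeff_add)

lemma coord_add: "coord (s + t) = coord s + coord t"
  by transfer (simp add: pm_sum_add elem_coeff_add elem_coeff_0)

lemma coord_0 [simp]: "coord 0 = 0"
  by transfer simp

lemma lookup_coord_pure:
  "lookup (coord (pure_tensor a u)) m = of_int (lookup (int_coeff u) m) * a"
  by (simp add: pure_tensor_def coord.abs_eq pm_sum_single elem_coeff_0 lookup_elem_coeff del: elem_coeff.simps)

text \<open>The embedding of the field.\<close>

definition scal :: "'k::field \<Rightarrow> 'k kostant" where
  "scal c = pure_tensor c 1"

text \<open>The basis element with given exponents.\<close>

definition mon :: "expo \<Rightarrow> 'k::field kostant" where
  "mon m = pure_tensor 1 (kostant_monomial (exps m))"

lemma scal_simps:
  "scal (c + d) = scal c + scal d" "scal (c - d) = scal c - scal d" "scal (c * d) = scal c * scal d"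
  "scal 0 = 0" "scal 1 = 1"
  by (simp_all add: scal_def pure_tensor_add pure_tensor_minus pure_tensor_mult pure_tensor_1)

lemma scal_pure: "scal c * pure_tensor a u = pure_tensor (c * a) u"
  by (simp add: scal_def pure_tensor_mult)

lemma scal_commute: "scal c * t = t * scal c"
  by (induction t rule: tensor_induct)
    (simp_all add: scal_def pure_tensor_mult mult.commute left_diff_distrib right_diff_distrib)

lemma coord_scal: "lookup (coord (scal c * t)) m = c * lookup (coord t) m"
  by (induction t rule: tensor_induct)
    (simp_all add: scal_pure lookup_coord_pure right_diff_distrib coord_minus lookup_minus)

lemma coord_mon: "coord (mon m) = Poly_Mapping.single m 1"
  by (rule poly_mapping_eqI) (simp add: mon_def lookup_coord_pure int_coeff_simps lookup_single when_def)

text \<open>The element with given coordinates.\<close>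

definition from_coord :: "(expo \<Rightarrow>\<^sub>0 'k::field) \<Rightarrow> 'k kostant" where
  "from_coord = pm_sum (\<lambda>m c. scal c * mon m)"

lemma from_coord_simps:
  "from_coord (p + q) = from_coord p + from_coord q" "from_coord (p - q) = from_coord p - from_coord q"
  "from_coord 0 = 0" "from_coord (Poly_Mapping.single m c) = scal c * mon m"
  unfolding from_coord_def
  by (simp_all add: pm_sum_add pm_sum_minus pm_sum_single scal_simps distrib_right)

lemma coord_from_coord: "coord (from_coord p) = p"
proof (induction p rule: pm_induct)
  case (single m c)
  show ?case
    by (rule poly_mapping_eqI) (simp add: from_coord_simps coord_scal coord_mon lookup_single when_def)
qed (simp_all add: from_coord_simps coord_add)

lemma from_coord_coord: "from_coord (coord t) = t"
proof (induction t rule: tensor_induct)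
  case (pure a u)
  show ?case
  proof (induction u rule: kostant_Z_induct)
    case (mono m)
    have "pure_tensor a (kostant_monomial (exps m)) = scal a * mon m"
      by (simp add: mon_def scal_pure)
    moreover have "coord (scal a * mon m) = Poly_Mapping.single m a"
      by (rule poly_mapping_eqI) (simp add: coord_scal coord_mon lookup_single when_def)
    ultimately show ?case by (simp add: from_coord_simps)
  qed (simp_all add: pure_tensor_minus coord_minus from_coord_simps)
qed (simp_all add: coord_minus from_coord_simps)

lemma coord_inject: "coord s = coord t \<longleftrightarrow> s = t"
  by (metis from_coord_coord)

lemma coord_single: "coord (scal c * mon m) = Poly_Mapping.single m c"
  by (metis coord_from_coord from_coord_simps(4))

text \<open>The degree of a basis element.\<close>

fun wt :: "expo \<Rightarrow> nat" where "wt (c, b, a) = a + b + 2 * c"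

lemma weight_exps: "weight (exps m) = wt m"
  by (cases m) (simp add: weight_eq)

lemma kostant_grading_iff:
  "t \<in> kostant_grading d \<longleftrightarrow> (\<forall>m. lookup (coord t) m \<noteq> 0 \<longrightarrow> wt m = d)"
proof
  assume "t \<in> kostant_grading d"
  then show "\<forall>m. lookup (coord t) m \<noteq> 0 \<longrightarrow> wt m = d"
    unfolding kostant_grading_def
  proof (induction rule: group_closure.induct)
    case (base s)
    then consider "s = 0" | c k where "s = pure_tensor c (kostant_monomial k)" "weight k = d" by auto
    then show ?case
    proof cases
      case 2
      moreover obtain m where "k = exps m" using exps_surj by blast
      ultimately have "s = scal c * mon m" "wt m = d"
        by (simp_all add: mon_def scal_pure weight_exps)
      then show ?thesis by (simp add: coord_single lookup_single when_def)
    qed simp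
  next
    case (diff s t)
    show ?case using diff.IH by (metis coord_minus lookup_minus diff_zero)
  qed
next
  assume *: "\<forall>m. lookup (coord t) m \<noteq> 0 \<longrightarrow> wt m = d"
  have "from_coord (coord t) \<in> kostant_grading d"
    unfolding from_coord_def pm_sum_def kostant_grading_def
  proof (intro group_closure_sum in_group_closure)
    fix m assume "m \<in> keys (coord t)"
    with * have "weight (exps m) = d" by (simp add: weight_exps in_keys_iff)
    then show "scal (lookup (coord t) m) * mon m \<in>
        {pure_tensor c (kostant_monomial k) |c k. weight k = d}"
      by (auto simp: mon_def scal_pure)
  qed
  then show "t \<in> kostant_grading d" by (simp add: from_coord_coord)
qed

lemma positive_part_iff:
  "t \<in> positive_part kostant_grading \<longleftrightarrow> lookup (coord t) (0, 0, 0) = 0"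
proof
  assume "t \<in> positive_part kostant_grading"
  then show "lookup (coord t) (0, 0, 0) = 0"
    unfolding positive_part_def
  proof (induction rule: group_closure.induct)
    case (base s)
    then consider "s = 0" | d where "d \<ge> 1" "s \<in> kostant_grading d" by auto
    then show ?case
    proof cases
      case 2
      moreover have "wt (0, 0, 0) = 0" by simp
      ultimately show ?thesis unfolding kostant_grading_iff by (metis not_one_le_zero)
    qed simp
  qed (simp add: coord_minus lookup_minus)
next
  assume *: "lookup (coord t) (0, 0, 0) = 0"
  have "from_coord (coord t) \<in> positive_part kostant_grading"
    unfolding from_coord_def pm_sum_def positive_part_def
  proof (intro group_closure_sum in_group_closure)
    fix m assume "m \<in> keys (coord t)"
    with * have "m \<noteq> (0, 0, 0)" by (auto simp: in_keys_iff)
    then have "wt m \<ge> 1" by (cases m) auto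
    moreover have "scal (lookup (coord t) m) * mon m \<in> kostant_grading (wt m)"
      by (simp add: kostant_grading_iff coord_single lookup_single when_def)
    ultimately show "scal (lookup (coord t) m) * mon m \<in> (\<Union>d\<in>{1..}. kostant_grading d)"
      by auto
  qed
  then show "t \<in> positive_part kostant_grading" by (simp add: from_coord_coord)
qed

section \<open>Multiplication in the Kostant form in characteristic two\<close>

lemma dp_eq_ordered_monomial:
  "divided_power (uea_e \<alpha>) n = ordered_monomial root_order (\<lambda>\<beta>. if \<beta> = \<alpha> then n else 0)"
  by (cases \<alpha>) (simp_all add: ordered_monomial_def root_order_def)

text \<open>The divided powers of the root vectors, as elements of the integral form.\<close>

lift_definition kostant_dp :: "root \<Rightarrow> nat \<Rightarrow> kostant_Z" is "\<lambda>\<alpha> n. divided_power (uea_e \<alpha>) n"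
  unfolding dp_eq_ordered_monomial integral_form_def by (intro in_group_closure rangeI)

lemma Rep_kostant_Z_simps:
  "Rep_kostant_Z (x * y) = Rep_kostant_Z x * Rep_kostant_Z y"
  "Rep_kostant_Z (of_nat n) = of_nat n"
  "Rep_kostant_Z (- x) = - Rep_kostant_Z x"
  "Rep_kostant_Z (sum f S) = (\<Sum>s\<in>S. Rep_kostant_Z (f s))"
  "Rep_kostant_Z ((- 1) ^ j) = (- 1) ^ j"
proof -
  show "Rep_kostant_Z (of_nat n) = of_nat n"
    by (induction n) (simp_all add: zero_kostant_Z.rep_eq one_kostant_Z.rep_eq plus_kostant_Z.rep_eq)
  show "Rep_kostant_Z (sum f S) = (\<Sum>s\<in>S. Rep_kostant_Z (f s))"
    by (induction S rule: infinite_finite_induct) (simp_all add: zero_kostant_Z.rep_eq plus_kostant_Z.rep_eq)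
  show "Rep_kostant_Z ((- 1) ^ j) = (- 1) ^ j"
    by (cases "even j") (simp_all add: uminus_kostant_Z.rep_eq one_kostant_Z.rep_eq)
qed (simp_all add: times_kostant_Z.rep_eq uminus_kostant_Z.rep_eq)

lemma kostant_dp_mult: "kostant_dp \<alpha> a * kostant_dp \<alpha> b = of_nat ((a + b) choose a) * kostant_dp \<alpha> (a + b)"
  unfolding Rep_kostant_Z_inject[symmetric] Rep_kostant_Z_simps kostant_dp.rep_eq by (rule divided_power_mult)

lemma kostant_dp_0: "kostant_dp \<alpha> 0 = 1"
  unfolding Rep_kostant_Z_inject[symmetric] one_kostant_Z.rep_eq kostant_dp.rep_eq by simp

lemma kostant_dp_commute:
  "kostant_dp R12 a * kostant_dp R13 c = kostant_dp R13 c * kostant_dp R12 a" "kostant_dp R23 a * kostant_dp R13 c = kostant_dp R13 c * kostant_dp R23 a"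
  unfolding Rep_kostant_Z_inject[symmetric] Rep_kostant_Z_simps kostant_dp.rep_eq by (rule dp_commute)+

text \<open>The commutator of \<open>e\<^sub>2\<^sub>3\<close> and \<open>e\<^sub>1\<^sub>2\<close> is
  \<open>- e\<^sub>1\<^sub>3\<close>, whence the signs.\<close>

lemma kostant_dp_exchange: "kostant_dp R23 a * kostant_dp R12 b =
    (\<Sum>j\<le>min a b. (- 1) ^ j * (kostant_dp R13 j * kostant_dp R12 (b - j) * kostant_dp R23 (a - j)))"
proof -
  let ?z = "- uea_e R13"
  have "dp R23 a * dp R12 b =
      (\<Sum>j\<le>a. if j \<le> b then divided_power ?z j * dp R12 (b - j) * dp R23 (a - j) else 0)"
    by (rule divided_power_exchange) (simp_all add: uea_e_commute)
  also have "\<dots> = (\<Sum>j\<in>{j. j \<le> a \<and> j \<le> b}. divided_power ?z j * dp R12 (b - j) * dp R23 (a - j))"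
    by (rule sum.mono_neutral_cong_right) auto
  also have "{j. j \<le> a \<and> j \<le> b} = {..min a b}" by auto
  finally show ?thesis
    unfolding Rep_kostant_Z_inject[symmetric] Rep_kostant_Z_simps kostant_dp.rep_eq divided_power_uminus
    by (simp add: mult.assoc)
qed

lemma kostant_monomial_kostant_dp: "kostant_monomial (exps (c, b, a)) = kostant_dp R13 c * kostant_dp R12 b * kostant_dp R23 a"
proof -
  have "kostant_monomial (exps (c, b, a)) = kostant_dp R12 b * kostant_dp R13 c * kostant_dp R23 a"
    unfolding Rep_kostant_Z_inject[symmetric] Rep_kostant_Z_simps kostant_dp.rep_eq kostant_monomial.rep_eq
    by (simp add: ordered_monomial_def root_order_def mult.assoc)
  then show ?thesis by (simp add: kostant_dp_commute)
qed

text \<open>The divided powers of \<open>e\<^sub>2\<^sub>3\<close>, \<open>e\<^sub>1\<^sub>2\<close>,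
  \<open>e\<^sub>1\<^sub>3\<close> over a field. With this choice the basis monomials are \<open>kZ c * kY b *
  kX a\<close>.\<close>

definition kX :: "nat \<Rightarrow> 'k::field kostant" where "kX a = pure_tensor 1 (kostant_dp R23 a)"
definition kY :: "nat \<Rightarrow> 'k::field kostant" where "kY b = pure_tensor 1 (kostant_dp R12 b)"
definition kZ :: "nat \<Rightarrow> 'k::field kostant" where "kZ c = pure_tensor 1 (kostant_dp R13 c)"

lemma mon_eq: "mon (c, b, a) = kZ c * kY b * kX a"
  by (simp add: mon_def kZ_def kY_def kX_def pure_tensor_mult kostant_monomial_kostant_dp)

lemma kXYZ_0: "kX 0 = 1" "kY 0 = 1" "kZ 0 = 1"
  by (simp_all add: kX_def kY_def kZ_def kostant_dp_0 pure_tensor_1)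

lemma mon_single: "kX a = mon (0, 0, a)" "kY b = mon (0, b, 0)" "kZ c = mon (c, 0, 0)"
  by (simp_all add: mon_eq kXYZ_0)

lemma char2_facts:
  assumes "CHAR('k::field) = 2"
  shows "- 1 = (1 :: 'k)" "(of_nat n :: 'k) = (if odd n then 1 else 0)"
proof -
  have *: "(of_nat n :: 'k) = 0 \<longleftrightarrow> even n" for n by (simp add: of_nat_eq_0_iff_char_dvd assms)
  from *[of 2] have "(1 :: 'k) + 1 = 0" by simp
  then show m: "- 1 = (1 :: 'k)" by (simp add: eq_neg_iff_add_eq_0 minus_equation_iff)
  show "(of_nat n :: 'k) = (if odd n then 1 else 0)"
  proof (cases "odd n")
    case True
    then obtain m where "n = Suc (2 * m)" by (metis oddE Suc_eq_plus1)
    then show ?thesis using *[of "2 * m"] by simp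
  qed (use * in simp)
qed

lemma divided_powers_kostant:
  assumes "CHAR('k::field) = 2"
  shows "divided_powers (\<lambda>n. pure_tensor 1 (kostant_dp \<alpha> n) :: 'k kostant)"
proof
  show "pure_tensor 1 (kostant_dp \<alpha> 0) = (1 :: 'k kostant)" by (simp add: kostant_dp_0 pure_tensor_1)
  show "pure_tensor 1 (kostant_dp \<alpha> a) * pure_tensor 1 (kostant_dp \<alpha> b) =
      (if odd ((a + b) choose a) then pure_tensor 1 (kostant_dp \<alpha> (a + b)) else 0 :: 'k kostant)" for a b
    by (simp add: pure_tensor_mult kostant_dp_mult pure_tensor_of_nat char2_facts[OF assms])
qed

lemma heisenberg2_kostant:
  assumes "CHAR('k::field) = 2"
  shows "heisenberg2 (kX :: nat \<Rightarrow> 'k kostant) kY kZ"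
proof (rule heisenberg2.intro)
  have "(1 :: 'k kostant) + 1 = scal (1 + - 1)"
    unfolding char2_facts(1)[OF assms] by (simp only: scal_simps)
  then show "(1 :: 'k kostant) + 1 = 0" by (simp add: scal_simps)
  show "divided_powers (kX :: nat \<Rightarrow> 'k kostant)" "divided_powers (kY :: nat \<Rightarrow> 'k kostant)"
    "divided_powers (kZ :: nat \<Rightarrow> 'k kostant)"
    using divided_powers_kostant[OF assms, of R23] divided_powers_kostant[OF assms, of R12]
      divided_powers_kostant[OF assms, of R13] by (simp_all add: kX_def[abs_def] kY_def[abs_def] kZ_def[abs_def])
  show "kX a * kZ c = kZ c * (kX a :: 'k kostant)" "kY a * kZ c = kZ c * (kY a :: 'k kostant)" for a c
    by (simp_all add: kX_def kY_def kZ_def pure_tensor_mult kostant_dp_commute)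
  show "kX a * kY b = (\<Sum>j\<le>min a b. kZ j * kY (b - j) * kX (a - j) :: 'k kostant)" for a b
  proof -
    have "pure_tensor 1 ((- 1) ^ j * u) = (pure_tensor 1 u :: 'k kostant)" for j u
    proof -
      have "pure_tensor 1 (- u) = (pure_tensor (- 1) u :: 'k kostant)"
        using pure_tensor_minus(2)[of "1 :: 'k" 0 u] pure_tensor_minus(1)[of "0 :: 'k" 1 u] by simp
      then show ?thesis by (cases "even j") (simp_all add: char2_facts[OF assms])
    qed
    then show ?thesis
      by (simp add: kX_def kY_def kZ_def pure_tensor_mult kostant_dp_exchange pure_tensor_sum)
  qed
qed

lemma kostant_generated: "t \<in> group_closure {scal r * kZ c * kY b * kX a | r c b a. True}"
proof -
  have "from_coord (coord t) \<in> group_closure {scal r * kZ c * kY b * kX a | r c b a. True}"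
    unfolding from_coord_def pm_sum_def
  proof (intro group_closure_sum in_group_closure)
    fix m :: expo
    obtain c b a where "m = (c, b, a)" by (cases m)
    then show "scal (lookup (coord t) m) * mon m \<in> {scal r * kZ c * kY b * kX a | r c b a. True}"
      by (auto simp: mon_eq mult.assoc)
  qed
  then show ?thesis by (simp add: from_coord_coord)
qed

lemma kostant2_kostant:
  assumes "CHAR('k::field) = 2"
  shows "kostant2 (kX :: nat \<Rightarrow> 'k kostant) kY kZ scal"
  by (intro kostant2.intro kostant2_axioms.intro heisenberg2_kostant assms scal_commute kostant_generated)
    (simp_all add: scal_simps)

lemma mon_mult:
  assumes "CHAR('k::field) = 2"
  shows "mon (c, b, a) * mon (c', b', a') = (\<Sum>j\<le>min a b'.
    if odd ((c + c') choose c) \<and> odd ((c + c' + j) choose (c + c')) \<and> odd ((b + (b' - j)) choose b) \<and>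
      odd ((a - j + a') choose (a - j)) then mon (c + c' + j, b + (b' - j), a - j + a') else 0 :: 'k kostant)"
proof -
  interpret H: heisenberg2 "kX :: nat \<Rightarrow> 'k kostant" kY kZ by (rule heisenberg2_kostant[OF assms])
  have "mon (c, b, a) * mon (c', b', a') = kZ c * kY b * (kX a * kZ c') * kY b' * (kX a' :: 'k kostant)"
    by (simp add: mon_eq mult.assoc)
  also have "\<dots> = kZ c * (kY b * kZ c') * (kX a * kY b') * (kX a' :: 'k kostant)"
    by (simp only: H.ZX mult.assoc)
  also have "\<dots> = kZ c * kZ c' * kY b * (\<Sum>j\<le>min a b'. kZ j * kY (b' - j) * kX (a - j)) * (kX a' :: 'k kostant)"
    by (simp only: H.ZY H.XY mult.assoc)
  also have "\<dots> = (\<Sum>j\<le>min a b'. (kZ c * kZ c') * (kY b * kZ j) * kY (b' - j) * (kX (a - j) * kX a'))"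
    by (simp only: sum_distrib_left sum_distrib_right mult.assoc)
  also have "\<dots> = (\<Sum>j\<le>min a b'. ((kZ c * kZ c') * kZ j) * (kY b * kY (b' - j)) * (kX (a - j) * kX a'))"
    by (simp only: H.ZY mult.assoc)
  also have "\<dots> = (\<Sum>j\<le>min a b'.
    if odd ((c + c') choose c) \<and> odd ((c + c' + j) choose (c + c')) \<and> odd ((b + (b' - j)) choose b) \<and>
      odd ((a - j + a') choose (a - j)) then mon (c + c' + j, b + (b' - j), a - j + a') else 0)"
    by (intro sum.cong refl) (simp add: H.mult_simps mon_eq)
  finally show ?thesis .
qed

lemma scal_mult_scal: "scal r * x * (scal s * y) = scal (r * s) * (x * y)"
proof -
  have "scal r * x * (scal s * y) = scal r * (x * scal s) * y" by (simp only: mult.assoc)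
  also have "x * scal s = scal s * x" by (rule scal_commute[symmetric])
  finally show ?thesis by (simp only: scal_simps mult.assoc)
qed

lemma mult_expand:
  fixes s t :: "'k::field kostant"
  shows "s * t = (\<Sum>m\<in>keys (coord s). \<Sum>m'\<in>keys (coord t).
    scal (lookup (coord s) m * lookup (coord t) m') * (mon m * mon m'))"
proof -
  have "s * t = from_coord (coord s) * from_coord (coord t)" by (simp add: from_coord_coord)
  also have "\<dots> = (\<Sum>m\<in>keys (coord s). \<Sum>m'\<in>keys (coord t).
      scal (lookup (coord s) m) * mon m * (scal (lookup (coord t) m') * mon m'))"
    by (simp add: from_coord_def pm_sum_def sum_product)
  also have "\<dots> = (\<Sum>m\<in>keys (coord s). \<Sum>m'\<in>keys (coord t).
    scal (lookup (coord s) m * lookup (coord t) m') * (mon m * mon m'))"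
    by (intro sum.cong refl scal_mult_scal)
  finally show ?thesis .
qed

lemma coord_sum: "coord (\<Sum>s\<in>S. f s) = (\<Sum>s\<in>S. coord (f s))"
  by (induction S rule: infinite_finite_induct) (simp_all add: coord_add)

lemma kostant_grading_mult:
  fixes s t :: "'k::field kostant"
  assumes "CHAR('k) = 2" "s \<in> kostant_grading d" "t \<in> kostant_grading e"
  shows "s * t \<in> kostant_grading (d + e)"
proof -
  have zero: "(0 :: 'k kostant) \<in> kostant_grading n" for n by (simp add: kostant_grading_def)
  have if_in: "(if P then u else v) \<in> S" if "v \<in> S" "u \<in> S" for P and u v :: "'k kostant" and S
    using that by simp
  have sum: "(\<Sum>i\<in>S. f i) \<in> kostant_grading n" if "\<And>i. i \<in> S \<Longrightarrow> f i \<in> kostant_grading n"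
    for S :: "'i set" and f :: "'i \<Rightarrow> 'k kostant" and n
    using that unfolding kostant_grading_def by (rule group_closure_sum)
  have mon: "(mon m :: 'k kostant) \<in> kostant_grading (wt m)" for m
    by (simp add: kostant_grading_iff coord_mon lookup_single when_def)
  have scal: "scal r * u \<in> kostant_grading n" if "u \<in> kostant_grading n" for r n and u :: "'k kostant"
    using that by (simp add: kostant_grading_iff coord_scal)
  have "mon m * mon m' \<in> (kostant_grading (wt m + wt m') :: 'k kostant set)" for m m'
  proof -
    obtain c b a c' b' a' where m: "m = (c, b, a)" "m' = (c', b', a')" by (cases m; cases m')
    show ?thesis
      unfolding m mon_mult[OF assms(1)]
    proof (rule sum)
      fix j assume "j \<in> {..min a b'}"
      then have eq: "wt (c + c' + j, b + (b' - j), a - j + a') = wt (c, b, a) + wt (c', b', a')" by simp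
      show "(if odd ((c + c') choose c) \<and> odd ((c + c' + j) choose (c + c')) \<and>
          odd ((b + (b' - j)) choose b) \<and> odd ((a - j + a') choose (a - j))
        then mon (c + c' + j, b + (b' - j), a - j + a') else 0 :: 'k kostant) \<in> kostant_grading (wt (c, b, a) + wt (c', b', a'))"
        using mon[of "(c + c' + j, b + (b' - j), a - j + a')"] unfolding eq by (rule if_in[OF zero])
    qed
  qed
  moreover have "wt m = d" if "m \<in> keys (coord s)" for m
    using that assms(2) by (simp add: kostant_grading_iff in_keys_iff)
  moreover have "wt m = e" if "m \<in> keys (coord t)" for m
    using that assms(3) by (simp add: kostant_grading_iff in_keys_iff)
  ultimately show ?thesis
    unfolding mult_expand[of s t] by (intro sum scal) metis
qed

text \<open>Products of elements of positive degree have no term \<open>kX (2 ^ k)\<close> or \<open>kY (2 ^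
  k)\<close>: such a term could only come from a product \<open>kX a * kX c\<close> or \<open>kY a * kY
  c\<close> with an even binomial coefficient.\<close>

lemma coord_mult_power:
  fixes s t :: "'k::field kostant"
  assumes "CHAR('k) = 2" "lookup (coord s) (0, 0, 0) = 0" "lookup (coord t) (0, 0, 0) = 0"
    and M: "M = (0, 0, 2 ^ k) \<or> M = (0, 2 ^ k, 0)"
  shows "lookup (coord (s * t)) M = 0"
proof -
  have "lookup (coord (mon m * mon m' :: 'k kostant)) M = 0"
    if "m \<noteq> (0, 0, 0)" "m' \<noteq> (0, 0, 0)" for m m'
  proof -
    obtain c b a c' b' a' where m: "m = (c, b, a)" "m' = (c', b', a')" by (cases m; cases m')
    show ?thesis
      unfolding m mon_mult[OF assms(1)] coord_sum lookup_sum
    proof (rule sum.neutral, rule ballI)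
      fix j assume j: "j \<in> {..min a b'}"
      let ?M = "(c + c' + j, b + (b' - j), a - j + a')"
      have "\<not> (odd ((b + (b' - j)) choose b) \<and> odd ((a - j + a') choose (a - j)) \<and> ?M = M)"
      proof
        assume *: "odd ((b + (b' - j)) choose b) \<and> odd ((a - j + a') choose (a - j)) \<and> ?M = M"
        with M have z: "c = 0" "c' = 0" "j = 0" by auto
        from M show False
        proof
          assume "M = (0, 0, 2 ^ k)"
          then have "b = 0" "b' = 0" "a + a' = 2 ^ k" using * z by auto
          moreover from this have "a \<noteq> 0" "a' \<noteq> 0" using that m z by auto
          ultimately show False using * z even_power_choose[of a k] by auto
        next
          assume "M = (0, 2 ^ k, 0)"
          then have "a = 0" "a' = 0" "b + b' = 2 ^ k" using * z by auto
          moreover from this have "b \<noteq> 0" "b' \<noteq> 0" using that m z by auto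
          ultimately show False using * z even_power_choose[of b k] by auto
        qed
      qed
      then show "lookup (coord (if odd ((c + c') choose c) \<and> odd ((c + c' + j) choose (c + c')) \<and>
          odd ((b + (b' - j)) choose b) \<and> odd ((a - j + a') choose (a - j))
        then mon ?M else 0 :: 'k kostant)) M = 0"
        by (auto simp: coord_mon lookup_single when_def simp del: Pair_inject)
    qed
  qed
  moreover have "m \<noteq> (0, 0, 0)" if "m \<in> keys (coord s)" for m
    using that assms(2) by (auto simp: in_keys_iff)
  moreover have "m \<noteq> (0, 0, 0)" if "m \<in> keys (coord t)" for m
    using that assms(3) by (auto simp: in_keys_iff)
  ultimately show ?thesis
    by (simp add: mult_expand[of s t] coord_sum lookup_sum coord_scal)
qed

text \<open>The projection to the component of degree \<open>n\<close>.\<close>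

definition proj :: "nat \<Rightarrow> 'k::field kostant \<Rightarrow> 'k kostant" where
  "proj n t = from_coord (Poly_Mapping.mapp (\<lambda>m c. if wt m = n then c else 0) (coord t))"

lemma coord_proj: "lookup (coord (proj n t)) m = (if wt m = n then lookup (coord t) m else 0)"
  by (auto simp: proj_def coord_from_coord lookup_mapp when_def in_keys_iff)

lemma coord_eqI: "(\<And>m. lookup (coord s) m = lookup (coord t) m) \<Longrightarrow> s = t"
  using coord_inject poly_mapping_eqI by blast

lemma coord_1: "coord (1 :: 'k::field kostant) = Poly_Mapping.single (0, 0, 0) 1"
  using coord_mon[of "(0, 0, 0)"] by (simp add: mon_eq kXYZ_0)

lemma graded_algebra_kostant:
  assumes "CHAR('k::field) = 2"
  shows "graded_algebra (kostant_grading :: nat \<Rightarrow> 'k kostant set) scal proj"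
proof
  show "(1 :: 'k kostant) \<noteq> 0"
    using coord_1[where 'k = 'k] by (metis coord_0 lookup_single_eq lookup_zero zero_neq_one)
  show "kostant_grading 0 = range (scal :: 'k \<Rightarrow> 'k kostant)"
  proof (intro set_eqI iffI)
    fix t :: "'k kostant" assume t: "t \<in> kostant_grading 0"
    have "t = scal (lookup (coord t) (0, 0, 0))"
    proof (rule coord_eqI)
      fix m :: expo
      have "wt m = 0 \<longleftrightarrow> m = (0, 0, 0)" by (cases m) auto
      then show "lookup (coord t) m =
          lookup (coord (scal (lookup (coord t) (0, 0, 0)) :: 'k kostant)) m"
        using t coord_scal[of "lookup (coord t) (0, 0, 0)" "1 :: 'k kostant" m]
        by (auto simp: kostant_grading_iff coord_1 lookup_single when_def)
    qed
    then show "t \<in> range scal" by blast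
  next
    fix t :: "'k kostant" assume "t \<in> range scal"
    then obtain r where "t = scal r * 1" by auto
    then show "t \<in> kostant_grading 0"
      by (auto simp only: kostant_grading_iff coord_scal coord_1 lookup_single when_def) (simp split: if_splits)
  qed
  show "finite {n. proj n a \<noteq> 0}" and "(\<Sum>n | proj n a \<noteq> 0. proj n a) = a" for a :: "'k kostant"
  proof -
    have *: "{n. proj n a \<noteq> 0} \<subseteq> wt ` keys (coord a)"
    proof
      fix n assume "n \<in> {n. proj n a \<noteq> 0}"
      then have "proj n a \<noteq> 0" by simp
      then obtain m where "lookup (coord (proj n a)) m \<noteq> 0"
        using coord_eqI[of "proj n a" 0] by auto
      then show "n \<in> wt ` keys (coord a)" by (auto simp: coord_proj in_keys_iff split: if_splits)
    qed
    then show fin: "finite {n. proj n a \<noteq> 0}" by (rule finite_subset) simp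
    show "(\<Sum>n | proj n a \<noteq> 0. proj n a) = a"
    proof (rule coord_eqI)
      fix m :: expo
      have "lookup (coord (\<Sum>n | proj n a \<noteq> 0. proj n a)) m =
          (\<Sum>n | proj n a \<noteq> 0. if n = wt m then lookup (coord a) m else 0)"
        unfolding coord_sum lookup_sum by (intro sum.cong refl) (auto simp: coord_proj)
      also have "\<dots> = lookup (coord a) m"
      proof (cases "proj (wt m) a = 0")
        case True
        then have "lookup (coord (proj (wt m) a)) m = 0" by simp
        then have z: "lookup (coord a) m = 0" by (simp add: coord_proj)
        show ?thesis unfolding z by simp
      qed (simp add: fin)
      finally show "lookup (coord (\<Sum>n | proj n a \<noteq> 0. proj n a)) m = lookup (coord a) m" .
    qed
  qed
  show "\<exists>E. countable E \<and> (\<forall>a :: 'k kostant. a \<in> group_closure {scal r * e | r e. e \<in> E})"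
  proof (intro exI[of _ "range mon"] conjI allI)
    show "countable (range mon :: 'k kostant set)" by (rule countable_image) simp
    fix a :: "'k kostant"
    have "from_coord (coord a) \<in> group_closure {scal r * e | r e. e \<in> range mon}"
      unfolding from_coord_def pm_sum_def by (intro group_closure_sum in_group_closure) blast
    then show "a \<in> group_closure {scal r * e | r e. e \<in> range mon}" by (simp add: from_coord_coord)
  qed
  show "proj n (a + b) = proj n a + proj n b" for n and a b :: "'k kostant"
    by (rule coord_eqI) (simp add: coord_proj coord_add lookup_add)
  show "proj n a \<in> kostant_grading n" for n and a :: "'k kostant"
    by (simp add: kostant_grading_iff coord_proj)
  show "proj n a = a" if "a \<in> kostant_grading n" for n and a :: "'k kostant"
    using that by (intro coord_eqI) (auto simp: coord_proj kostant_grading_iff)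
  show "proj m a = 0" if "a \<in> kostant_grading n" "m \<noteq> n" for m n and a :: "'k kostant"
    using that by (intro coord_eqI) (auto simp: coord_proj kostant_grading_iff)
qed (rule scal_simps scal_commute kostant_grading_mult[OF assms] | assumption)+

section \<open>The first two steps of the resolution\<close>

lemma proj_0_iff: "proj 0 t = 0 \<longleftrightarrow> lookup (coord t) (0, 0, 0) = 0"
proof
  assume "proj 0 t = 0"
  then show "lookup (coord t) (0, 0, 0) = 0"
    using coord_proj[of 0 t "(0, 0, 0)"] by simp
next
  assume *: "lookup (coord t) (0, 0, 0) = 0"
  show "proj 0 t = 0"
  proof (rule coord_eqI)
    fix m show "lookup (coord (proj 0 t)) m = lookup (coord 0) m"
      using * by (cases m) (auto simp: coord_proj)
  qed
qed

lemma coord_scal_mon: "lookup (coord (scal r * mon m)) m' = (if m = m' then r else 0)"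
  by (simp add: coord_single lookup_single when_def)

lemma lookup_coord_mon: "lookup (coord (mon m)) m' = (if m = m' then 1 else 0)"
  by (simp add: coord_mon lookup_single when_def)

lemma mon_in_grading: "mon m \<in> kostant_grading (wt m)"
  by (simp add: kostant_grading_iff lookup_coord_mon)

text \<open>The Kostant form over a field of characteristic two. The parameter only names the field.\<close>

locale kostant_char2 =
  fixes k_type :: "'k::field itself"
  assumes char2: "CHAR('k) = 2"
begin

sublocale A: graded_algebra "kostant_grading :: nat \<Rightarrow> 'k kostant set" scal proj
  by (rule graded_algebra_kostant[OF char2])

sublocale H: kostant2 "kX :: nat \<Rightarrow> 'k kostant" kY kZ scal
  by (rule kostant2_kostant[OF char2])

text \<open>The generators, indexed by \<open>2 * k\<close> and \<open>2 * k + 1\<close>.\<close>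

definition gen_exp :: "nat \<Rightarrow> expo" where
  "gen_exp j = (if even j then (0, 0, 2 ^ (j div 2)) else (0, 2 ^ (j div 2), 0))"

definition gen :: "nat \<Rightarrow> 'k kostant" where "gen j = mon (gen_exp j)"

definition \<delta>1 :: "nat \<Rightarrow> nat" where "\<delta>1 j = 2 ^ (j div 2)"

text \<open>The images in the zeroth term of the basis elements of the first term.\<close>

definition gen_elt :: "nat \<Rightarrow> nat \<Rightarrow>\<^sub>0 'k kostant" where "gen_elt j = gen j \<odot> A.unit 0"

text \<open>The augmentation, on the zeroth term of the resolution.\<close>

definition eps :: "(nat \<Rightarrow>\<^sub>0 'k kostant) \<Rightarrow> 'k" where
  "eps f = lookup (coord (lookup f 0)) (0, 0, 0)"

text \<open>The kernel of the augmentation.\<close>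

definition N0 :: "(nat \<Rightarrow>\<^sub>0 'k kostant) set" where
  "N0 = {f. keys f \<subseteq> {0} \<and> eps f = 0}"

text \<open>The kernel of the first map; the first term of the resolution has all natural numbers as
  indices.\<close>

definition N1 :: "(nat \<Rightarrow>\<^sub>0 'k kostant) set" where
  "N1 = {f. keys f \<subseteq> UNIV \<and> A.lin gen_elt f = 0}"

lemma gen_simps: "gen (2 * k) = kX (2 ^ k)" "gen (Suc (2 * k)) = kY (2 ^ k)"
  by (simp_all add: gen_def gen_exp_def mon_single)

lemma gen_exp_inject: "gen_exp i = gen_exp j \<longleftrightarrow> i = j"
proof
  assume *: "gen_exp i = gen_exp j"
  then have "even i \<longleftrightarrow> even j" by (auto simp: gen_exp_def split: if_splits)
  moreover from this * have "i div 2 = j div 2" by (auto simp: gen_exp_def split: if_splits)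
  ultimately show "i = j" by (metis even_two_times_div_two odd_two_times_div_two_succ)
qed simp

lemma wt_gen_exp: "wt (gen_exp j) = \<delta>1 j"
  by (simp add: gen_exp_def \<delta>1_def)

lemma gen_exp_power: "\<exists>k. gen_exp j = (0, 0, 2 ^ k) \<or> gen_exp j = (0, 2 ^ k, 0)"
  by (auto simp: gen_exp_def)

lemma lin_gen_elt: "A.lin gen_elt h = pm_sum (\<lambda>j a. a * gen j) h \<odot> A.unit 0"
  by (simp add: A.lin_def pm_sum_def gen_elt_def act_sum act_act)

lemma act_unit_eq_0: "a \<odot> A.unit i = 0 \<longleftrightarrow> a = 0"
  by (metis A.act_unit lookup_single_eq lookup_zero single_zero)

text \<open>The left ideal generated by the chosen generators. It turns out to be the augmentation
  ideal.\<close>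

definition left_ideal :: "'k kostant set" where
  "left_ideal = {pm_sum (\<lambda>j a. a * gen j) h | h. True}"

lemma left_ideal_diff: "s \<in> left_ideal \<Longrightarrow> t \<in> left_ideal \<Longrightarrow> s - t \<in> left_ideal"
proof -
  assume "s \<in> left_ideal" "t \<in> left_ideal"
  then obtain h h' where "s = pm_sum (\<lambda>j a. a * gen j) h" "t = pm_sum (\<lambda>j a. a * gen j) h'"
    by (auto simp: left_ideal_def)
  then have "s - t = pm_sum (\<lambda>j a. a * gen j) (h - h')" by (simp add: pm_sum_minus distrib_right)
  then show ?thesis by (auto simp: left_ideal_def)
qed

lemma left_ideal_mult: "t \<in> left_ideal \<Longrightarrow> a * t \<in> left_ideal"
proof -
  assume "t \<in> left_ideal"
  then obtain h where "t = pm_sum (\<lambda>j a. a * gen j) h" by (auto simp: left_ideal_def)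
  then have "a * t = pm_sum (\<lambda>j a. a * gen j) (a \<odot> h)"
    by (subst pm_sum_superset[of "keys h"])
      (auto simp: A.keys_act pm_sum_def sum_distrib_left mult.assoc)
  then show ?thesis by (auto simp: left_ideal_def)
qed

lemma left_ideal_gen: "gen j \<in> left_ideal"
proof -
  have "gen j = pm_sum (\<lambda>j a. a * gen j) (A.unit j)" by (simp add: A.unit_def pm_sum_single)
  then show ?thesis by (auto simp: left_ideal_def)
qed

lemma left_ideal_0: "0 \<in> left_ideal"
  using left_ideal_diff[OF left_ideal_gen[of 0] left_ideal_gen[of 0]] by simp

lemma left_ideal_add: "s \<in> left_ideal \<Longrightarrow> t \<in> left_ideal \<Longrightarrow> s + t \<in> left_ideal"
  using left_ideal_diff[of s "0 - t"] left_ideal_diff[of 0 t] left_ideal_0 by simp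

lemma left_ideal_sum: "(\<And>s. s \<in> S \<Longrightarrow> f s \<in> left_ideal) \<Longrightarrow> sum f S \<in> left_ideal"
  by (induction S rule: infinite_finite_induct) (auto intro: left_ideal_0 left_ideal_add)

lemma left_ideal_powers: "kX (2 ^ k) \<in> left_ideal" "kY (2 ^ k) \<in> left_ideal"
  using left_ideal_gen[of "2 * k"] left_ideal_gen[of "Suc (2 * k)"] by (simp_all only: gen_simps)

lemma left_ideal_X: "a \<noteq> 0 \<Longrightarrow> kX a \<in> left_ideal"
  using divided_powers.D_split[OF H.X some_bit[of a]] left_ideal_mult left_ideal_powers(1) by simp

lemma left_ideal_Y: "b \<noteq> 0 \<Longrightarrow> kY b \<in> left_ideal"
  using divided_powers.D_split[OF H.Y some_bit[of b]] left_ideal_mult left_ideal_powers(2) by simp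

lemma left_ideal_Z: "c \<noteq> 0 \<Longrightarrow> kZ c \<in> left_ideal"
proof -
  have pow: "kZ (2 ^ i) \<in> left_ideal" for i
  proof -
    let ?n = "2 ^ i :: nat"
    have "{..?n} = insert ?n {..<?n}" by auto
    then have "kX ?n * kY ?n = kZ ?n + (\<Sum>j<?n. kZ j * kY (?n - j) * (kX (?n - j) :: 'k kostant))"
      by (simp add: H.XY H.zero_simps)
    then have "kZ ?n = kX ?n * kY ?n - (\<Sum>j<?n. kZ j * kY (?n - j) * (kX (?n - j) :: 'k kostant))"
      by simp
    moreover have "kX ?n * kY ?n \<in> left_ideal" by (intro left_ideal_mult left_ideal_powers)
    moreover have "(\<Sum>j<?n. kZ j * kY (?n - j) * (kX (?n - j) :: 'k kostant)) \<in> left_ideal"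
      by (intro left_ideal_sum left_ideal_mult left_ideal_X) simp
    ultimately show ?thesis by (simp only: left_ideal_diff)
  qed
  assume "c \<noteq> 0"
  then have "kZ c = kZ (c - 2 ^ some_bit c) * (kZ (2 ^ some_bit c) :: 'k kostant)"
    using divided_powers.D_split[OF H.Z some_bit[of c]] by simp
  then show ?thesis by (rule ssubst) (rule left_ideal_mult[OF pow])
qed

lemma left_ideal_eq: "t \<in> left_ideal \<longleftrightarrow> lookup (coord t) (0, 0, 0) = 0"
proof
  assume "t \<in> left_ideal"
  then obtain h where t: "t = pm_sum (\<lambda>j a. a * gen j) h" by (auto simp: left_ideal_def)
  have "proj 0 (gen j) = 0" for j
    unfolding proj_0_iff gen_def lookup_coord_mon by (auto simp: gen_exp_def)
  then have "proj 0 t = 0" unfolding t pm_sum_def A.pr_of_sum by (simp add: A.pr_0_mult)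
  then show "lookup (coord t) (0, 0, 0) = 0" by (simp add: proj_0_iff)
next
  assume *: "lookup (coord t) (0, 0, 0) = 0"
  have "from_coord (coord t) \<in> left_ideal"
    unfolding from_coord_def pm_sum_def
  proof (intro left_ideal_sum left_ideal_mult)
    fix m assume "m \<in> keys (coord t)"
    with * have "m \<noteq> (0, 0, 0)" by (auto simp: in_keys_iff)
    then show "mon m \<in> left_ideal"
    proof (cases m)
      case (fields c b a)
      consider "a \<noteq> 0" | "a = 0" "b \<noteq> 0" | "a = 0" "b = 0" "c \<noteq> 0" using \<open>m \<noteq> (0, 0, 0)\<close> fields by auto
      then show ?thesis unfolding fields mon_eq
      proof cases
        case 1
        then show "kZ c * kY b * kX a \<in> left_ideal" by (intro left_ideal_mult left_ideal_X)
      next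
        case 2
        then have "kZ c * kY b * kX a = kZ c * (kY b :: 'k kostant)" by (simp add: H.zero_simps)
        with 2 show "kZ c * kY b * kX a \<in> left_ideal" by (simp add: left_ideal_mult left_ideal_Y)
      next
        case 3
        then have "kZ c * kY b * kX a = (kZ c :: 'k kostant)" by (simp add: H.zero_simps)
        with 3 show "kZ c * kY b * kX a \<in> left_ideal" by (simp add: left_ideal_Z)
      qed
    qed
  qed
  then show "t \<in> left_ideal" by (simp add: from_coord_coord)
qed

lemma single_0_eq: "keys f \<subseteq> {0} \<Longrightarrow> f = lookup f 0 \<odot> A.unit (0 :: nat)"
  by (rule poly_mapping_eqI) (auto simp: A.lookup_unit in_keys_iff)

text \<open>Decomposable elements have no coefficient at the exponents of the generators.\<close>

lemma decomposables_coeff: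
  fixes \<delta> :: "nat \<Rightarrow> nat"
  assumes N: "\<And>y i. y \<in> N \<Longrightarrow> lookup (coord (lookup y i)) (0, 0, 0) = 0"
    and f: "f \<in> A.decomposables \<delta> N n"
  shows "lookup (coord (lookup f i)) (gen_exp j) = 0"
  using f unfolding A.decomposables_def
proof (induction rule: group_closure.induct)
  case (base s)
  then consider "s = 0" | a y d where "s = a \<odot> y" "1 \<le> d" "a \<in> kostant_grading d" "y \<in> N" by auto
  then show ?case
  proof cases
    case 2
    have "lookup (coord a) (0, 0, 0) = 0"
      using 2 unfolding kostant_grading_iff by (metis wt.simps add.right_neutral mult_0_right not_one_le_zero)
    moreover obtain k where "gen_exp j = (0, 0, 2 ^ k) \<or> gen_exp j = (0, 2 ^ k, 0)" using gen_exp_power by blast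
    ultimately show ?thesis using N[OF 2(4)] 2(1) by (simp add: coord_mult_power[OF char2])
  qed simp
qed (simp add: lookup_minus coord_minus)

lemma minimal_generators_0: "A.minimal_generators (\<lambda>_. 0) N0 UNIV \<delta>1 gen_elt"
  unfolding A.minimal_generators_def
proof (intro conjI ballI allI impI)
  fix j :: nat
  have "gen j \<in> left_ideal" by (rule left_ideal_gen)
  then show "gen_elt j \<in> N0"
    by (simp add: N0_def eps_def gen_elt_def left_ideal_eq A.lookup_unit A.act_unit)
  have "gen j \<in> kostant_grading (\<delta>1 j)" unfolding gen_def wt_gen_exp[symmetric] by (rule mon_in_grading)
  then show "A.prF (\<lambda>_. 0) (\<delta>1 j) (gen_elt j) = gen_elt j"
    by (intro poly_mapping_eqI) (auto simp: A.lookup_prF gen_elt_def A.lookup_unit A.pr_same)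
next
  fix f assume f: "f \<in> N0"
  then have "lookup f 0 \<in> left_ideal" by (simp add: N0_def eps_def left_ideal_eq)
  then obtain h where "lookup f 0 = pm_sum (\<lambda>j a. a * gen j) h" by (auto simp: left_ideal_def)
  then have "A.lin gen_elt h = f" using single_0_eq[of f] f by (simp add: lin_gen_elt N0_def)
  then show "\<exists>h. keys h \<subseteq> UNIV \<and> A.lin gen_elt h = f" by blast
next
  fix n h
  assume h: "keys h \<subseteq> {j\<in>UNIV. \<delta>1 j = n} \<and> (\<forall>j. lookup h j \<in> range scal) \<and>
    A.lin gen_elt h \<in> A.decomposables (\<lambda>_. 0) N0 n"
  have "\<forall>j. \<exists>r. lookup h j = scal r"
  proof
    fix j
    have "lookup h j \<in> range scal" using h by blast
    then show "\<exists>r. lookup h j = scal r" by blast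
  qed
  from choice[OF this] obtain r where r: "\<And>j. lookup h j = scal (r j)" by blast
  have N: "lookup (coord (lookup y i)) (0, 0, 0) = 0" if "y \<in> N0" for y i
  proof (cases "i = 0")
    case True
    with that show ?thesis by (simp add: N0_def eps_def)
  next
    case False
    with that have "i \<notin> keys y" by (auto simp: N0_def)
    then show ?thesis by (simp add: in_keys_iff)
  qed
  have r_0: "r j = 0" if "j \<in> keys h" for j
  proof -
    have "0 = lookup (coord (lookup (A.lin gen_elt h) 0)) (gen_exp j)"
      using decomposables_coeff[OF N, of _ "A.lin gen_elt h" "\<lambda>_. 0" n 0 j] h by simp
    also have "lookup (A.lin gen_elt h) 0 = (\<Sum>i\<in>keys h. scal (r i) * mon (gen_exp i))"
      by (simp add: lin_gen_elt A.lookup_unit pm_sum_def r gen_def)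
    also have "lookup (coord \<dots>) (gen_exp j) = (\<Sum>i\<in>keys h. if i = j then r j else 0)"
      unfolding coord_sum lookup_sum by (intro sum.cong refl) (auto simp: coord_scal_mon gen_exp_inject)
    also have "\<dots> = r j" using that by simp
    finally show ?thesis by simp
  qed
  have "lookup h j = 0" for j
  proof (cases "j \<in> keys h")
    case True
    show ?thesis unfolding r r_0[OF True] by (rule scal_simps)
  qed (simp add: in_keys_iff)
  then show "h = 0" by (intro poly_mapping_eqI) simp
qed

lemma N1_positive: "f \<in> N1 \<Longrightarrow> lookup (coord (lookup f i)) (0, 0, 0) = 0"
  using A.minimal_kernel[OF minimal_generators_0, of f i] by (simp add: N1_def proj_0_iff)

text \<open>The basis elements of the first term over \<open>kX (2 ^ k)\<close> and \<open>kY (2 ^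
  k)\<close>.\<close>

abbreviation xx :: "nat \<Rightarrow> nat \<Rightarrow>\<^sub>0 'k kostant" where "xx k \<equiv> A.unit (2 * k)"
abbreviation yy :: "nat \<Rightarrow> nat \<Rightarrow>\<^sub>0 'k kostant" where "yy k \<equiv> A.unit (Suc (2 * k))"

text \<open>The standard lifts of the basis monomials.\<close>

fun std :: "nat \<times> nat \<times> nat \<Rightarrow> nat \<Rightarrow>\<^sub>0 'k kostant" where
  "std (c, b, a) =
      (if a \<noteq> 0 then kZ c \<odot> kY b \<odot> divided_lift kX xx a else if b \<noteq> 0 then kZ c \<odot> divided_lift kY yy b
       else kX c \<odot> divided_lift kY yy c)"

text \<open>The relations. The first component distinguishes commutators of two \<open>kX\<close>, of two
  \<open>kY\<close>, and of \<open>kX (2 ^ k)\<close> with \<open>kY (2 ^ l)\<close>; for \<open>k = l\<close>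
  the first two become squares.\<close>

fun rel :: "nat \<times> nat \<times> nat \<Rightarrow> nat \<Rightarrow>\<^sub>0 'k kostant" where
  "rel (t, k, l) =
     (if t = 0 then if k = l then kX (2 ^ k) \<odot> xx k else kX (2 ^ k) \<odot> xx l - kX (2 ^ l) \<odot> xx k
      else if t = 1 then if k = l then kY (2 ^ k) \<odot> yy k else kY (2 ^ k) \<odot> yy l - kY (2 ^ l) \<odot> yy k
      else kX (2 ^ k) \<odot> yy l - (\<Sum>j\<le>min (2 ^ k) (2 ^ l). std (j, 2 ^ l - j, 2 ^ k - j)))"

text \<open>The indices of the relations that are used.\<close>

definition rel_index :: "(nat \<times> nat \<times> nat) set" where
  "rel_index = {(t, k, l). t < 2 \<and> k \<le> l \<or> t = 2 \<and> k \<noteq> l}"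

text \<open>The same indices encoded as natural numbers, and the relations and their degrees as functions of
  the code.\<close>

definition rel_codes :: "nat set" where "rel_codes = to_nat ` rel_index"

definition rel_elt :: "nat \<Rightarrow> nat \<Rightarrow>\<^sub>0 'k kostant" where "rel_elt j = rel (from_nat j)"

definition \<delta>2 :: "nat \<Rightarrow> nat" where "\<delta>2 j = (case from_nat j of (t :: nat, k, l) \<Rightarrow> 2 ^ k + 2 ^ l)"

lemma lin_gen_elt_unit: "A.lin gen_elt (a \<odot> A.unit j) = (a * gen j) \<odot> A.unit 0"
  by (simp add: A.lin_act A.lin_unit gen_elt_def act_act)

lemma lin_gen_elt_divided_lift:
  "a \<noteq> 0 \<Longrightarrow> A.lin gen_elt (divided_lift kX xx a) = kX a \<odot> A.unit 0"
  "a \<noteq> 0 \<Longrightarrow> A.lin gen_elt (divided_lift kY yy a) = kY a \<odot> A.unit 0"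
  unfolding divided_lift_def lin_gen_elt_unit gen_simps
  using divided_powers.D_split[OF H.X some_bit[of a]] divided_powers.D_split[OF H.Y some_bit[of a]] by simp_all

lemma lin_gen_elt_std:
  "a \<noteq> 0 \<or> b \<noteq> 0 \<Longrightarrow> A.lin gen_elt (std (c, b, a)) = mon (c, b, a) \<odot> A.unit 0"
  "c \<noteq> 0 \<Longrightarrow> A.lin gen_elt (std (c, 0, 0)) = (kX c * kY c) \<odot> A.unit 0"
  by (auto simp: A.lin_act lin_gen_elt_divided_lift act_act mon_eq H.zero_simps mult.assoc)

lemma lin_gen_elt_rel:
  assumes "m \<in> rel_index" shows "A.lin gen_elt (rel m) = 0"
proof -
  obtain t k l where m: "m = (t, k, l)" by (cases m)
  have same: "D (2 ^ k) * D (2 ^ k) = (0 :: 'k kostant)" "D (2 ^ k) * D (2 ^ l) = D (2 ^ l) * D (2 ^ k)"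
    if "divided_powers D" for D
    using divided_powers.D_mult[OF that, of "2 ^ k" "2 ^ k"] divided_powers.D_commute[OF that]
    by (auto simp: odd_choose_add_iff)
  consider "t = 0" | "t = 1" | "t = 2" "k \<noteq> l" using assms by (auto simp: m rel_index_def less_2_cases_iff)
  then show ?thesis
  proof cases
    case 1
    then show ?thesis using same[OF H.X]
      by (auto simp: m A.lin_simps lin_gen_elt_unit gen_simps act_simps)
  next
    case 2
    then show ?thesis using same[OF H.Y]
      by (auto simp: m A.lin_simps lin_gen_elt_unit gen_simps act_simps)
  next
    case 3
    have "A.lin gen_elt (\<Sum>j\<le>min (2 ^ k) (2 ^ l). std (j, 2 ^ l - j, 2 ^ k - j)) =
        (\<Sum>j\<le>min (2 ^ k) (2 ^ l). mon (j, 2 ^ l - j, 2 ^ k - j) \<odot> A.unit 0)"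
      unfolding A.lin_sum
    proof (intro sum.cong refl lin_gen_elt_std)
      fix j :: nat assume j: "j \<in> {..min (2 ^ k) (2 ^ l)}"
      have "(2 ^ k :: nat) \<noteq> 2 ^ l" using 3 by simp
      with j show "2 ^ k - j \<noteq> 0 \<or> 2 ^ l - j \<noteq> 0" by auto
    qed
    also have "\<dots> = (kX (2 ^ k) * kY (2 ^ l)) \<odot> A.unit 0" by (simp add: H.XY mon_eq act_sum)
    finally show ?thesis using 3 by (simp add: m A.lin_simps lin_gen_elt_unit gen_simps del: std.simps)
  qed
qed

text \<open>The submodule generated by the relations.\<close>

definition rel_module :: "(nat \<Rightarrow>\<^sub>0 'k kostant) set" where
  "rel_module = {A.lin rel_elt h | h. keys h \<subseteq> rel_codes}"

lemma rel_rel_module: "m \<in> rel_index \<Longrightarrow> rel m \<in> rel_module"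
  unfolding rel_module_def
  by (intro CollectI exI[of _ "A.unit (to_nat m)"]) (simp add: A.lin_unit A.keys_unit rel_codes_def rel_elt_def)

lemma submodule_rel_module: "submodule rel_module"
proof
  show "0 \<in> rel_module" unfolding rel_module_def by (intro CollectI exI[of _ 0]) (simp add: A.lin_simps)
  show "u - v \<in> rel_module" if "u \<in> rel_module" "v \<in> rel_module" for u v
  proof -
    from that obtain h h' where "keys h \<subseteq> rel_codes" "keys h' \<subseteq> rel_codes" "u = A.lin rel_elt h" "v = A.lin rel_elt h'"
      by (auto simp: rel_module_def)
    then show ?thesis unfolding rel_module_def
      by (intro CollectI exI[of _ "h - h'"]) (simp add: A.lin_simps A.keys_diff_subset)
  qed
  show "a \<odot> u \<in> rel_module" if "u \<in> rel_module" for u a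
  proof -
    from that obtain h where "keys h \<subseteq> rel_codes" "u = A.lin rel_elt h" by (auto simp: rel_module_def)
    then show ?thesis unfolding rel_module_def
      using A.keys_act[of a h] by (intro CollectI exI[of _ "a \<odot> h"]) (simp add: A.lin_act)
  qed
qed

sublocale R: submodule rel_module by (rule submodule_rel_module)

lemma divided_syzygy_rel_module: "divided_syzygy kX rel_module xx" "divided_syzygy kY rel_module yy"
proof -
  have x: "R.cgr (kX (2 ^ k) \<odot> xx l) (kX (2 ^ l) \<odot> xx k)" if "k < l" for k l
    using rel_rel_module[of "(0, k, l)"] that by (simp add: R.cgr_def rel_index_def)
  have y: "R.cgr (kY (2 ^ k) \<odot> yy l) (kY (2 ^ l) \<odot> yy k)" if "k < l" for k l
    using rel_rel_module[of "(1, k, l)"] that by (simp add: R.cgr_def rel_index_def)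
  show "divided_syzygy kX rel_module xx"
  proof (intro divided_syzygy.intro divided_syzygy_axioms.intro H.X submodule_rel_module)
    show "R.cgr (kX (2 ^ k) \<odot> xx k) 0" for k
      using rel_rel_module[of "(0, k, k)"] by (simp add: R.cgr_def rel_index_def)
    show "R.cgr (kX (2 ^ k) \<odot> xx l) (kX (2 ^ l) \<odot> xx k)" for k l
      using x[of k l] R.cgr_sym[OF x[of l k]] by (cases k l rule: linorder_cases) auto
  qed
  show "divided_syzygy kY rel_module yy"
  proof (intro divided_syzygy.intro divided_syzygy_axioms.intro H.Y submodule_rel_module)
    show "R.cgr (kY (2 ^ k) \<odot> yy k) 0" for k
      using rel_rel_module[of "(1, k, k)"] by (simp add: R.cgr_def rel_index_def)
    show "R.cgr (kY (2 ^ k) \<odot> yy l) (kY (2 ^ l) \<odot> yy k)" for k l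
      using y[of k l] R.cgr_sym[OF y[of l k]] by (cases k l rule: linorder_cases) auto
  qed
qed

sublocale P: kostant2_presentation "kX :: nat \<Rightarrow> 'k kostant" kY kZ scal rel_module xx yy std
proof (intro kostant2_presentation.intro kostant2_presentation_axioms.intro H.kostant2_axioms submodule_rel_module
    divided_syzygy_rel_module)
  show "std (c, b, a) = (if a \<noteq> 0 then kZ c \<odot> kY b \<odot> divided_lift kX xx a else if b \<noteq> 0 then kZ c \<odot> divided_lift kY yy b
       else kX c \<odot> divided_lift kY yy c)" for a b c by simp
  show "R.cgr (kX (2 ^ k) \<odot> yy l) (\<Sum>j\<le>min (2 ^ k) (2 ^ l). std (j, 2 ^ l - j, 2 ^ k - j))" if "k \<noteq> l" for k l
    using rel_rel_module[of "(2, k, l)"] that by (simp add: R.cgr_def rel_index_def del: std.simps)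
qed

text \<open>Every element of the first term is the sum of a relation and a linear combination of standard
  lifts.\<close>

lemma generated_normal_form:
  "\<exists>u\<in>rel_module. \<exists>p. lookup p (0, 0, 0) = 0 \<and> f = u + pm_sum (\<lambda>m r. scal r \<odot> std m) p"
proof -
  have "a \<odot> A.unit i \<in> P.L2" for a i
  proof (cases "even i")
    case True
    then obtain k where "i = 2 * k" by blast
    then show ?thesis using P.spanning(1)[of a k] by simp
  next
    case False
    then obtain k where "i = Suc (2 * k)" by (metis oddE Suc_eq_plus1)
    then show ?thesis using P.spanning(2)[of a k] by simp
  qed
  then have "pm_sum (\<lambda>i a. a \<odot> A.unit i) f \<in> group_closure P.E2"
    unfolding pm_sum_def P.L2_def by (intro group_closure_sum)
  then have "f \<in> group_closure P.E2" by (simp add: A.sum_units)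
  then show ?thesis
  proof (induction rule: group_closure.induct)
    case (base s)
    then consider "s \<in> rel_module" | r m where "s = scal r \<odot> std m" "m \<noteq> (0, 0, 0)"
      using R.zero_in by (auto simp: P.E2_def)
    then show ?case
    proof cases
      case 1
      then show ?thesis by (intro bexI[of _ s] exI[of _ 0]) simp_all
    next
      case 2
      then show ?thesis
        by (intro bexI[of _ 0] exI[of _ "Poly_Mapping.single m r"])
          (simp_all add: R.zero_in pm_sum_single scal_simps act_simps lookup_single when_def)
    qed
  next
    case (diff s t)
    from diff.IH(1) obtain u p where 1: "u \<in> rel_module" "lookup p (0, 0, 0) = 0"
      "s = u + pm_sum (\<lambda>m r. scal r \<odot> std m) p" by blast
    from diff.IH(2) obtain v q where 2: "v \<in> rel_module" "lookup q (0, 0, 0) = 0"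
      "t = v + pm_sum (\<lambda>m r. scal r \<odot> std m) q" by blast
    have "pm_sum (\<lambda>m r. scal r \<odot> std m) (p - q) = pm_sum (\<lambda>m r. scal r \<odot> std m) p - pm_sum (\<lambda>m r. scal r \<odot> std m) q"
      by (rule pm_sum_minus) (simp add: scal_simps act_simps)
    with 1 2 show ?case
      by (intro bexI[of _ "u - v"] exI[of _ "p - q"]) (simp_all add: lookup_minus R.diff_in)
  qed
qed

text \<open>The values of the standard lifts under the first map.\<close>

definition std_value :: "expo \<Rightarrow> 'k kostant" where
  "std_value = (\<lambda>(c, b, a). if a \<noteq> 0 \<or> b \<noteq> 0 then mon (c, b, a) else kX c * kY c)"

lemma coord_XY_diag: "lookup (coord (kX c * kY c :: 'k kostant)) (c', 0, 0) = (if c = c' then 1 else 0)"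
proof -
  have "lookup (coord (kX c * kY c :: 'k kostant)) (c', 0, 0) =
      (\<Sum>j\<le>c. lookup (coord (mon (j, c - j, c - j) :: 'k kostant)) (c', 0, 0))"
    by (simp add: H.XY mon_eq coord_sum lookup_sum)
  also have "\<dots> = (\<Sum>j\<le>c. if j = c then if c = c' then 1 else 0 else 0)"
    by (intro sum.cong refl) (auto simp: lookup_coord_mon)
  finally show ?thesis by simp
qed

text \<open>The value for \<open>(c, 0, 0)\<close> is the only one with a term \<open>kZ c\<close>; the others
  are distinct basis monomials.\<close>

lemma std_value_independent:
  assumes "pm_sum (\<lambda>m r. scal r * std_value m) p = 0"
  shows "p = 0"
proof -
  let ?coord = "\<lambda>t m. lookup (coord t) m"
  have sum: "(\<Sum>m\<in>keys p. lookup p m * ?coord (std_value m) m') = 0" for m'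
    using assms by (metis (mono_tags, lifting) coord_0 coord_scal coord_sum lookup_sum lookup_zero pm_sum_def sum.cong)
  have diag: "lookup p (c, 0, 0) = 0" for c
  proof -
    have "(\<Sum>m\<in>keys p. lookup p m * ?coord (std_value m) (c, 0, 0)) =
        (\<Sum>m\<in>keys p. if m = (c, 0, 0) then lookup p (c, 0, 0) else 0)"
      by (intro sum.cong refl) (auto simp: std_value_def lookup_coord_mon coord_XY_diag split: prod.splits)
    with sum[of "(c, 0, 0)"] show ?thesis by (auto simp: in_keys_iff split: if_splits)
  qed
  show "p = 0"
  proof (rule poly_mapping_eqI)
    fix m' :: expo
    obtain c b a where m': "m' = (c, b, a)" by (cases m')
    show "lookup p m' = lookup 0 m'"
    proof (cases "a \<noteq> 0 \<or> b \<noteq> 0")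
      case True
      have "(\<Sum>m\<in>keys p. lookup p m * ?coord (std_value m) m') =
          (\<Sum>m\<in>keys p. if m = m' then lookup p m' else 0)"
      proof (intro sum.cong refl)
        fix m assume "m \<in> keys p"
        then have "m \<noteq> (c, 0, 0)" for c using diag[of c] by (auto simp: in_keys_iff)
        then show "lookup p m * ?coord (std_value m) m' = (if m = m' then lookup p m' else 0)"
          by (cases m) (auto simp: std_value_def lookup_coord_mon)
      qed
      with sum[of m'] show ?thesis by (auto simp: in_keys_iff split: if_splits)
    qed (use diag m' in auto)
  qed
qed

text \<open>Since the standard lifts have independent values, an element of the kernel is equal to its part in
  the relations.\<close>

lemma N1_generated: "f \<in> N1 \<Longrightarrow> f \<in> rel_module"
proof -
  assume f: "f \<in> N1"
  obtain u p where up: "u \<in> rel_module" "lookup p (0, 0, 0) = 0" "f = u + pm_sum (\<lambda>m r. scal r \<odot> std m) p"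
    using generated_normal_form by blast
  have lin_u: "A.lin gen_elt u = 0"
  proof -
    obtain h where h: "u = A.lin rel_elt h" "keys h \<subseteq> rel_codes" using up(1) by (auto simp: rel_module_def)
    have "A.lin gen_elt (rel_elt j) = 0" if "j \<in> rel_codes" for j
      using that lin_gen_elt_rel by (auto simp: rel_codes_def rel_elt_def simp del: rel.simps)
    then show ?thesis
      using h(2) unfolding h(1) A.lin_def[of rel_elt] pm_sum_def A.lin_sum by (intro sum.neutral) (auto simp: A.lin_act act_simps)
  qed
  have "A.lin gen_elt (std m) = std_value m \<odot> A.unit 0" if "m \<in> keys p" for m
  proof -
    obtain c b a where m: "m = (c, b, a)" by (cases m)
    have "m \<noteq> (0, 0, 0)" using that up(2) by (auto simp: in_keys_iff)
    then show ?thesis using lin_gen_elt_std(1)[of a b c] lin_gen_elt_std(2)[of c] unfolding m std_value_def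
      by (cases "a \<noteq> 0 \<or> b \<noteq> 0") (auto simp del: std.simps)
  qed
  then have "A.lin gen_elt (pm_sum (\<lambda>m r. scal r \<odot> std m) p) = pm_sum (\<lambda>m r. scal r * std_value m) p \<odot> A.unit 0"
    by (simp add: pm_sum_def A.lin_sum A.lin_act act_sum act_act)
  moreover have "A.lin gen_elt (pm_sum (\<lambda>m r. scal r \<odot> std m) p) = 0"
    using f lin_u by (simp add: up(3) N1_def A.lin_simps)
  ultimately have "p = 0" using std_value_independent by (simp add: act_unit_eq_0)
  with up show "f \<in> rel_module" by simp
qed

lemma homogeneous_act:
  "a \<in> kostant_grading d \<Longrightarrow> A.prF \<delta>1 n f = f \<Longrightarrow> A.prF \<delta>1 (d + n) (a \<odot> f) = a \<odot> f"
  by (simp add: A.prF_act_left)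

lemma homogeneous_unit: "A.prF \<delta>1 (\<delta>1 i) (A.unit i) = A.unit i"
proof (rule poly_mapping_eqI)
  have "(1 :: 'k kostant) \<in> kostant_grading 0" 
    using mon_in_grading[where 'a = 'k and m = "(0, 0, 0)"] by (simp add: mon_eq kXYZ_0)
  then show "lookup (A.prF \<delta>1 (\<delta>1 i) (A.unit i)) j = lookup (A.unit i) j" for j
    by (auto simp: A.lookup_prF A.lookup_unit A.pr_same)
qed

lemma kXYZ_grading: "kX a \<in> kostant_grading a" "kY b \<in> kostant_grading b" "kZ c \<in> kostant_grading (2 * c)"
  using mon_in_grading[of "(0, 0, a)"] mon_in_grading[of "(0, b, 0)"] mon_in_grading[of "(c, 0, 0)"]
  by (simp_all add: mon_single)

lemma homogeneous_divided_lift: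
  "a \<noteq> 0 \<Longrightarrow> A.prF \<delta>1 a (divided_lift kX xx a) = divided_lift kX xx a"
  "a \<noteq> 0 \<Longrightarrow> A.prF \<delta>1 a (divided_lift kY yy a) = divided_lift kY yy a"
proof -
  assume "a \<noteq> 0"
  then have le: "2 ^ some_bit a \<le> a" by (intro bit_minus_power some_bit)
  have "\<delta>1 (2 * some_bit a) = 2 ^ some_bit a" "\<delta>1 (Suc (2 * some_bit a)) = 2 ^ some_bit a" by (simp_all add: \<delta>1_def)
  with le homogeneous_act[OF kXYZ_grading(1) homogeneous_unit, of "a - 2 ^ some_bit a" "2 * some_bit a"]
    homogeneous_act[OF kXYZ_grading(2) homogeneous_unit, of "a - 2 ^ some_bit a" "Suc (2 * some_bit a)"]
  show "A.prF \<delta>1 a (divided_lift kX xx a) = divided_lift kX xx a" "A.prF \<delta>1 a (divided_lift kY yy a) = divided_lift kY yy a"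
    by (simp_all add: divided_lift_def)
qed

lemma homogeneous_std:
  assumes "(c, b, a) \<noteq> (0, 0, 0)" shows "A.prF \<delta>1 (a + b + 2 * c) (std (c, b, a)) = std (c, b, a)"
proof -
  consider "a \<noteq> 0" | "a = 0" "b \<noteq> 0" | "a = 0" "b = 0" "c \<noteq> 0" using assms by auto
  then show ?thesis
  proof cases
    case 1
    have "2 * c + (b + a) = a + b + 2 * c" by simp
    with 1 homogeneous_act[OF kXYZ_grading(3) homogeneous_act[OF kXYZ_grading(2) homogeneous_divided_lift(1)], of a c b]
    show ?thesis by simp
  next
    case 2
    have "2 * c + b = a + b + 2 * c" using 2 by simp
    with 2 homogeneous_act[OF kXYZ_grading(3) homogeneous_divided_lift(2), of b c] show ?thesis by simp
  next
    case 3
    have "c + c = a + b + 2 * c" using 3 by simp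
    with 3 homogeneous_act[OF kXYZ_grading(1) homogeneous_divided_lift(2), of c c] show ?thesis by simp
  qed
qed

lemma homogeneous_rel:
  assumes "(t, k, l) \<in> rel_index" shows "A.prF \<delta>1 (2 ^ k + 2 ^ l) (rel (t, k, l)) = rel (t, k, l)"
proof -
  have d: "\<delta>1 (2 * i) = 2 ^ i" "\<delta>1 (Suc (2 * i)) = 2 ^ i" for i by (simp_all add: \<delta>1_def)
  have X: "A.prF \<delta>1 (2 ^ k + 2 ^ l) (kX (2 ^ k) \<odot> xx l) = kX (2 ^ k) \<odot> xx l"
    "A.prF \<delta>1 (2 ^ k + 2 ^ l) (kX (2 ^ k) \<odot> yy l) = kX (2 ^ k) \<odot> yy l"
    "A.prF \<delta>1 (2 ^ k + 2 ^ l) (kY (2 ^ k) \<odot> yy l) = kY (2 ^ k) \<odot> yy l" for k l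
    using homogeneous_act[OF kXYZ_grading(1) homogeneous_unit, of "2 ^ k" "2 * l"]
      homogeneous_act[OF kXYZ_grading(1) homogeneous_unit, of "2 ^ k" "Suc (2 * l)"]
      homogeneous_act[OF kXYZ_grading(2) homogeneous_unit, of "2 ^ k" "Suc (2 * l)"] by (simp_all add: d)
  consider "t = 0" | "t = 1" | "t = 2" "k \<noteq> l" using assms by (auto simp: rel_index_def less_2_cases_iff)
  then show ?thesis
  proof cases
    case 1
    then show ?thesis using X(1)[of k l] X(1)[of l k] by (auto simp: A.prF_simps add.commute)
  next
    case 2
    then show ?thesis using X(3)[of k l] X(3)[of l k] by (auto simp: A.prF_simps add.commute)
  next
    case 3
    have "A.prF \<delta>1 (2 ^ k + 2 ^ l) (\<Sum>j\<le>min (2 ^ k) (2 ^ l). std (j, 2 ^ l - j, 2 ^ k - j)) =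
        (\<Sum>j\<le>min (2 ^ k) (2 ^ l). std (j, 2 ^ l - j, 2 ^ k - j))"
      unfolding A.prF_sum
    proof (intro sum.cong refl)
      fix j :: nat assume j: "j \<in> {..min (2 ^ k) (2 ^ l)}"
      have "(2 ^ k :: nat) \<noteq> 2 ^ l" using 3 by simp
      with j have "(j, 2 ^ l - j, 2 ^ k - j) \<noteq> (0, 0, 0)" by auto
      moreover have "2 ^ k - j + (2 ^ l - j) + 2 * j = 2 ^ k + 2 ^ l" using j by auto
      ultimately show "A.prF \<delta>1 (2 ^ k + 2 ^ l) (std (j, 2 ^ l - j, 2 ^ k - j)) = std (j, 2 ^ l - j, 2 ^ k - j)"
        using homogeneous_std by metis
    qed
    with 3 show ?thesis by (simp add: A.prF_simps X del: std.simps)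
  qed
qed

text \<open>The coefficient functionals dual to the relations.\<close>

definition dual :: "nat \<times> nat \<times> nat \<Rightarrow> (nat \<Rightarrow>\<^sub>0 'k kostant) \<Rightarrow> 'k" where
  "dual = (\<lambda>(t, k, l) f. lookup (coord (lookup f (if t = 0 then 2 * l else Suc (2 * l))))
     (if t = 1 then (0, 2 ^ k, 0) else (0, 0, 2 ^ k)))"

lemma dual_linear: "dual m (f + g) = dual m f + dual m g" "dual m (f - g) = dual m f - dual m g" "dual m 0 = 0"
  "dual m (scal r \<odot> f) = r * dual m f"
  by (cases m; simp add: dual_def lookup_add lookup_minus coord_add coord_minus coord_scal)+

lemma dual_sum: "dual m (\<Sum>s\<in>S. f s) = (\<Sum>s\<in>S. dual m (f s))"
  by (induction S rule: infinite_finite_induct) (simp_all add: dual_linear)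

lemma dual_decomposables: "f \<in> A.decomposables \<delta>1 N1 n \<Longrightarrow> dual m f = 0"
proof -
  assume f: "f \<in> A.decomposables \<delta>1 N1 n"
  obtain t k l where m: "m = (t, k, l)" by (cases m)
  have "(if t = 1 then (0, 2 ^ k, 0) else (0, 0, 2 ^ k)) = gen_exp (if t = 1 then Suc (2 * k) else 2 * k)"
    by (simp add: gen_exp_def)
  then show ?thesis using decomposables_coeff[OF N1_positive f] by (simp add: dual_def m del: if_split)
qed

text \<open>The correction terms of the exchange relations are invisible to the functionals: the coefficient
  at an \<open>xx\<close> contains \<open>kZ\<close> or \<open>kY\<close>, the coefficient at a
  \<open>yy\<close> contains \<open>kZ\<close>.\<close>

lemma dual_std:
  assumes "k \<noteq> l" "j \<le> min (2 ^ k) (2 ^ l)"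
  shows "dual m (std (j, 2 ^ l - j, 2 ^ k - j)) = 0"
proof -
  obtain t k0 l0 where m: "m = (t, k0, l0)" by (cases m)
  have ne: "(2 ^ k :: nat) \<noteq> 2 ^ l" using assms(1) by simp
  let ?a = "2 ^ k - j" and ?b = "2 ^ l - j"
  consider "?a \<noteq> 0" | "?a = 0" "?b \<noteq> 0" using ne assms(2) by fastforce
  then show ?thesis
  proof cases
    case 1
    then have "std (j, ?b, ?a) = mon (j, ?b, ?a - 2 ^ some_bit ?a) \<odot> xx (some_bit ?a)"
      by (simp add: divided_lift_def act_act mon_eq mult.assoc)
    then have "dual m (std (j, ?b, ?a)) = (if t = 0 \<and> l0 = some_bit ?a then
        lookup (coord (mon (j, ?b, ?a - 2 ^ some_bit ?a) :: 'k kostant)) (0, 0, 2 ^ k0) else 0)"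
      by (auto simp: dual_def m A.lookup_unit simp del: std.simps) presburger+
    also have "\<dots> = 0" by (auto simp: lookup_coord_mon)
    finally show ?thesis .
  next
    case 2
    then have "j \<noteq> 0" by (metis diff_zero power_not_zero zero_neq_numeral)
    from 2 have "std (j, ?b, ?a) = mon (j, ?b - 2 ^ some_bit ?b, 0) \<odot> yy (some_bit ?b)"
      by (simp add: divided_lift_def act_act mon_eq H.zero_simps)
    then show ?thesis using \<open>j \<noteq> 0\<close>
      by (auto simp: dual_def m A.lookup_unit lookup_coord_mon simp del: std.simps)
  qed
qed

lemma dual_rel:
  assumes "m \<in> rel_index" "m0 \<in> rel_index"
  shows "dual m0 (rel m) = (if m = m0 then 1 else 0)"
proof -
  obtain t k l t0 k0 l0 where m: "m = (t, k, l)" "m0 = (t0, k0, l0)" by (cases m; cases m0)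
  have par: "2 * i \<noteq> Suc (2 * j)" "Suc (2 * j) \<noteq> 2 * i" for i j :: nat by presburger+
  consider "t = 0" | "t = 1" | "t = 2" "k \<noteq> l" using assms by (auto simp: m rel_index_def less_2_cases_iff)
  then show ?thesis
  proof cases
    case 1
    then show ?thesis using assms
      by (auto simp: m rel_index_def dual_def A.lookup_unit lookup_minus coord_minus mon_single lookup_coord_mon par)
  next
    case 2
    then show ?thesis using assms
      by (auto simp: m rel_index_def dual_def A.lookup_unit lookup_minus coord_minus mon_single lookup_coord_mon par)
  next
    case 3
    then have "dual m0 (rel m) = dual m0 (kX (2 ^ k) \<odot> yy l)"
      by (simp add: m dual_linear dual_sum dual_std del: std.simps)
    also have "\<dots> = (if m = m0 then 1 else 0)" using assms 3
      by (auto simp: m rel_index_def dual_def A.lookup_unit mon_single lookup_coord_mon par)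
    finally show ?thesis .
  qed
qed

lemma minimal_generators_1: "A.minimal_generators \<delta>1 N1 rel_codes \<delta>2 rel_elt"
  unfolding A.minimal_generators_def
proof (intro conjI ballI allI impI)
  fix j assume "j \<in> rel_codes"
  then obtain t k l where j: "j = to_nat (t, k, l)" "(t, k, l) \<in> rel_index" by (auto simp: rel_codes_def)
  then show "rel_elt j \<in> N1" using lin_gen_elt_rel by (simp add: N1_def rel_elt_def del: rel.simps)
  show "A.prF \<delta>1 (\<delta>2 j) (rel_elt j) = rel_elt j"
    using homogeneous_rel[OF j(2)] by (simp add: j(1) rel_elt_def \<delta>2_def del: rel.simps)
next
  fix f assume "f \<in> N1"
  then show "\<exists>h. keys h \<subseteq> rel_codes \<and> A.lin rel_elt h = f"
    using N1_generated by (auto simp: rel_module_def)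
next
  fix n h
  assume h: "keys h \<subseteq> {j\<in>rel_codes. \<delta>2 j = n} \<and> (\<forall>j. lookup h j \<in> range scal) \<and>
    A.lin rel_elt h \<in> A.decomposables \<delta>1 N1 n"
  have "\<forall>j. \<exists>r. lookup h j = scal r"
  proof
    fix j
    have "lookup h j \<in> range scal" using h by blast
    then show "\<exists>r. lookup h j = scal r" by blast
  qed
  from choice[OF this] obtain r where r: "\<And>j. lookup h j = scal (r j)" by blast
  have r_0: "r j = 0" if "j \<in> keys h" for j
  proof -
    have rel_index: "from_nat i \<in> rel_index" "to_nat (from_nat i :: nat \<times> nat \<times> nat) = i" if "i \<in> keys h" for i
      using h that by (auto simp: rel_codes_def)
    have "0 = dual (from_nat j) (A.lin rel_elt h)" using dual_decomposables[of "A.lin rel_elt h" n "from_nat j"] h by simp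
    also have "\<dots> = (\<Sum>i\<in>keys h. r i * dual (from_nat j) (rel (from_nat i)))"
      by (simp add: A.lin_def pm_sum_def dual_sum r dual_linear rel_elt_def del: rel.simps)
    also have "\<dots> = (\<Sum>i\<in>keys h. if i = j then r j else 0)"
    proof (intro sum.cong refl)
      fix i assume i: "i \<in> keys h"
      have "(from_nat i :: nat \<times> nat \<times> nat) = from_nat j \<longleftrightarrow> i = j" using rel_index(2)[OF i] rel_index(2)[OF that] by metis
      then show "r i * dual (from_nat j) (rel (from_nat i)) = (if i = j then r j else 0)"
        using dual_rel[OF rel_index(1)[OF i] rel_index(1)[OF that]] by (simp del: rel.simps)
    qed
    also have "\<dots> = r j" using that by simp
    finally show ?thesis by simp
  qed
  have "lookup h j = 0" for j
  proof (cases "j \<in> keys h")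
    case True
    show ?thesis unfolding r r_0[OF True] by (rule scal_simps)
  qed (simp add: in_keys_iff)
  then show "h = 0" by (intro poly_mapping_eqI) simp
qed

end

section \<open>The trivial module and the minimal resolution\<close>

context kostant_char2 begin

text \<open>The augmentation of the algebra.\<close>

definition aug :: "'k kostant \<Rightarrow> 'k" where
  "aug t = lookup (coord t) (0, 0, 0)"

lemma aug_simps: "aug (s + t) = aug s + aug t" "aug (s - t) = aug s - aug t" "aug 0 = 0" "aug 1 = 1"
  by (simp_all add: aug_def coord_add coord_minus lookup_add lookup_minus coord_1)

lemma aug_scal: "aug (scal c) = c"
  using coord_scal[of c "1 :: 'k kostant" "(0, 0, 0)"] by (simp add: aug_def coord_1)

lemma proj_0_eq: "proj 0 t = scal (aug t)"
proof -
  obtain r where r: "proj 0 t = scal r" using A.pr_in[of 0 t] A.G_0 by auto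
  have "aug (proj 0 t) = aug t" by (simp add: aug_def coord_proj)
  then show ?thesis using aug_scal[of r] by (simp add: r)
qed

lemma aug_mult: "aug (s * t) = aug s * aug t"
proof -
  have "scal (aug (s * t)) = (scal (aug s * aug t) :: 'k kostant)"
    using A.pr_0_mult[of s t] by (simp add: proj_0_eq scal_simps)
  then show ?thesis using aug_scal by metis
qed

lemma aug_grading: "t \<in> kostant_grading d \<Longrightarrow> d \<noteq> 0 \<Longrightarrow> aug t = 0"
  unfolding kostant_grading_iff aug_def by (metis add_0 mult_0_right wt.simps)

text \<open>The scalar in the definition of the trivial module is the augmentation.\<close>

lemma smult_trivial: "smult (trivial_module :: ('k kostant, 'k) gmod) a x = aug a * x"
proof -
  have "a - pure_tensor c 1 \<in> positive_part kostant_grading \<longleftrightarrow> c = aug a" for c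
    using aug_scal[of c] unfolding positive_part_iff aug_def[symmetric]
    by (auto simp: aug_simps scal_def)
  then show ?thesis by (simp add: trivial_module_def)
qed

lemma carrier_trivial: "carrier (trivial_module :: ('k kostant, 'k) gmod) = UNIV"
  and component_trivial: "component (trivial_module :: ('k kostant, 'k) gmod) n = (if n = 0 then UNIV else {0})"
  by (simp_all add: trivial_module_def)

lemma graded_module_trivial: "graded_module kostant_grading (trivial_module :: ('k kostant, 'k) gmod)"
  unfolding graded_module_def additive_subgroup_def carrier_trivial smult_trivial component_trivial
proof (intro conjI ballI allI)
  fix x :: 'k
  show "\<exists>!f :: nat \<Rightarrow>\<^sub>0 'k. (\<forall>n. lookup f n \<in> (if n = 0 then UNIV else {0})) \<and>
      x = (\<Sum>n\<in>keys f. lookup f n)"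
  proof (rule unique_decomposition[where P = "\<lambda>n x. if n = 0 then x else 0"])
    have "{n :: nat. (if n = 0 then x else 0) \<noteq> 0} = (if x = 0 then {} else {0})" by auto
    then show "finite {n :: nat. (if n = 0 then x else 0) \<noteq> 0}"
      "(\<Sum>n | (if n = 0 then x else 0) \<noteq> 0. if n = (0 :: nat) then x else 0) = x" by simp_all
  qed (auto split: if_splits)
next
  fix d n :: nat and a :: "'k kostant" and x :: 'k assume "a \<in> kostant_grading d" "x \<in> (if n = 0 then UNIV else {0})"
  then show "aug a * x \<in> (if d + n = 0 then UNIV else {0})"
    using aug_grading[of a d] by (cases "d = 0"; cases "n = 0") auto
qed (auto simp: aug_simps aug_mult algebra_simps)

lemma eps_eq: "eps f = aug (lookup f 0)"
  by (simp add: eps_def aug_def)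

lemma graded_hom_eps: "graded_hom (A.free {0} (\<lambda>_. 0)) (trivial_module :: ('k kostant, 'k) gmod) eps"
  unfolding graded_hom_def A.carrier_free A.smult_free A.component_free carrier_trivial smult_trivial component_trivial
proof (intro conjI ballI allI)
  fix n and f :: "nat \<Rightarrow>\<^sub>0 'k kostant" assume "f \<in> {f. keys f \<subseteq> {0} \<and> A.prF (\<lambda>_. 0) n f = f}"
  then have "lookup f 0 = proj n (lookup f 0)"
    using A.lookup_prF[of "\<lambda>_. 0" n f 0] by simp
  then have "lookup f 0 \<in> kostant_grading n" using A.pr_in by metis
  then show "eps f \<in> (if n = 0 then UNIV else {0})" using aug_grading by (simp add: eps_eq)
qed (simp_all add: eps_eq lookup_add aug_simps aug_mult)

lemma graded_submodule_N0: "A.graded_submodule {0} (\<lambda>_. 0) N0"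
  unfolding A.graded_submodule_def
proof (intro conjI ballI allI)
  show "submodule N0"
  proof
    fix a u assume "u \<in> N0"
    then show "a \<odot> u \<in> N0" using A.keys_act[of a u] by (auto simp: N0_def eps_eq aug_mult)
  qed (auto simp: N0_def eps_eq aug_simps lookup_minus dest: A.keys_diff_subset)
  fix f n assume f: "f \<in> N0"
  then show "keys f \<subseteq> {0}" by (simp add: N0_def)
  show "A.prF (\<lambda>_. 0) n f \<in> N0"
    using f A.keys_prF[of "\<lambda>_. 0" n f] by (auto simp: N0_def eps_def A.lookup_prF coord_proj)
qed

lemma eps_surj: "eps ` carrier (A.free {0} (\<lambda>_. 0)) = carrier (trivial_module :: ('k kostant, 'k) gmod)"
proof -
  have "c = eps (Poly_Mapping.single 0 (scal c))" for c by (simp add: eps_eq aug_scal)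
  moreover have "Poly_Mapping.single 0 (scal c) \<in> carrier (A.free {0} (\<lambda>_. 0))" for c by simp
  ultimately show ?thesis unfolding carrier_trivial by blast
qed

lemma free_1_iso: "A.free UNIV \<delta>1 \<cong>\<^sub>g
  direct_sum (UNIV :: nat set) (\<lambda>k. direct_power (kostant_shift (2 ^ k) :: ('k kostant, 'k kostant) gmod) 2)"
proof (rule A.free_powers_iso)
  show "bij_betw (\<lambda>j. (j div 2, j mod 2)) UNIV ((UNIV :: nat set) \<times> {..<2 :: nat})"
    by (rule bij_betw_byWitness[where f' = "\<lambda>(k, t). 2 * k + t"]) auto
qed (simp add: \<delta>1_def)

text \<open>The relations of degree \<open>2 ^ (k + 1)\<close>, and those of degree \<open>2 ^ l + 2 ^
  k\<close> with \<open>k < l\<close>.\<close>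

definition rel_codes_squares :: "nat set" where "rel_codes_squares = to_nat ` {(t :: nat, k :: nat, l :: nat). t < 2 \<and> k = l}"
definition rel_codes_mixed :: "nat set" where
  "rel_codes_mixed = to_nat ` {(t :: nat, k :: nat, l :: nat). t < 2 \<and> k < l \<or> t = 2 \<and> k \<noteq> l}"

lemma rel_codes_eq: "rel_codes = rel_codes_squares \<union> rel_codes_mixed" "rel_codes_squares \<inter> rel_codes_mixed = {}"
  by (auto simp: rel_codes_def rel_codes_squares_def rel_codes_mixed_def rel_index_def image_iff)

lemma bij_betw_from_nat: "bij_betw from_nat (to_nat ` S) (S :: 'c::countable set)"
  by (rule bij_betw_byWitness[where f' = to_nat]) auto

lemma free_squares_iso: "A.free rel_codes_squares \<delta>2 \<cong>\<^sub>g
  direct_sum (UNIV :: nat set) (\<lambda>k. direct_power (kostant_shift (2 ^ (k + 1)) :: ('k kostant, 'k kostant) gmod) 2)"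
proof (rule A.free_powers_iso)
  let ?h = "\<lambda>(t :: nat, k :: nat, l :: nat). (k, t)"
  have "bij_betw ?h {(t, k, l). t < 2 \<and> k = l} (UNIV \<times> {..<2})"
    by (rule bij_betw_byWitness[where f' = "\<lambda>(k, t). (t, k, k)"]) auto
  with bij_betw_from_nat show "bij_betw (?h \<circ> from_nat) rel_codes_squares (UNIV \<times> {..<2})"
    unfolding rel_codes_squares_def by (rule bij_betw_trans)
  show "\<delta>2 j = 2 ^ (fst ((?h \<circ> from_nat) j) + 1)" if "j \<in> rel_codes_squares" for j
    using that by (auto simp: rel_codes_squares_def \<delta>2_def)
qed

lemma free_mixed_iso: "A.free rel_codes_mixed \<delta>2 \<cong>\<^sub>g direct_sum {(k :: nat, l :: nat). k < l}
  (\<lambda>(k, l). direct_power (kostant_shift (2 ^ l + 2 ^ k) :: ('k kostant, 'k kostant) gmod) 4)"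
proof -
  let ?s = "\<lambda>(k :: nat, l :: nat). 2 ^ l + 2 ^ k :: nat"
  have "A.free rel_codes_mixed \<delta>2 \<cong>\<^sub>g direct_sum {(k :: nat, l :: nat). k < l}
    (\<lambda>i. direct_power (kostant_shift (?s i) :: ('k kostant, 'k kostant) gmod) 4)"
  proof (rule A.free_powers_iso)
    \<comment> \<open>the four relations for \<open>k < l\<close>: two commutators and the two mixed relations, the last one with the roles of \<open>k\<close> and \<open>l\<close> exchanged\<close>
    let ?h = "\<lambda>(t :: nat, k :: nat, l :: nat). if k < l then ((k, l), t) else ((l, k), 3)"
    let ?h' = "\<lambda>((k :: nat, l :: nat), t :: nat). if t = 3 then (2, l, k) else (t, k, l)"
    have "bij_betw ?h {(t, k, l). t < 2 \<and> k < l \<or> t = 2 \<and> k \<noteq> l} ({(k, l). k < l} \<times> {..<4})"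
      by (rule bij_betw_byWitness[where f' = ?h']) (auto split: if_splits)
    with bij_betw_from_nat show "bij_betw (?h \<circ> from_nat) rel_codes_mixed ({(k, l). k < l} \<times> {..<4})"
      unfolding rel_codes_mixed_def by (rule bij_betw_trans)
    show "\<delta>2 j = ?s (fst ((?h \<circ> from_nat) j))" if "j \<in> rel_codes_mixed" for j
      using that by (auto simp: rel_codes_mixed_def \<delta>2_def)
  qed
  moreover have "(\<lambda>i. direct_power (kostant_shift (?s i) :: ('k kostant, 'k kostant) gmod) 4) =
      (\<lambda>(k, l). direct_power (kostant_shift (2 ^ l + 2 ^ k)) 4)"
    by (auto simp: fun_eq_iff)
  ultimately show ?thesis by simp
qed

lemma resolution: "\<exists>(F :: nat \<Rightarrow> ('k kostant, nat \<Rightarrow>\<^sub>0 'k kostant) gmod) d.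
    minimal_graded_projective_resolution kostant_grading F d eps (trivial_module :: ('k kostant, 'k) gmod) \<and>
    F 0 = A.free {0} (\<lambda>_. 0) \<and> F 1 = A.free UNIV \<delta>1 \<and> F 2 = A.free rel_codes \<delta>2"
proof (rule A.exists_minimal_resolution)
  show "proj 0 (lookup f i) = 0" if "keys f \<subseteq> {0}" "eps f = 0" for f i
  proof (cases "i = 0")
    case True
    then show ?thesis using that(2) by (simp add: proj_0_iff eps_def)
  next
    case False
    with that(1) have "i \<notin> keys f" by auto
    then show ?thesis by (simp add: in_keys_iff)
  qed
  show "A.minimal_generators (\<lambda>_. 0) {f. keys f \<subseteq> {0} \<and> eps f = 0} UNIV \<delta>1 gen_elt"
    using minimal_generators_0 by (simp add: N0_def)
  show "A.minimal_generators \<delta>1 {f. keys f \<subseteq> UNIV \<and> A.lin gen_elt f = 0} rel_codes \<delta>2 rel_elt"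
    using minimal_generators_1 by (simp add: N1_def)
  show "A.graded_submodule {0} (\<lambda>_. 0) {f. keys f \<subseteq> {0} \<and> eps f = 0}"
    using graded_submodule_N0 by (simp add: N0_def)
qed (rule graded_module_trivial graded_hom_eps eps_surj)+

end

theorem theorem3:
  assumes "CHAR('k::field) = 2"
  shows "\<exists>(F :: nat \<Rightarrow> ('k kostant, nat \<Rightarrow>\<^sub>0 'k kostant) gmod) d \<epsilon>.
    minimal_graded_projective_resolution kostant_grading F d \<epsilon> (trivial_module :: ('k kostant, 'k) gmod) \<and>
    F 0 \<cong>\<^sub>g (kostant_shift 0 :: ('k kostant, 'k kostant) gmod) \<and>
    F 1 \<cong>\<^sub>g direct_sum (UNIV :: nat set) (\<lambda>k. direct_power (kostant_shift (2 ^ k) :: ('k kostant, 'k kostant) gmod) 2) \<and>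
    F 2 \<cong>\<^sub>g binary_sum
      (direct_sum (UNIV :: nat set) (\<lambda>k. direct_power (kostant_shift (2 ^ (k + 1)) :: ('k kostant, 'k kostant) gmod) 2))
      (direct_sum {(k :: nat, l :: nat). k < l}
        (\<lambda>(k, l). direct_power (kostant_shift (2 ^ l + 2 ^ k) :: ('k kostant, 'k kostant) gmod) 4))"
proof -
  interpret kostant_char2 "TYPE('k)" by unfold_locales (rule assms)
  obtain F :: "nat \<Rightarrow> ('k kostant, nat \<Rightarrow>\<^sub>0 'k kostant) gmod" and d where
    res: "minimal_graded_projective_resolution kostant_grading F d eps (trivial_module :: ('k kostant, 'k) gmod)"
    and F: "F 0 = A.free {0} (\<lambda>_. 0)" "F 1 = A.free UNIV \<delta>1" "F 2 = A.free rel_codes \<delta>2"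
    using resolution by blast
  show ?thesis
  proof (intro exI[of _ F] exI[of _ d] exI[of _ eps] conjI res)
    show "F 0 \<cong>\<^sub>g kostant_shift 0"
      unfolding F by (rule A.free_single_iso)
    show "F 1 \<cong>\<^sub>g direct_sum (UNIV :: nat set) (\<lambda>k. direct_power (kostant_shift (2 ^ k)) 2)"
      unfolding F by (rule free_1_iso)
    show "F 2 \<cong>\<^sub>g binary_sum (direct_sum (UNIV :: nat set) (\<lambda>k. direct_power (kostant_shift (2 ^ (k + 1))) 2))
      (direct_sum {(k :: nat, l :: nat). k < l} (\<lambda>(k, l). direct_power (kostant_shift (2 ^ l + 2 ^ k)) 4))"
      unfolding F rel_codes_eq(1) by (rule A.free_sum_iso[OF rel_codes_eq(2) free_squares_iso free_mixed_iso])
  qed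
qed

end
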